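(* Let $f:\mathbb{R}^n\to\mathbb{R}$ satisfy: (1) $f$ is convex and twice differentiable, and for some constant $M>0$, $G(x)\preceq MI$ on the level set $\{x\in\mathbb{R}^n:f(x)\le f(x_1)\}$, where $x_1=x_1^{(1)}$ is the starting point; (2) $f$ has a minimizer $x_\ast$ for which $G(x_\ast)$ is non-singular (so $x_\ast$ is unique); (3) $G(x)$ is Lipschitz continuous in a neighborhood of $x_\ast$, with Lipschitz constant $\mu$. Let $S$ be a neighborhood of $x_\ast$ and $0<m\le M$ a constant such that $mI\preceq G(x)\preceq MI$ for all $x\in S$, and assume that the filter threshold satisfies $\tau\le m$. Then Block BFGS converges $Q$-superlinearly along the subsequence of steps in $D_k$, that is, $$\lim_{\substack{k\to\infty\\ i\in D_k}}\frac{\|x_k^{(i+1)}-x_\ast\|}{\|x_k^{(i)}-x_\ast\|}=0,$$ where the limit is over those pairs $(k,i)$ for which $s_k^{(i)}$ is a column of $D_k$ (i.e., for every $\varepsilon>0$ there is $K$ such that the quotient is less than $\varepsilon$ for all $k\ge K$ and all $i\in\{1,\dots,q\}$ such that $s_k^{(i)}$ is retained in $D_k$).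
   Context: Notation: $\|\cdot\|$ is the Euclidean norm, $\langle\cdot,\cdot\rangle$ the standard inner product, $g(x)=\nabla f(x)$, $G(x)=\nabla^2 f(x)$, and $A\preceq B$ means $B-A$ is positive semidefinite. Block BFGS. Inputs: a starting point $x_1^{(1)}=x_1\in\mathbb{R}^n$, a symmetric positive definite matrix $B_1\in\mathbb{R}^{n\times n}$, an integer $q\ge 1$, a filter threshold $\tau>0$, and line search parameters $0<\alpha<\frac12$, $\alpha<\beta<1$. For $k=1,2,3,\dots$: (i) For $i=1,\dots,q$: put $g_k^{(i)}=g(x_k^{(i)})$ and $d_k^{(i)}=-B_k^{-1}g_k^{(i)}$; choose a step size $\lambda=\lambda_k^{(i)}>0$ satisfying the Armijo-Wolfe conditions $f(x_k^{(i)}+\lambda d_k^{(i)})\le f(x_k^{(i)})+\alpha\lambda\langle g_k^{(i)},d_k^{(i)}\rangle$ and $\langle g(x_k^{(i)}+\lambda d_k^{(i)}),d_k^{(i)}\rangle\ge\beta\langle g_k^{(i)},d_k^{(i)}\rangle$, where $\lambda=1$ is always chosen whenever it satisfies both conditions; put $s_k^{(i)}=\lambda_k^{(i)}d_k^{(i)}$ and $x_k^{(i+1)}=x_k^{(i)}+s_k^{(i)}$. (ii) Put $G_k=G(x_k^{(q+1)})$, $S_k=[s_k^{(1)}\ \cdots\ s_k^{(q)}]$, and $D_k=\mathrm{FILTERSTEPS}(S_k,G_k)$. (iii) If $D_k$ is not empty, put $B_{k+1}=B_k-B_kD_k(D_k^TB_kD_k)^{-1}D_k^TB_k+G_kD_k(D_k^TG_kD_k)^{-1}D_k^TG_k$;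 if $D_k$ is empty, put $B_{k+1}=B_k$. Put $x_{k+1}^{(1)}=x_k^{(q+1)}$. FILTERSTEPS$(S,G)$ with threshold $\tau$: go through the columns of $S$ from left to right, keeping a list of retained columns, initially empty. If $D'$ is the matrix of columns retained so far and $s$ is the next column, let $\sigma^2=s^TGs-s^TGD'(D'^TGD')^{-1}D'^TGs$ (the second term is absent if $D'$ is empty); retain $s$ if $\sigma^2\ge\tau\|s\|^2$, otherwise discard it. The output $D$ is the matrix of retained columns; the values $\sigma^2$ of the retained columns are the diagonal entries of $\Sigma$ in the factorization $D^TGD=L\Sigma L^T$ with $L$ unit lower triangular and $\Sigma$ diagonal. It is assumed that no iterate has zero gradient, so that the algorithm produces infinite sequences. *)

theory Defs
  imports
    "HOL-Analysis.Analysis"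
    "Jordan_Normal_Form.Gauss_Jordan_Elimination"
begin

(* Both HOL-Analysis and Jordan_Normal_Form use these symbols; here they mean
   the component of a vector in R^n and the inner product of HOL-Analysis. *)
no_notation Matrix.vec_index (infixl \<open>$\<close> 100)
no_notation Matrix.scalar_prod (infix \<open>\<bullet>\<close> 70)

definition psd :: "real^'n^'n \<Rightarrow> bool" where
  "psd A \<longleftrightarrow> transpose A = A \<and> (\<forall>v. 0 \<le> v \<bullet> (A *v v))"

definition pos_def :: "real^'n^'n \<Rightarrow> bool" where
  "pos_def A \<longleftrightarrow> transpose A = A \<and> (\<forall>v. v \<noteq> 0 \<longrightarrow> 0 < v \<bullet> (A *v v))"

definition loewner_le :: "real^'n^'n \<Rightarrow> real^'n^'n \<Rightarrow> bool" (infix \<open>\<preceq>\<close> 50) where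
  "A \<preceq> B \<longleftrightarrow> psd (B - A)"

abbreviation identity_mat :: "real^'n^'n" (\<open>\<I>\<close>) where
  "\<I> \<equiv> Finite_Cartesian_Product.mat 1"

(* The number of columns of D varies along the algorithm, so an n x r matrix D is
   represented by the list ds of its r columns.  Matrices whose size depends on r
   are matrices of Jordan_Normal_Form, those of size n x n have type real^'n^'n. *)

(* D^T A D *)
definition compress :: "real^'n^'n \<Rightarrow> (real^'n) list \<Rightarrow> real mat" where
  "compress A ds =
     Matrix.mat (length ds) (length ds) (\<lambda>(i, j). (ds ! i) \<bullet> (A *v (ds ! j)))"

(* A D (D^T A D)^(-1) D^T A, written out entry by entry: A *v (ds ! i) is column i of A D
   and (ds ! j) v* A is row j of D^T A.  Meaningful when D^T A D is invertible; the zero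
   matrix when D has no columns. *)
definition block_term :: "real^'n^'n \<Rightarrow> (real^'n) list \<Rightarrow> real^'n^'n" where
  "block_term A ds =
     (let W = the (mat_inverse (compress A ds)) in
      \<chi> a b. \<Sum>i<length ds. \<Sum>j<length ds.
        (A *v (ds ! i)) $ a * W $$ (i, j) * ((ds ! j) v* A) $ b)"

(* sigma^2 for the next column s, given the list ds of columns retained so far *)
definition filter_value :: "real^'n^'n \<Rightarrow> (real^'n) list \<Rightarrow> real^'n \<Rightarrow> real" where
  "filter_value G ds s = s \<bullet> (G *v s) - s \<bullet> (block_term G ds *v s)"

(* FILTERSTEPS applied to the columns s 1, ..., s i: the increasing list of the indices of
   the retained columns.  Indices are recorded, rather than the columns themselves, because
   a discarded column may coincide with a retained one. *)
primrec retained :: "real \<Rightarrow> real^'n^'n \<Rightarrow> (nat \<Rightarrow> real^'n) \<Rightarrow> nat \<Rightarrow> nat list" where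
  "retained \<tau> G s 0 = []"
| "retained \<tau> G s (Suc i) =
     (let R = retained \<tau> G s i in
      if filter_value G (map s R) (s (Suc i)) \<ge> \<tau> * (norm (s (Suc i)))\<^sup>2
      then R @ [Suc i] else R)"

definition filter_steps :: "real \<Rightarrow> real^'n^'n \<Rightarrow> (nat \<Rightarrow> real^'n) \<Rightarrow> nat \<Rightarrow> (real^'n) list" where
  "filter_steps \<tau> G s q = map s (retained \<tau> G s q)"

definition block_update :: "real^'n^'n \<Rightarrow> real^'n^'n \<Rightarrow> (real^'n) list \<Rightarrow> real^'n^'n" where
  "block_update B G ds =
     (if ds = [] then B else B - block_term B ds + block_term G ds)"

definition armijo_wolfe ::
  "(real^'n \<Rightarrow> real) \<Rightarrow> (real^'n \<Rightarrow> real^'n) \<Rightarrow> real \<Rightarrow> real \<Rightarrow> real^'n \<Rightarrow> real^'n \<Rightarrow> real \<Rightarrow> bool"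
where
  "armijo_wolfe f g \<alpha> \<beta> x d t \<longleftrightarrow>
     f (x + t *\<^sub>R d) \<le> f x + \<alpha> * t * (g x \<bullet> d) \<and>
     g (x + t *\<^sub>R d) \<bullet> d \<ge> \<beta> * (g x \<bullet> d)"

(* The sequences x k i (1 <= i <= q + 1), s k i (1 <= i <= q) and B k, for k >= 1, are
   produced by a run of the algorithm on f, with gradient g and Hessian G.  This is a relation
   because the step sizes lam k i are only required to satisfy the line search conditions. *)
definition block_BFGS ::
  "(real^'n \<Rightarrow> real) \<Rightarrow> (real^'n \<Rightarrow> real^'n) \<Rightarrow> (real^'n \<Rightarrow> real^'n^'n) \<Rightarrow>
   real^'n \<Rightarrow> real^'n^'n \<Rightarrow> nat \<Rightarrow> real \<Rightarrow> real \<Rightarrow> real \<Rightarrow>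
   (nat \<Rightarrow> nat \<Rightarrow> real^'n) \<Rightarrow> (nat \<Rightarrow> nat \<Rightarrow> real^'n) \<Rightarrow> (nat \<Rightarrow> nat \<Rightarrow> real) \<Rightarrow>
   (nat \<Rightarrow> real^'n^'n) \<Rightarrow> bool"
where
  "block_BFGS f g G x1 B1 q \<tau> \<alpha> \<beta> x s lam B \<longleftrightarrow>
     x 1 1 = x1 \<and> B 1 = B1 \<and>
     (\<forall>k\<ge>1.
        (\<forall>i\<in>{1..q}.
           let d = - (matrix_inv (B k) *v g (x k i)) in
             lam k i > 0 \<and>
             armijo_wolfe f g \<alpha> \<beta> (x k i) d (lam k i) \<and>
             (armijo_wolfe f g \<alpha> \<beta> (x k i) d 1 \<longrightarrow> lam k i = 1) \<and>
             s k i = lam k i *\<^sub>R d \<and>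
             x k (i + 1) = x k i + s k i) \<and>
        (let Gk = G (x k (q + 1)) in
           B (k + 1) = block_update (B k) Gk (filter_steps \<tau> Gk (s k) q)) \<and>
        x (k + 1) 1 = x k (q + 1))"

end

theory Submission
  imports Defs "Jordan_Normal_Form.Determinant"
begin

text \<open>
  Why the theorem holds.  The proof follows the Powell and Byrd--Nocedal approach to BFGS: the matrices
  \<open>B k\<close> are controlled through the single real number \<open>\<psi> = trace (H B) - ln (det B)\<close>, which is
  bounded below and which, up to bounded errors, each retained step lowers according to how badly \<open>B\<close> fits along it.

  A block update is a chain of ordinary BFGS updates.  The term \<open>A D (D\<^sup>T A D)\<^sup>-\<^sup>1 D\<^sup>T A\<close> depends only on
  \<open>A\<close> and on the span of the columns of \<open>D\<close> (\<open>deflation_unique\<close>).  Hence the columns may be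
  added one at a time, in any order, and each new column \<open>s\<close> amounts to a BFGS update along the part \<open>t\<close>
  of \<open>s\<close> that is \<open>G\<close>-orthogonal to the previous columns (\<open>partial_update_step\<close>).  The determinant
  of one BFGS update is explicit (\<open>det_bfgs\<close>), so the block determinants never have to be handled.
  The filter value of \<open>s\<close> is exactly the number \<open>t \<bullet> G t\<close>, which is how the threshold \<open>\<tau>\<close> bounds the
  determinant from below (\<open>filtered_block_update\<close>).

  Global convergence uses \<open>H = \<I>\<close>.  An update raises the potential by at most a constant plus
  \<open>ln (cos\<^sup>2 \<theta>)\<close>, where \<open>\<theta>\<close> is the angle between any retained step \<open>s\<close> and \<open>B s\<close>
  (\<open>psi_filtered_update\<close>), whereas the Armijo-Wolfe conditions make \<open>f\<close> decrease by a multiple of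
  \<open>\<parallel>g\<parallel>\<^sup>2 cos\<^sup>2 \<theta>\<close> (\<open>line_search_step\<close>).  So small cosines are paid for by the potential.  Bounding
  \<open>exp\<close> below by a tangent turns the two inequalities into one Lyapunov function that moves by at least a fixed amount per
  update: \<open>1 / h - b \<psi>\<close> in general (\<open>sublinear_lyapunov\<close>), where \<open>h = f - f xs\<close>, and
  \<open>ln h + b \<psi>\<close> near \<open>xs\<close> (\<open>linear_lyapunov\<close>), where the first column passes the filter because
  \<open>\<tau> \<le> m\<close>.  The latter gives geometric decay, so the distances to \<open>xs\<close> are summable.

  Superlinear convergence uses \<open>H = (G xs)\<^sup>-\<^sup>1\<close>.  Now an update lowers the potential by the
  discrepancy between \<open>B\<close> and \<open>G xs\<close> along any retained step, up to an error at most of the order of the distance to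
  \<open>xs\<close> (\<open>psi_block_update\<close>, \<open>discrepancy_near\<close>).  The errors are summable and the potential is
  bounded below, so the discrepancies tend to 0, which is the Dennis--More condition \<open>(B - G xs) s = o(\<parallel>s\<parallel>)\<close>
  for all retained \<open>s\<close> (\<open>dennis_more\<close>).  Under it the unit step satisfies the line search conditions, is
  therefore taken, and reduces the error by a factor tending to 0 (\<open>quasi_newton_step\<close>).
\<close>

(* As in the definitions, components, inner products and det are those of real^'n. *)
no_notation Matrix.vec_index (infixl \<open>$\<close> 100)
no_notation Matrix.scalar_prod (infix \<open>\<bullet>\<close> 70)
hide_const (open) Determinant.det

section \<open>Positive semidefinite matrices and rank-one perturbations\<close>

lemma norm_matrix_vector_le:
  fixes A :: "real^'n^'m"
  shows "norm (A *v v) \<le> norm A * norm v"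
proof -
  have "norm (A *v v) = L2_set (\<lambda>i. norm (A $ i \<bullet> v)) UNIV"
    by (simp add: norm_vec_def matrix_vector_mul_component)
  also have "\<dots> \<le> L2_set (\<lambda>i. norm (A $ i) * norm v) UNIV"
    by (rule L2_set_mono) (simp_all add: Cauchy_Schwarz_ineq2)
  also have "\<dots> = norm A * norm v"
    by (simp add: norm_vec_def[of A] L2_set_left_distrib)
  finally show ?thesis .
qed

lemma symmetric_dot:
  fixes A :: "real^'n^'n"
  assumes "transpose A = A"
  shows "(A *v x) \<bullet> y = x \<bullet> (A *v y)"
  using assms by (metis dot_lmul_matrix transpose_matrix_vector)

lemma symmetricI:
  fixes A :: "real^'n^'n"
  assumes "\<And>x y. (A *v x) \<bullet> y = x \<bullet> (A *v y)"
  shows "transpose A = A"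
proof -
  have "(transpose A *v x) \<bullet> y = (A *v x) \<bullet> y" for x y
    by (simp add: dot_lmul_matrix assms)
  then have "transpose A *v x = A *v x" for x
    by (metis vector_eq_rdot)
  then show ?thesis by (simp add: matrix_eq)
qed

lemma pos_def_imp_psd: "pos_def A \<Longrightarrow> psd A"
  unfolding pos_def_def psd_def by (metis inner_zero_left less_eq_real_def)

lemma psd_Cauchy_Schwarz:
  assumes "psd A"
  shows "(x \<bullet> (A *v y))\<^sup>2 \<le> (x \<bullet> (A *v x)) * (y \<bullet> (A *v y))"
proof -
  define a b c where "a = x \<bullet> (A *v x)" and "b = x \<bullet> (A *v y)" and "c = y \<bullet> (A *v y)"
  have sym: "y \<bullet> (A *v x) = b"
    using assms symmetric_dot[of A y x] by (simp add: psd_def b_def inner_commute)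
  have q: "0 \<le> a + 2 * r * b + r\<^sup>2 * c" for r
  proof -
    have "0 \<le> (x + r *\<^sub>R y) \<bullet> (A *v (x + r *\<^sub>R y))" using assms by (simp add: psd_def)
    also have "\<dots> = a + 2 * r * b + r\<^sup>2 * c"
      by (simp add: a_def[symmetric] b_def[symmetric] c_def[symmetric] sym matrix_vector_right_distrib
          matrix_vector_mult_scaleR inner_add_left inner_add_right algebra_simps power2_eq_square)
    finally show ?thesis .
  qed
  have "b\<^sup>2 \<le> a * c"
  proof (cases "c = 0")
    case True
    have "b = 0"
    proof (rule ccontr)
      assume "b \<noteq> 0"
      then have "a + 2 * (- (a + 1) / (2 * b)) * b + (- (a + 1) / (2 * b))\<^sup>2 * c = -1"
        using True by (simp add: field_simps)
      with q[of "- (a + 1) / (2 * b)"] show False by simp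
    qed
    then show ?thesis using True by simp
  next
    case False
    have "c \<ge> 0" using assms by (simp add: c_def psd_def)
    with False have "c > 0" by simp
    have "a + 2 * (- b / c) * b + (- b / c)\<^sup>2 * c = a - b\<^sup>2 / c"
      using \<open>c > 0\<close> by (simp add: field_simps power2_eq_square)
    with q[of "- b / c"] have "b\<^sup>2 / c \<le> a" by simp
    then show ?thesis using \<open>c > 0\<close> by (simp add: field_simps)
  qed
  then show ?thesis by (simp add: a_def b_def c_def)
qed

lemma psd_kernel:
  assumes "psd A" and "x \<bullet> (A *v x) = 0"
  shows "A *v x = 0"
proof -
  have "((A *v x) \<bullet> (A *v x))\<^sup>2 \<le> 0"
    using psd_Cauchy_Schwarz[OF assms(1), of "A *v x" x] assms(2) by simp
  then show ?thesis by simp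
qed

text \<open>A trace bound in place of the largest eigenvalue: the Cauchy-Schwarz inequality for the form of \<open>A\<close>,
  applied to \<open>v\<close> and each unit vector, and summed.\<close>

lemma psd_norm_trace:
  assumes "psd A"
  shows "(norm (A *v v))\<^sup>2 \<le> trace A * (v \<bullet> (A *v v))"
proof -
  have e: "(A *v v) $ i = axis i 1 \<bullet> (A *v v)" "A $ i $ i = axis i 1 \<bullet> (A *v axis i 1)" for i
    by (simp_all add: inner_axis' matrix_vector_mul_component inner_axis)
  have "(norm (A *v v))\<^sup>2 = (\<Sum>i\<in>UNIV. ((A *v v) $ i)\<^sup>2)"
    by (simp only: power2_norm_eq_inner inner_vec_def) (simp add: power2_eq_square)
  also have "\<dots> \<le> (\<Sum>i\<in>UNIV. A $ i $ i * (v \<bullet> (A *v v)))"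
    unfolding e by (intro sum_mono psd_Cauchy_Schwarz assms)
  finally show ?thesis by (simp add: trace_def sum_distrib_right)
qed

lemma psd_trace_nonneg:
  assumes "psd A"
  shows "0 \<le> trace A"
proof -
  have "A $ i $ i = axis i 1 \<bullet> (A *v axis i 1)" for i
    by (simp_all add: inner_axis' matrix_vector_mul_component inner_axis)
  then show ?thesis using assms by (simp add: trace_def sum_nonneg psd_def)
qed

definition outer :: "real^'n \<Rightarrow> real^'n \<Rightarrow> real^'n^'n" where
  "outer a b = (\<chi> i j. a $ i * b $ j)"

lemma outer_mult_vec [simp]: "outer a b *v v = (b \<bullet> v) *\<^sub>R a"
  by (simp add: outer_def Finite_Cartesian_Product.vec_eq_iff matrix_vector_mult_def inner_vec_def sum_distrib_left mult_ac)

lemma outer_scaleR: "outer (r *\<^sub>R a) b = r *\<^sub>R outer a b"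
  by (simp add: outer_def Finite_Cartesian_Product.vec_eq_iff)

lemma trace_mult_outer: "trace (H ** outer a b) = b \<bullet> (H *v a)"
proof -
  have "trace (H ** outer a b) = (\<Sum>i\<in>UNIV. b $ i * (H *v a) $ i)"
    by (simp add: trace_def matrix_matrix_mult_def outer_def matrix_vector_mult_def
        sum_distrib_left mult_ac)
  then show ?thesis by (simp add: inner_vec_def)
qed

lemma scaleR_mult_vec: "(r *\<^sub>R A) *v v = r *\<^sub>R ((A :: real^'n^'m) *v v)"
  by (simp add: Finite_Cartesian_Product.vec_eq_iff matrix_vector_mult_def sum_distrib_left mult_ac)

text \<open>The matrix determinant lemma.  A rotation reduces it to the case where \<open>v\<close> is a multiple of a unit vector;
  there only one column of the identity changes, and Cramer's rule applies.\<close>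

lemma det_identity_plus_outer: "det (\<I> + outer u v) = 1 + u \<bullet> v" for u v :: "real^'n"
proof (cases "v = 0")
  case True
  then have "outer u v = 0" by (simp add: outer_def Finite_Cartesian_Product.vec_eq_iff)
  then show ?thesis using True by simp
next
  case False
  define k :: 'n where "k = (SOME k. True)"
  have "norm (axis k (norm v) :: real^'n) = norm v" 
  proof -
    have "axis k (norm v) = norm v *\<^sub>R (axis k 1 :: real^'n)"
      by (simp add: Finite_Cartesian_Product.vec_eq_iff axis_def)
    then show ?thesis by simp
  qed
  then obtain f where f: "orthogonal_transformation f" and fk: "f (axis k (norm v)) = v"
    using orthogonal_transformation_exists by blast
  define P where "P = matrix f"
  have lin: "linear f" using f by (simp add: orthogonal_transformation_def)
  have P: "P *v x = f x" for x by (simp add: P_def lin)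
  have dotP: "(P *v x) \<bullet> (P *v y) = x \<bullet> y" for x y
    using f by (simp add: P orthogonal_transformation_def)
  have orth: "transpose P ** P = \<I>"
    using f orthogonal_transformation_matrix unfolding orthogonal_matrix P_def by blast
  define w where "w = transpose P *v u"
  have wdot: "w \<bullet> x = u \<bullet> (P *v x)" for x by (simp add: w_def dot_lmul_matrix)
  have eq: "transpose P ** (\<I> + outer u v) ** P = \<I> + outer w (axis k (norm v))"
  proof -
    have "(transpose P ** (\<I> + outer u v) ** P) *v x = (\<I> + outer w (axis k (norm v))) *v x" for x
    proof -
      have "(transpose P ** (\<I> + outer u v) ** P) *v x
          = (transpose P ** P) *v x + (v \<bullet> (P *v x)) *\<^sub>R (transpose P *v u)"
        by (simp only: matrix_vector_mul_assoc[symmetric] matrix_vector_mult_add_rdistrib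
            outer_mult_vec matrix_vector_mul_lid matrix_vector_right_distrib matrix_vector_mult_scaleR)
      also have "v \<bullet> (P *v x) = axis k (norm v) \<bullet> x"
        using dotP[of "axis k (norm v)" x] by (simp add: P fk)
      finally show ?thesis
        by (simp add: orth w_def matrix_vector_mult_add_rdistrib del: transpose_matrix_vector)
    qed
    then show ?thesis by (simp add: matrix_eq)
  qed
  have "\<I> + outer w (axis k (norm v)) =
      (\<chi> i j. if j = k then (\<I> *v (axis k 1 + norm v *\<^sub>R w)) $ i else \<I> $ i $ j)"
    unfolding matrix_vector_mul_lid
    by (auto simp: Finite_Cartesian_Product.vec_eq_iff outer_def axis_def Finite_Cartesian_Product.mat_def)
  then have "det (\<I> + outer w (axis k (norm v))) = (axis k 1 + norm v *\<^sub>R w) $ k"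
    by (simp only: cramer_lemma det_I mult_1_right)
  also have "\<dots> = 1 + w \<bullet> axis k (norm v)"
    unfolding inner_axis by (simp add: axis_def)
  also have "\<dots> = 1 + u \<bullet> v" by (simp add: wdot P fk)
  finally have "det (transpose P ** (\<I> + outer u v) ** P) = 1 + u \<bullet> v" by (simp add: eq)
  moreover have "det (transpose P) * det P = 1"
    using arg_cong[OF orth, of det] by (simp only: det_mul det_I)
  moreover have "det (transpose P ** (\<I> + outer u v) ** P)
      = det (transpose P) * det P * det (\<I> + outer u v)"
    by (simp only: det_mul mult_ac)
  ultimately show ?thesis by simp
qed

lemma det_plus_outer: "det (C + outer (C *v u) v) = det C * (1 + u \<bullet> v)"
proof -
  have "C + outer (C *v u) v = C ** (\<I> + outer u v)"
    by (simp add: matrix_eq matrix_vector_mult_add_rdistrib matrix_vector_mul_assoc[symmetric]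
        matrix_vector_right_distrib matrix_vector_mult_scaleR)
  then show ?thesis by (simp add: det_mul det_identity_plus_outer)
qed

lemma pos_def_invertible:
  assumes "pos_def A"
  shows "invertible A"
proof -
  have "inj ((*v) A)"
  proof (rule injI)
    fix x y assume "A *v x = A *v y"
    then have "(x - y) \<bullet> (A *v (x - y)) = 0" by (simp add: matrix_vector_mult_diff_distrib)
    then show "x = y" using assms unfolding pos_def_def by (metis less_irrefl right_minus_eq)
  qed
  then show ?thesis using matrix_left_invertible_injective invertible_left_inverse by blast
qed

lemma matrix_inv_mult_vec:
  fixes A :: "real^'n^'n"
  assumes "invertible A"
  shows "A *v (matrix_inv A *v v) = v" "matrix_inv A *v (A *v v) = v"
proof -
  have "A ** matrix_inv A = \<I> \<and> matrix_inv A ** A = \<I>"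
    using assms unfolding invertible_def matrix_inv_def by (rule someI_ex)
  then show "A *v (matrix_inv A *v v) = v" "matrix_inv A *v (A *v v) = v"
    by (simp_all add: matrix_vector_mul_assoc)
qed

lemma pos_def_matrix_inv:
  assumes "pos_def A"
  shows "pos_def (matrix_inv A)"
proof -
  note inv = matrix_inv_mult_vec[OF pos_def_invertible[OF assms]]
  have sym: "transpose A = A" using assms by (simp add: pos_def_def)
  have "transpose (matrix_inv A) = matrix_inv A"
    by (rule symmetricI) (metis inv(1) sym symmetric_dot)
  moreover have "0 < v \<bullet> (matrix_inv A *v v)" if "v \<noteq> 0" for v
  proof -
    have "matrix_inv A *v v \<noteq> 0" using inv(1)[of v] that by auto
    then have "0 < (matrix_inv A *v v) \<bullet> (A *v (matrix_inv A *v v))"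
      using assms by (simp add: pos_def_def)
    then show ?thesis by (simp add: inv inner_commute)
  qed
  ultimately show ?thesis by (simp add: pos_def_def)
qed

section \<open>The BFGS update\<close>

definition bfgs :: "real^'n^'n \<Rightarrow> real^'n \<Rightarrow> real^'n \<Rightarrow> real^'n^'n" where
  "bfgs C y t = C - (1 / (t \<bullet> (C *v t))) *\<^sub>R outer (C *v t) (C *v t) + (1 / (y \<bullet> t)) *\<^sub>R outer y y"

lemma bfgs_mult_vec:
  "bfgs C y t *v v = C *v v - (((C *v t) \<bullet> v) / (t \<bullet> (C *v t))) *\<^sub>R (C *v t) + ((y \<bullet> v) / (y \<bullet> t)) *\<^sub>R y"
  by (simp add: bfgs_def matrix_vector_mult_add_rdistrib matrix_vector_mult_diff_rdistrib scaleR_mult_vec)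

lemma pos_def_bfgs:
  assumes C: "pos_def C" and yt: "y \<bullet> t > 0"
  shows "pos_def (bfgs C y t)"
proof -
  have sym: "transpose C = C" using C by (simp add: pos_def_def)
  have t: "t \<noteq> 0" using yt by auto
  then have tCt: "t \<bullet> (C *v t) > 0" using C by (simp add: pos_def_def)
  have "transpose (bfgs C y t) = bfgs C y t"
  proof (rule symmetricI)
    fix a b
    have "b \<bullet> (C *v a) = a \<bullet> (C *v b)" by (metis inner_commute sym symmetric_dot)
    then show "(bfgs C y t *v a) \<bullet> b = a \<bullet> (bfgs C y t *v b)"
      by (simp add: bfgs_mult_vec inner_add_left inner_add_right inner_diff_left inner_diff_right
        inner_commute mult.commute)
  qed
  moreover have "0 < v \<bullet> (bfgs C y t *v v)" if v: "v \<noteq> 0" for v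
  proof -
    \<comment> \<open>\<open>r t\<close> is the projection of \<open>v\<close> on \<open>t\<close> for the form of \<open>C\<close>; what remains is the form at \<open>v - r t\<close> plus a square, and the two cannot vanish together\<close>
    define r where "r = (v \<bullet> (C *v t)) / (t \<bullet> (C *v t))"
    have sw: "t \<bullet> (C *v v) = v \<bullet> (C *v t)" by (metis inner_commute sym symmetric_dot)
    have sw': "(C *v t) \<bullet> v = v \<bullet> (C *v t)" by (rule inner_commute)
    have res: "(v - r *\<^sub>R t) \<bullet> (C *v (v - r *\<^sub>R t))
        = v \<bullet> (C *v v) - (v \<bullet> (C *v t))\<^sup>2 / (t \<bullet> (C *v t))"
      using tCt by (simp add: r_def matrix_vector_mult_diff_distrib matrix_vector_mult_scaleR
          inner_diff_left inner_diff_right sw power2_eq_square field_simps)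
    have eq: "v \<bullet> (bfgs C y t *v v) = (v - r *\<^sub>R t) \<bullet> (C *v (v - r *\<^sub>R t)) + (y \<bullet> v)\<^sup>2 / (y \<bullet> t)"
      unfolding res by (simp add: bfgs_mult_vec inner_add_right inner_diff_right sw'
          power2_eq_square inner_commute[of y v])
    show ?thesis
    proof (cases "v = r *\<^sub>R t")
      case True
      then have "r \<noteq> 0" using v by auto
      then have "y \<bullet> v \<noteq> 0" using True yt by simp
      then have "0 < (y \<bullet> v)\<^sup>2 / (y \<bullet> t)" using yt by simp
      then show ?thesis using eq True by simp
    next
      case False
      then have "0 < (v - r *\<^sub>R t) \<bullet> (C *v (v - r *\<^sub>R t))" using C by (simp add: pos_def_def)
      moreover have "0 \<le> (y \<bullet> v)\<^sup>2 / (y \<bullet> t)" using yt by simp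
      ultimately show ?thesis using eq by simp
    qed
  qed
  ultimately show ?thesis by (simp add: pos_def_def)
qed

text \<open>BFGS adds one outer product and subtracts another, so the determinant lemma is applied twice, with the addition
  first: subtracting first would pass through a singular matrix.\<close>

lemma det_bfgs:
  assumes C: "pos_def C" and yt: "y \<bullet> t > 0"
  shows "det (bfgs C y t) = det C * ((y \<bullet> t) / (t \<bullet> (C *v t)))"
proof -
  have sym: "transpose C = C" using C by (simp add: pos_def_def)
  have t: "t \<noteq> 0" using yt by auto
  define T where "T = t \<bullet> (C *v t)"
  have tCt: "T > 0" using C t by (simp add: pos_def_def T_def)
  define z where "z = matrix_inv C *v y"
  have Cz: "C *v z = y" by (simp add: z_def matrix_inv_mult_vec(1)[OF pos_def_invertible[OF C]])
  define \<delta> where "\<delta> = (z \<bullet> y) / (y \<bullet> t)"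
  have "z \<bullet> (C *v z) \<ge> 0" using pos_def_imp_psd[OF C] by (simp add: psd_def)
  then have \<delta>: "1 + \<delta> > 0" using yt by (simp add: \<delta>_def Cz add_pos_nonneg)
  define C1 where "C1 = C + (1 / (y \<bullet> t)) *\<^sub>R outer y y"
  have "C1 = C + outer (C *v ((1 / (y \<bullet> t)) *\<^sub>R z)) y"
    by (simp add: C1_def matrix_vector_mult_scaleR Cz outer_scaleR)
  then have d1: "det C1 = det C * (1 + \<delta>)"
    by (simp only: det_plus_outer) (simp add: \<delta>_def)
  \<comment> \<open>\<open>p\<close> is the preimage of \<open>C t\<close> under \<open>C1\<close>, so that the subtraction has the form of \<open>det_plus_outer\<close>\<close>
  define p where "p = t - (1 / (1 + \<delta>)) *\<^sub>R z"
  have C1v: "C1 *v v = C *v v + ((y \<bullet> v) / (y \<bullet> t)) *\<^sub>R y" for v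
    by (simp add: C1_def matrix_vector_mult_add_rdistrib scaleR_mult_vec)
  have "C1 *v z = (1 + \<delta>) *\<^sub>R y"
    by (simp add: C1v Cz \<delta>_def inner_commute scaleR_add_left)
  moreover have "C1 *v t = C *v t + y" using yt by (simp add: C1v)
  ultimately have C1p: "C1 *v p = C *v t"
    using \<delta> by (simp add: p_def matrix_vector_mult_diff_distrib matrix_vector_mult_scaleR)
  have zCt: "z \<bullet> (C *v t) = y \<bullet> t" by (metis Cz sym symmetric_dot)
  have "bfgs C y t = C1 + outer (C1 *v ((- 1 / T) *\<^sub>R p)) (C *v t)"
    unfolding matrix_vector_mult_scaleR C1p outer_scaleR by (simp add: bfgs_def C1_def T_def)
  then have "det (bfgs C y t) = det C * (1 + \<delta>) * (1 + ((- 1 / T) *\<^sub>R p) \<bullet> (C *v t))"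
    by (simp only: det_plus_outer d1)
  also have "((- 1 / T) *\<^sub>R p) \<bullet> (C *v t) = - 1 + (y \<bullet> t) / ((1 + \<delta>) * T)"
  proof -
    have "p \<bullet> (C *v t) = T - (y \<bullet> t) / (1 + \<delta>)" by (simp add: p_def inner_diff_left zCt T_def)
    then have "((- 1 / T) *\<^sub>R p) \<bullet> (C *v t) = (- 1 / T) * (T - (y \<bullet> t) / (1 + \<delta>))" by simp
    also have "\<dots> = - 1 + (y \<bullet> t) / ((1 + \<delta>) * T)" using tCt
      by (simp add: right_diff_distrib)
    finally show ?thesis .
  qed
  finally show ?thesis using \<delta> by (simp add: T_def)
qed

section \<open>Block updates as chains of BFGS updates\<close>

text \<open>The basis-free form of \<open>A D (D\<^sup>T A D)\<^sup>-\<^sup>1 D\<^sup>T A\<close>, where \<open>W\<close> is the span of the columns of \<open>D\<close>: it is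
  \<open>A\<close> composed with the \<open>A\<close>-orthogonal projection onto \<open>W\<close>.  A relation rather than a function, so that
  it also makes sense when \<open>A\<close> is only positive semidefinite.\<close>

definition deflation :: "real^'n^'n \<Rightarrow> (real^'n) set \<Rightarrow> real^'n^'n \<Rightarrow> bool" where
  "deflation A W P \<longleftrightarrow> transpose P = P \<and> (\<forall>w\<in>W. P *v w = A *v w) \<and> (\<forall>v. \<exists>w\<in>W. P *v v = A *v w)"

text \<open>Here \<open>w\<close> is the \<open>A\<close>-orthogonal projection of \<open>v\<close>, and the two equations are Pythagoras' theorem for the
  form of \<open>A\<close>.\<close>

lemma deflation_form:
  assumes A: "psd A" and P: "deflation A W P" and w: "w \<in> W" "P *v v = A *v w"
  shows "v \<bullet> (P *v v) = w \<bullet> (A *v w)"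
    and "v \<bullet> (A *v v) - v \<bullet> (P *v v) = (v - w) \<bullet> (A *v (v - w))"
proof -
  have sA: "transpose A = A" and sP: "transpose P = P"
    using A P by (auto simp: psd_def deflation_def)
  have "w \<bullet> (A *v w) = w \<bullet> (P *v v)" using w by simp
  also have "\<dots> = v \<bullet> (P *v w)" by (metis inner_commute sP symmetric_dot)
  also have "\<dots> = v \<bullet> (A *v w)" using w P by (simp add: deflation_def)
  finally have eq: "v \<bullet> (A *v w) = w \<bullet> (A *v w)" by simp
  then show 1: "v \<bullet> (P *v v) = w \<bullet> (A *v w)" using w by simp
  have "w \<bullet> (A *v v) = v \<bullet> (A *v w)" by (metis inner_commute sA symmetric_dot)
  then show "v \<bullet> (A *v v) - v \<bullet> (P *v v) = (v - w) \<bullet> (A *v (v - w))"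
    using eq 1 by (simp add: matrix_vector_mult_diff_distrib inner_diff_left inner_diff_right)
qed

lemma psd_deflation:
  assumes A: "psd A" and P: "deflation A W P"
  shows "psd P" and "psd (A - P)"
proof -
  have sA: "transpose A = A" and sP: "transpose P = P"
    using A P by (auto simp: psd_def deflation_def)
  have "0 \<le> v \<bullet> (P *v v) \<and> 0 \<le> v \<bullet> ((A - P) *v v)" for v
  proof -
    obtain w where w: "w \<in> W" "P *v v = A *v w" using P by (auto simp: deflation_def)
    show ?thesis using deflation_form[OF A P w] A
      by (simp add: psd_def matrix_vector_mult_diff_rdistrib inner_diff_right)
  qed
  moreover have "transpose (A - P) = A - P"
    by (rule symmetricI)
      (simp add: matrix_vector_mult_diff_rdistrib inner_diff_left inner_diff_right
        symmetric_dot[OF sA] symmetric_dot[OF sP])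
  ultimately show "psd P" "psd (A - P)" using sP by (simp_all add: psd_def)
qed

text \<open>If \<open>w\<close> and \<open>u\<close> are two projections of the same \<open>v\<close>, then \<open>w - u\<close> lies in \<open>W\<close> and is
  \<open>A\<close>-orthogonal to \<open>W\<close>, hence to itself, hence in the kernel of \<open>A\<close>.\<close>

lemma deflation_unique:
  assumes A: "psd A" and W: "subspace W" and P: "deflation A W P" and Q: "deflation A W Q"
  shows "P = Q"
proof -
  have "P *v v = Q *v v" for v
  proof -
    obtain w where w: "w \<in> W" "P *v v = A *v w" using P by (auto simp: deflation_def)
    obtain u where u: "u \<in> W" "Q *v v = A *v u" using Q by (auto simp: deflation_def)
    have wu: "w - u \<in> W" using W w u by (simp add: subspace_diff)
    have "(w - u) \<bullet> (P *v v) = (A *v (w - u)) \<bullet> v"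
      using P wu by (metis deflation_def symmetric_dot)
    moreover have "(w - u) \<bullet> (Q *v v) = (A *v (w - u)) \<bullet> v"
      using Q wu by (metis deflation_def symmetric_dot)
    ultimately have "(w - u) \<bullet> (A *v (w - u)) = 0"
      using w u by (simp add: matrix_vector_mult_diff_distrib inner_diff_right)
    then have "A *v (w - u) = 0" using psd_kernel A by blast
    then show ?thesis using w u by (simp add: matrix_vector_mult_diff_distrib)
  qed
  then show ?thesis by (simp add: matrix_eq)
qed

lemma deflation_zero: "deflation A {0} 0"
proof -
  have "transpose (0 :: real^'n^'n) = 0" by (rule symmetricI) simp
  then show ?thesis by (simp add: deflation_def)
qed

lemma deflation_UNIV: "deflation A UNIV P \<Longrightarrow> P = A"
  unfolding deflation_def matrix_eq[of P A] by (intro allI) (drule conjunct2, drule conjunct1, erule bspec, rule UNIV_I)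

text \<open>One Gram-Schmidt step.  The vector \<open>a\<close> is the image under \<open>A\<close> of the component of \<open>s\<close> that is
  \<open>A\<close>-orthogonal to \<open>W\<close>.\<close>

lemma deflation_extend:
  assumes A: "psd A" and W: "subspace W" and P: "deflation A W P"
    and a: "a = A *v s - P *v s" and pos: "s \<bullet> a > 0"
  shows "deflation A (span (insert s W)) (P + (1 / (s \<bullet> a)) *\<^sub>R outer a a)"
proof -
  let ?P = "P + (1 / (s \<bullet> a)) *\<^sub>R outer a a"
  have sA: "transpose A = A" and sP: "transpose P = P"
    using A P by (auto simp: psd_def deflation_def)
  have mult: "?P *v v = P *v v + ((a \<bullet> v) / (s \<bullet> a)) *\<^sub>R a" for v
    by (simp add: matrix_vector_mult_add_rdistrib scaleR_mult_vec)
  have aW: "a \<bullet> w = 0" if "w \<in> W" for w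
  proof -
    have "a \<bullet> w = s \<bullet> (A *v w) - s \<bullet> (P *v w)"
      by (simp add: a inner_diff_left symmetric_dot[OF sA] symmetric_dot[OF sP])
    then show ?thesis using P that by (simp add: deflation_def)
  qed
  have "transpose ?P = ?P"
  proof (rule symmetricI)
    fix x y
    show "(?P *v x) \<bullet> y = x \<bullet> (?P *v y)"
      unfolding mult
      by (simp add: inner_add_left inner_add_right symmetric_dot[OF sP] inner_commute[of x a])
  qed
  moreover have "?P *v w = A *v w" if wspan: "w \<in> span (insert s W)" for w
  proof -
    obtain r where r: "w - r *\<^sub>R s \<in> W"
    proof -
      obtain r where "w - r *\<^sub>R s \<in> span W" using wspan unfolding span_breakdown_eq by blast
      moreover have "span W = W" using W by (rule span_eq_iff[THEN iffD2])
      ultimately show ?thesis using that by simp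
    qed
    have "?P *v (w - r *\<^sub>R s) = A *v (w - r *\<^sub>R s)"
    proof -
      have "P *v (w - r *\<^sub>R s) = A *v (w - r *\<^sub>R s)" using P r unfolding deflation_def by blast
      then show ?thesis unfolding mult aW[OF r] by simp
    qed
    moreover have "?P *v s = A *v s"
    proof -
      have "?P *v s = P *v s + a" unfolding mult inner_commute[of a s] using pos by simp
      then show ?thesis by (simp add: a)
    qed
    ultimately show ?thesis
      by (simp add: matrix_vector_mult_diff_distrib matrix_vector_mult_scaleR)
  qed
  moreover have "\<exists>w\<in>span (insert s W). ?P *v v = A *v w" for v
  proof -
    obtain w where w: "w \<in> W" "P *v v = A *v w" using P by (auto simp: deflation_def)
    obtain u where u: "u \<in> W" "P *v s = A *v u" using P by (auto simp: deflation_def)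
    define r where "r = (a \<bullet> v) / (s \<bullet> a)"
    have "?P *v v = A *v (w + r *\<^sub>R (s - u))"
      unfolding mult r_def[symmetric]
      by (simp add: a w u matrix_vector_right_distrib matrix_vector_mult_diff_distrib
          matrix_vector_mult_scaleR)
    moreover have "w + r *\<^sub>R (s - u) \<in> span (insert s W)"
      using w u by (intro span_add span_mul span_diff) (auto intro: span_base)
    ultimately show ?thesis by blast
  qed
  ultimately show ?thesis by (simp add: deflation_def)
qed

text \<open>The state of a block update after the columns spanning \<open>W\<close> have been processed.\<close>

definition partial_update ::
  "real^'n^'n \<Rightarrow> real^'n^'n \<Rightarrow> (real^'n) set \<Rightarrow> real^'n^'n \<Rightarrow> bool" where
  "partial_update B G W C \<longleftrightarrow> (\<exists>P Q. deflation B W P \<and> deflation G W Q \<and> C = B - P + Q)"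

lemma partial_update_zero: "partial_update B G {0} B"
  unfolding partial_update_def by (intro exI[of _ 0] conjI deflation_zero) simp

lemma partial_update_UNIV: "partial_update B G UNIV C \<Longrightarrow> C = G"
  by (auto simp: partial_update_def dest!: deflation_UNIV)

lemma partial_update_unique:
  "psd B \<Longrightarrow> psd G \<Longrightarrow> subspace W \<Longrightarrow> partial_update B G W C \<Longrightarrow> partial_update B G W C' \<Longrightarrow> C = C'"
  unfolding partial_update_def using deflation_unique by blast

text \<open>The key to the reduction to BFGS.  Let \<open>t\<close> be the component of \<open>s\<close> that is \<open>G\<close>-orthogonal to
  \<open>W\<close>.  Adding \<open>s\<close> to the subtracted and to the added block changes the current matrix \<open>C\<close> by outer products of
  \<open>b\<close> and \<open>y\<close>, which are built from different projections of \<open>s\<close>.  But \<open>C\<close> agrees with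
  \<open>G\<close> on \<open>W\<close>, so that \<open>C t = b\<close>, as \<open>G t = y\<close>, and the change is the BFGS update of \<open>C\<close> along \<open>t\<close>.
  The equations for \<open>t \<bullet> b\<close> and \<open>y \<bullet> t\<close> express the determinant factor through \<open>s\<close> itself.\<close>

lemma partial_update_step:
  assumes B: "pos_def B" and G: "psd G" and W: "subspace W"
    and P: "deflation B W P" and Q: "deflation G W Q"
    and C: "pos_def (B - P + Q)"
    and y: "y = G *v s - Q *v s" and b: "b = B *v s - P *v s" and pos: "s \<bullet> y > 0"
  defines "P' \<equiv> P + (1 / (s \<bullet> b)) *\<^sub>R outer b b" and "Q' \<equiv> Q + (1 / (s \<bullet> y)) *\<^sub>R outer y y"
  obtains t where "G *v t = y" and "(B - P + Q) *v t = b" and "t \<bullet> b = s \<bullet> b"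
    and "y \<bullet> t = s \<bullet> y" and "0 < s \<bullet> b" and "t - s \<in> W"
    and "deflation B (span (insert s W)) P'" and "deflation G (span (insert s W)) Q'"
    and "B - P' + Q' = bfgs (B - P + Q) (G *v t) t"
proof -
  obtain w where w: "w \<in> W" "Q *v s = G *v w" using Q by (auto simp: deflation_def)
  define t where "t = s - w"
  have sG: "transpose G = G" and sQ: "transpose Q = Q"
    using G Q by (auto simp: psd_def deflation_def)
  have sB: "transpose B = B" and sP: "transpose P = P"
    using B P by (auto simp: pos_def_def deflation_def)
  have Gt: "G *v t = y" by (simp add: t_def y w matrix_vector_mult_diff_distrib)
  have Pw: "P *v w = B *v w" and Qw: "Q *v w = G *v w" using P Q w by (auto simp: deflation_def)
  have Ct: "(B - P + Q) *v t = b"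
    by (simp add: t_def b matrix_vector_mult_add_rdistrib matrix_vector_mult_diff_rdistrib
        matrix_vector_mult_diff_distrib Pw Qw w(2))
  have wy: "w \<bullet> y = 0"
  proof -
    have "w \<bullet> y = (G *v w) \<bullet> s - (Q *v w) \<bullet> s"
      by (simp add: y inner_diff_right symmetric_dot[OF sG] symmetric_dot[OF sQ])
    then show ?thesis by (simp add: Qw)
  qed
  have wb: "w \<bullet> b = 0"
  proof -
    have "w \<bullet> b = (B *v w) \<bullet> s - (P *v w) \<bullet> s"
      by (simp add: b inner_diff_right symmetric_dot[OF sB] symmetric_dot[OF sP])
    then show ?thesis by (simp add: Pw)
  qed
  have tb: "t \<bullet> b = s \<bullet> b" by (simp add: t_def inner_diff_left wb)
  have yt: "y \<bullet> t = s \<bullet> y" by (simp add: t_def inner_diff_right inner_commute[of y] wy)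
  have "t \<noteq> 0" using yt pos by auto
  then have "0 < t \<bullet> ((B - P + Q) *v t)" using C by (simp add: pos_def_def)
  then have sb: "0 < s \<bullet> b" by (simp only: Ct tb)
  have 1: "deflation B (span (insert s W)) P'"
    unfolding P'_def by (rule deflation_extend[OF pos_def_imp_psd[OF B] W P b sb])
  have 2: "deflation G (span (insert s W)) Q'"
    unfolding Q'_def by (rule deflation_extend[OF G W Q y pos])
  have 3: "B - P' + Q' = bfgs (B - P + Q) (G *v t) t"
    unfolding bfgs_def Ct Gt tb yt by (simp add: P'_def Q'_def)
  have 4: "t - s \<in> W" using w(1) W by (simp add: t_def subspace_neg)
  show ?thesis by (rule that[OF Gt Ct tb yt sb 4 1 2 3])
qed

text \<open>Linear independence modulo the kernel of \<open>A\<close>, stated with coefficients because a list may contain a vector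
  twice.  For positive semidefinite \<open>A\<close> it says that the Gram matrix \<open>compress A ds\<close> is invertible.\<close>

definition independent_for :: "real^'n^'n \<Rightarrow> (real^'n) list \<Rightarrow> bool" where
  "independent_for A ds \<longleftrightarrow> (\<forall>c. let v = (\<Sum>i<length ds. c i *\<^sub>R ds ! i) in
     v \<bullet> (A *v v) = 0 \<longrightarrow> (\<forall>i<length ds. c i = 0))"

lemma compress_inverse:
  assumes A: "psd A" and ind: "independent_for A ds"
  obtains V where "mat_inverse (compress A ds) = Some V"
    and "\<And>i k. i < length ds \<Longrightarrow> k < length ds \<Longrightarrow>
      (\<Sum>j<length ds. V $$ (i, j) * (ds ! j \<bullet> (A *v ds ! k))) = (if i = k then 1 else 0)"
    and "\<And>i j. i < length ds \<Longrightarrow> j < length ds \<Longrightarrow> V $$ (i, j) = V $$ (j, i)"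
proof -
  let ?n = "length ds"
  let ?C = "compress A ds"
  have sA: "transpose A = A" using A by (simp add: psd_def)
  have C: "?C \<in> carrier_mat ?n ?n" by (simp add: compress_def)
  have Cij: "?C $$ (i, j) = ds ! i \<bullet> (A *v ds ! j)" if "i < ?n" "j < ?n" for i j
    using that by (simp add: compress_def)
  have "Determinant.det ?C \<noteq> 0"
  proof
    assume "Determinant.det ?C = 0"
    then obtain v where v: "v \<in> carrier_vec ?n" "v \<noteq> 0\<^sub>v ?n" "?C *\<^sub>v v = 0\<^sub>v ?n"
      using det_0_iff_vec_prod_zero[OF C] by blast
    \<comment> \<open>a kernel vector of the Gram matrix gives a combination that is orthogonal to every \<open>ds ! i\<close>, hence to itself\<close>
    define z where "z = (\<Sum>j<?n. vec_index v j *\<^sub>R ds ! j)"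
    have dz: "ds ! i \<bullet> (A *v z) = 0" if "i < ?n" for i
    proof -
      have "vec_index (?C *\<^sub>v v) i = (\<Sum>j<?n. vec_index v j * (ds ! i \<bullet> (A *v ds ! j)))"
        using that v(1) C
        by (simp add: scalar_prod_def compress_def atLeast0LessThan mult.commute)
      also have "\<dots> = ds ! i \<bullet> (A *v z)"
        by (simp add: z_def linear_sum[OF matrix_vector_mul_linear] inner_sum_right
            matrix_vector_mult_scaleR)
      finally show ?thesis using v(3) that by simp
    qed
    then have "z \<bullet> (A *v z) = 0" 
      by (subst (1) z_def) (simp add: inner_sum_left dz)
    then have "\<forall>i<?n. vec_index v i = 0"
      using ind unfolding independent_for_def Let_def z_def by blast
    then have "v = 0\<^sub>v ?n" using v(1) by (intro eq_vecI) auto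
    with v(2) show False by simp
  qed
  then have "?C \<in> Units (ring_mat TYPE(real) ?n ())" by (rule det_non_zero_imp_unit[OF C])
  then obtain V where V: "mat_inverse ?C = Some V"
    using mat_inverse(1)[OF C, where b = "()"] by (cases "mat_inverse ?C") auto
  from mat_inverse(2)[OF C V] have VC: "V * ?C = 1\<^sub>m ?n" and CV: "?C * V = 1\<^sub>m ?n"
    and Vc: "V \<in> carrier_mat ?n ?n" by auto
  have sum: "(\<Sum>j<?n. V $$ (i, j) * (ds ! j \<bullet> (A *v ds ! k))) = (if i = k then 1 else 0)"
    if "i < ?n" "k < ?n" for i k
  proof -
    have "(V * ?C) $$ (i, k) = (\<Sum>j<?n. V $$ (i, j) * (ds ! j \<bullet> (A *v ds ! k)))"
      using that Vc C by (simp add: scalar_prod_def compress_def atLeast0LessThan)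
    then show ?thesis using that by (simp add: VC)
  qed
  have "transpose_mat ?C = ?C"
  proof (rule eq_matI)
    fix i j assume "i < dim_row ?C" "j < dim_col ?C"
    then have ij: "i < ?n" "j < ?n" by (simp_all add: compress_def)
    have "ds ! j \<bullet> (A *v ds ! i) = ds ! i \<bullet> (A *v ds ! j)"
      by (metis inner_commute sA symmetric_dot)
    then show "transpose_mat ?C $$ (i, j) = ?C $$ (i, j)" using ij by (simp add: compress_def)
  qed (simp_all add: compress_def)
  then have "transpose_mat V * ?C = 1\<^sub>m ?n"
    using CV transpose_mult[OF C Vc] by (metis transpose_one)
  then have "transpose_mat V = V"
    using CV VC Vc C by (metis assoc_mult_mat left_mult_one_mat right_mult_one_mat transpose_carrier_mat)
  then have "V $$ (i, j) = V $$ (j, i)" if "i < ?n" "j < ?n" for i j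
    using that Vc by (metis carrier_matD index_transpose_mat(1))
  with V sum show ?thesis using that by blast
qed

lemma block_term_mult_vec:
  assumes "mat_inverse (compress A ds) = Some V" and sA: "transpose A = A"
  shows "block_term A ds *v v =
    (\<Sum>i<length ds. (\<Sum>j<length ds. V $$ (i, j) * (ds ! j \<bullet> (A *v v))) *\<^sub>R (A *v ds ! i))"
proof -
  have dv: "(\<Sum>b\<in>UNIV. (ds ! j v* A) $ b * v $ b) = ds ! j \<bullet> (A *v v)" for j
    using dot_lmul_matrix[of "ds ! j" A v] by (simp add: inner_vec_def)
  have "(block_term A ds *v v) $ a =
      (\<Sum>b\<in>UNIV. (\<Sum>i<length ds. \<Sum>j<length ds.
        (A *v ds ! i) $ a * V $$ (i, j) * (ds ! j v* A) $ b) * v $ b)" for a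
    by (simp add: block_term_def assms matrix_vector_mult_def[of "block_term A ds"]
        matrix_vector_mult_def[of "\<chi> a b. _ a b"])
  also have "\<dots> a = (\<Sum>i<length ds. \<Sum>j<length ds. \<Sum>b\<in>UNIV.
        (A *v ds ! i) $ a * V $$ (i, j) * ((ds ! j v* A) $ b * v $ b))" for a
    by (subst sum.swap, simp add: sum_distrib_right)
       (subst sum.swap, simp add: mult.assoc sum.swap[of _ UNIV])
  also have "\<dots> a = (\<Sum>i<length ds. (\<Sum>j<length ds. V $$ (i, j) * (ds ! j \<bullet> (A *v v))) *\<^sub>R (A *v ds ! i)) $ a" for a
    by (simp add: sum_distrib_left[symmetric] dv) (simp add: sum_distrib_left sum_distrib_right mult_ac)
  finally show ?thesis by (simp add: Finite_Cartesian_Product.vec_eq_iff)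
qed


lemma deflation_block_term:
  assumes A: "psd A" and ind: "independent_for A ds"
  shows "deflation A (span (set ds)) (block_term A ds)"
proof -
  let ?n = "length ds" and ?P = "block_term A ds"
  have sA: "transpose A = A" using A by (simp add: psd_def)
  obtain V where V: "mat_inverse (compress A ds) = Some V"
    and one: "\<And>i k. i < ?n \<Longrightarrow> k < ?n \<Longrightarrow>
      (\<Sum>j<?n. V $$ (i, j) * (ds ! j \<bullet> (A *v ds ! k))) = (if i = k then 1 else 0)"
    and sV: "\<And>i j. i < ?n \<Longrightarrow> j < ?n \<Longrightarrow> V $$ (i, j) = V $$ (j, i)"
    using compress_inverse[OF A ind] by blast
  note mult = block_term_mult_vec[OF V sA]
  have "transpose ?P = ?P"
  proof (rule symmetricI)
    fix x y
    have "(?P *v x) \<bullet> y = (\<Sum>i<?n. \<Sum>j<?n. V $$ (i, j) * (ds ! j \<bullet> (A *v x)) * (ds ! i \<bullet> (A *v y)))"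
      by (simp add: mult inner_sum_left sum_distrib_right symmetric_dot[OF sA])
    also have "\<dots> = (\<Sum>i<?n. \<Sum>j<?n. V $$ (i, j) * (ds ! i \<bullet> (A *v x)) * (ds ! j \<bullet> (A *v y)))"
      by (subst sum.swap) (intro sum.cong refl, simp add: sV)
    also have "\<dots> = x \<bullet> (?P *v y)"
      by (simp add: mult inner_sum_right sum_distrib_left symmetric_dot[OF sA, symmetric]
          inner_commute mult_ac)
    finally show "(?P *v x) \<bullet> y = x \<bullet> (?P *v y)" .
  qed
  moreover have "?P *v w = A *v w" if w: "w \<in> span (set ds)" for w
  proof -
    have "?P *v (ds ! k) = A *v (ds ! k)" if "k < ?n" for k
    proof -
      have "?P *v (ds ! k) = (\<Sum>i<?n. (if i = k then 1 else 0) *\<^sub>R (A *v ds ! i))"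
        unfolding mult using that by (intro sum.cong refl) (simp add: one)
      also have "\<dots> = (\<Sum>i<?n. if i = k then A *v ds ! i else 0)"
        by (intro sum.cong) auto
      finally show ?thesis using that by simp
    qed
    then have "\<forall>d\<in>set ds. ?P *v d = A *v d" by (metis in_set_conv_nth)
    then show ?thesis
      using linear_eq_on_span[OF matrix_vector_mul_linear matrix_vector_mul_linear _ w] by blast
  qed
  moreover have "\<exists>w\<in>span (set ds). ?P *v v = A *v w" for v
  proof -
    define w where "w = (\<Sum>i<?n. (\<Sum>j<?n. V $$ (i, j) * (ds ! j \<bullet> (A *v v))) *\<^sub>R ds ! i)"
    have "?P *v v = A *v w"
      by (simp add: w_def mult linear_sum[OF matrix_vector_mul_linear] matrix_vector_mult_scaleR)
    moreover have "w \<in> span (set ds)"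
      unfolding w_def by (intro span_sum span_mul span_base) simp
    ultimately show ?thesis by blast
  qed
  ultimately show ?thesis by (simp add: deflation_def)
qed

text \<open>In a combination on which the form vanishes, pairing with the residual of \<open>s\<close> isolates the coefficient
  of \<open>s\<close>.\<close>

lemma independent_for_snoc:
  assumes A: "psd A" and ind: "independent_for A ds" and Q: "deflation A (span (set ds)) Q"
    and pos: "s \<bullet> (A *v s - Q *v s) > 0"
  shows "independent_for A (ds @ [s])"
  unfolding independent_for_def Let_def
proof (intro allI impI)
  fix c :: "nat \<Rightarrow> real" and i
  let ?n = "length ds"
  define w where "w = (\<Sum>i<?n. c i *\<^sub>R ds ! i)"
  have sQ: "transpose Q = Q" and sA: "transpose A = A" using A Q by (auto simp: psd_def deflation_def)
  have sum: "(\<Sum>i<length (ds @ [s]). c i *\<^sub>R (ds @ [s]) ! i) = w + c ?n *\<^sub>R s"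
    by (simp add: w_def nth_append)
  assume "(\<Sum>i<length (ds @ [s]). c i *\<^sub>R (ds @ [s]) ! i) \<bullet>
       (A *v (\<Sum>i<length (ds @ [s]). c i *\<^sub>R (ds @ [s]) ! i)) = 0"
  then have z: "A *v (w + c ?n *\<^sub>R s) = 0" unfolding sum using psd_kernel[OF A] by blast
  have wW: "w \<in> span (set ds)" unfolding w_def by (intro span_sum span_mul span_base) simp
  obtain u where u: "u \<in> span (set ds)" "Q *v s = A *v u" using Q by (auto simp: deflation_def)
  have "s \<bullet> (Q *v (w + c ?n *\<^sub>R s)) = (A *v u) \<bullet> (w + c ?n *\<^sub>R s)"
    by (metis sQ symmetric_dot u(2))
  also have "\<dots> = 0" by (simp only: symmetric_dot[OF sA] z inner_zero_right)
  finally have "s \<bullet> (A *v (w + c ?n *\<^sub>R s) - Q *v (w + c ?n *\<^sub>R s)) = 0"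
    by (simp only: z inner_diff_right inner_zero_right)
  moreover have "A *v (w + c ?n *\<^sub>R s) - Q *v (w + c ?n *\<^sub>R s) = c ?n *\<^sub>R (A *v s - Q *v s)"
    using Q wW by (simp add: deflation_def matrix_vector_right_distrib matrix_vector_mult_scaleR
        scaleR_diff_right)
  ultimately have "c ?n = 0" using pos by simp
  with z have "w \<bullet> (A *v w) = 0" by simp
  then have "\<forall>i<?n. c i = 0" using ind unfolding independent_for_def Let_def w_def by blast
  moreover assume "i < length (ds @ [s])"
  ultimately show "c i = 0" using \<open>c ?n = 0\<close> by (auto simp: less_Suc_eq)
qed

lemma independent_for_pos_def:
  assumes ind: "independent_for A ds" and B: "pos_def B"
  shows "independent_for B ds"
proof -
  have "v = 0" if "v \<bullet> (B *v v) = 0" for v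
    using B that unfolding pos_def_def by (metis less_irrefl)
  then have "v \<bullet> (A *v v) = 0" if "v \<bullet> (B *v v) = 0" for v
    using that by fastforce
  then show ?thesis using ind unfolding independent_for_def Let_def by blast
qed

definition filtered :: "real \<Rightarrow> real^'n^'n \<Rightarrow> (real^'n) list \<Rightarrow> bool" where
  "filtered \<tau> G ds \<longleftrightarrow>
    (\<forall>j<length ds. ds ! j \<noteq> 0 \<and> \<tau> * (norm (ds ! j))\<^sup>2 \<le> filter_value G (take j ds) (ds ! j))"

lemma filtered_Nil [simp]: "filtered \<tau> G []"
  by (simp add: filtered_def)

lemma filtered_snoc:
  "filtered \<tau> G (ds @ [s]) \<longleftrightarrow>
     filtered \<tau> G ds \<and> s \<noteq> 0 \<and> \<tau> * (norm s)\<^sup>2 \<le> filter_value G ds s"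
  by (auto simp: filtered_def nth_append less_Suc_eq)

lemma filtered_filter_steps:
  assumes "\<And>i. i \<in> {1..q} \<Longrightarrow> s i \<noteq> 0"
  shows "filtered \<tau> G (filter_steps \<tau> G s q)"
proof -
  have "p \<le> q \<Longrightarrow> filtered \<tau> G (map s (retained \<tau> G s p))" for p
    by (induction p) (auto simp: Let_def filtered_snoc assms)
  then show ?thesis by (simp add: filter_steps_def)
qed

lemma filter_value_eq: "filter_value G ds s = s \<bullet> (G *v s - block_term G ds *v s)"
  by (simp add: filter_value_def inner_diff_right)

text \<open>The filter value is the form of \<open>G\<close> at the residual of the new column, so a positive threshold keeps the
  retained columns independent for \<open>G\<close>, even where \<open>G\<close> is singular.\<close>

lemma filtered_independent:
  assumes G: "psd G" and \<tau>: "\<tau> > 0" and "filtered \<tau> G ds"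
  shows "independent_for G ds"
  using assms(3)
proof (induction ds rule: rev_induct)
  case Nil
  then show ?case by (simp add: independent_for_def)
next
  case (snoc s ds)
  then have ind: "independent_for G ds" and s: "s \<noteq> 0" "\<tau> * (norm s)\<^sup>2 \<le> filter_value G ds s"
    by (auto simp: filtered_snoc)
  have "0 < \<tau> * (norm s)\<^sup>2" using s \<tau> by simp
  then show ?case
    using s by (intro independent_for_snoc[OF G ind deflation_block_term[OF G ind]])
      (simp add: filter_value_eq)
qed

lemma partial_update_block_update:
  assumes B: "pos_def B" and G: "psd G" and ind: "independent_for G ds"
  shows "partial_update B G (span (set ds)) (block_update B G ds)"
proof (cases "ds = []")
  case True
  then show ?thesis by (simp add: block_update_def partial_update_zero)
next
  case False
  then show ?thesis
    unfolding block_update_def partial_update_def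
    using deflation_block_term[OF pos_def_imp_psd[OF B] independent_for_pos_def[OF ind B]]
      deflation_block_term[OF G ind] by auto
qed

text \<open>The number \<open>n\<close> is only an upper bound for the number of updates: a column that already lies in the span of
  the earlier ones is skipped.\<close>

inductive bfgs_steps :: "real^'n^'n \<Rightarrow> real^'n^'n \<Rightarrow> nat \<Rightarrow> real^'n^'n \<Rightarrow> bool" for G C where
  start: "bfgs_steps G C 0 C"
| skip: "bfgs_steps G C n D \<Longrightarrow> bfgs_steps G C (Suc n) D"
| step: "bfgs_steps G C n D \<Longrightarrow> t \<noteq> 0 \<Longrightarrow> bfgs_steps G C (Suc n) (bfgs D (G *v t) t)"

lemma pos_def_quadratic: "pos_def G \<Longrightarrow> t \<noteq> 0 \<Longrightarrow> (G *v t) \<bullet> t > 0"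
  by (simp add: pos_def_def inner_commute)

lemma pos_def_bfgs_steps:
  assumes "bfgs_steps G C n D" and "pos_def G" and "pos_def C"
  shows "pos_def D"
  using assms(1) by induction (auto intro!: pos_def_bfgs pos_def_quadratic assms)

text \<open>The residual of \<open>s\<close> can vanish only if \<open>s\<close> is in \<open>W\<close>, and then nothing changes.  This needs \<open>G\<close> positive
  definite; for semidefinite \<open>G\<close> the filter guarantees a positive residual instead.\<close>

lemma partial_update_insert:
  assumes B: "pos_def B" and G: "pos_def G" and W: "subspace W"
    and C: "partial_update B G W C" "pos_def C"
  shows "\<exists>D. partial_update B G (span (insert s W)) D \<and> (D = C \<or> (\<exists>t. t \<noteq> 0 \<and> D = bfgs C (G *v t) t))"
proof (cases "s \<in> W")
  case True
  then have "span (insert s W) = W" using W by (simp add: insert_absorb span_eq_iff[THEN iffD2])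
  then show ?thesis using C by auto
next
  case False
  obtain P Q where P: "deflation B W P" and Q: "deflation G W Q" and CPQ: "C = B - P + Q"
    using C(1) by (auto simp: partial_update_def)
  obtain w where w: "w \<in> W" "Q *v s = G *v w" using Q by (auto simp: deflation_def)
  have "s \<bullet> (G *v s - Q *v s) = (s - w) \<bullet> (G *v (s - w))"
    using deflation_form(2)[OF pos_def_imp_psd[OF G] Q w] by (simp add: inner_diff_right)
  moreover have "s - w \<noteq> 0" using False w by auto
  ultimately have "s \<bullet> (G *v s - Q *v s) > 0" using G by (simp add: pos_def_def)
  then obtain t where t: "(G *v t) \<bullet> t = s \<bullet> (G *v s - Q *v s)" "s \<bullet> (G *v s - Q *v s) > 0"
    and part: "partial_update B G (span (insert s W)) (bfgs C (G *v t) t)"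
  proof -
    assume pos: "s \<bullet> (G *v s - Q *v s) > 0"
    have C': "pos_def (B - P + Q)" using C(2) CPQ by simp
    show ?thesis
      using partial_update_step[OF B pos_def_imp_psd[OF G] W P Q C' HOL.refl HOL.refl pos] that pos
      unfolding partial_update_def CPQ by metis
  qed
  from t have "t \<noteq> 0" by auto
  with part show ?thesis by blast
qed

lemma partial_update_chain:
  assumes B: "pos_def B" and G: "pos_def G" and W: "subspace W"
    and C: "partial_update B G W C" "pos_def C"
  shows "\<exists>D. partial_update B G (span (W \<union> set ss)) D \<and> bfgs_steps G C (length ss) D"
proof (induction ss rule: rev_induct)
  case Nil
  then show ?case using C W by (auto simp: span_eq_iff[THEN iffD2] intro: bfgs_steps.start)
next
  case (snoc s ss)
  then obtain D where D: "partial_update B G (span (W \<union> set ss)) D"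
    and st: "bfgs_steps G C (length ss) D" by blast
  obtain E where E: "partial_update B G (span (insert s (span (W \<union> set ss)))) E"
    and ED: "E = D \<or> (\<exists>t. t \<noteq> 0 \<and> E = bfgs D (G *v t) t)"
    using partial_update_insert[OF B G subspace_span D pos_def_bfgs_steps[OF st G C(2)]] by blast
  have "span (insert s (span (W \<union> set ss))) = span (W \<union> set (ss @ [s]))"
  proof
    show "span (insert s (span (W \<union> set ss))) \<subseteq> span (W \<union> set (ss @ [s]))"
      by (rule span_minimal) (auto intro: span_base span_mono[THEN subsetD, rotated])
    show "span (W \<union> set (ss @ [s])) \<subseteq> span (insert s (span (W \<union> set ss)))"
      by (rule span_mono) (auto intro: span_base)
  qed
  with E have "partial_update B G (span (W \<union> set (ss @ [s]))) E" by simp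
  moreover have "bfgs_steps G C (length (ss @ [s])) E"
    using ED st by (auto intro: bfgs_steps.intros)
  ultimately show ?case by blast
qed

text \<open>Process a basis of the whole space: \<open>partial_update B G UNIV\<close> holds of \<open>G\<close> only.  Since the effect of a
  BFGS update on determinant and trace is known, this replaces any use of eigenvalues: properties of \<open>G\<close> can be carried
  back to every positive definite \<open>B\<close>.\<close>

lemma pos_def_connected:
  fixes B G :: "real^'n^'n"
  assumes B: "pos_def B" and G: "pos_def G"
  obtains n where "bfgs_steps G B n G"
proof -
  obtain ss :: "(real^'n) list" where ss: "set ss = Basis" using finite_list[OF finite_Basis] by blast
  obtain D where D: "partial_update B G (span ({0} \<union> set ss)) D" "bfgs_steps G B (length ss) D"
    using partial_update_chain[OF B G subspace_single_0 partial_update_zero B] by blast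
  have "span ({0} \<union> set ss) = (UNIV :: (real^'n) set)" by (simp add: ss span_insert_0)
  with D(1) have "D = G" by (auto dest: partial_update_UNIV)
  with D(2) show ?thesis using that by blast
qed

lemma pos_def_identity: "pos_def \<I>"
  by (simp add: pos_def_def)

text \<open>The sign of the determinant is preserved along a chain of BFGS updates that ends in the identity.\<close>

lemma pos_def_det:
  assumes B: "pos_def B"
  shows "0 < det B"
proof -
  obtain n where "bfgs_steps \<I> B n \<I>" using pos_def_connected[OF B pos_def_identity] .
  have step: "0 < det D \<Longrightarrow> 0 < det B" if "bfgs_steps \<I> B n D" for n D
    using that
  proof induction
    case (step n D t)
    have D: "pos_def D" using pos_def_bfgs_steps[OF step.hyps(1) pos_def_identity B] .
    have "0 < det D * ((\<I> *v t) \<bullet> t / (t \<bullet> (D *v t)))" (is "0 < _ * ?r")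
      using step.prems unfolding det_bfgs[OF D pos_def_quadratic[OF pos_def_identity step.hyps(2)]] .
    moreover have "0 < ?r"
      using pos_def_quadratic[OF pos_def_identity step.hyps(2)] pos_def_quadratic[OF D step.hyps(2)]
      by (simp add: inner_commute)
    ultimately have "0 < det D" by (metis zero_less_mult_pos2)
    then show ?case by (rule step.IH)
  qed auto
  show ?thesis by (rule step[OF \<open>bfgs_steps \<I> B n \<I>\<close>]) simp
qed

section \<open>The trace-determinant potential\<close>

text \<open>The Byrd-Nocedal potential of \<open>G0\<^sup>-\<^sup>1\<^sup>/\<^sup>2 B G0\<^sup>-\<^sup>1\<^sup>/\<^sup>2\<close>, up to the constant \<open>ln (det G0)\<close>, written without square
  roots of matrices.\<close>

definition psi :: "real^'n^'n \<Rightarrow> real^'n^'n \<Rightarrow> real" where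
  "psi G0 B = trace (matrix_inv G0 ** B) - ln (det B)"

text \<open>With \<open>\<kappa> = (s \<bullet> B s) / (s \<bullet> G0 s)\<close> this is \<open>(\<kappa> / cos\<^sup>2 \<theta>) - 1 - ln \<kappa>\<close>, where \<open>\<theta>\<close> is the
  angle between \<open>s\<close> and \<open>G0\<^sup>-\<^sup>1 B s\<close> in the inner product of \<open>G0\<close>.  It is nonnegative, and it is zero only if
  \<open>B s = G0 s\<close>.\<close>

definition discrepancy :: "real^'n^'n \<Rightarrow> real^'n^'n \<Rightarrow> real^'n \<Rightarrow> real" where
  "discrepancy G0 B s = (B *v s) \<bullet> (matrix_inv G0 *v (B *v s)) / (s \<bullet> (B *v s)) - 1
     - ln ((s \<bullet> (B *v s)) / (s \<bullet> (G0 *v s)))"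

lemma trace_mult_add: "trace (H ** (A + B)) = trace (H ** A) + trace (H ** B)" for H :: "real^'n^'n"
  by (simp add: matrix_add_ldistrib trace_add)

lemma trace_mult_scaleR: "trace (H ** (r *\<^sub>R A)) = r * trace (H ** A)" for H :: "real^'n^'n"
  by (simp add: trace_def matrix_matrix_mult_def sum_distrib_left mult_ac)

lemma trace_mult_diff: "trace (H ** (A - B)) = trace (H ** A) - trace (H ** B)" for H :: "real^'n^'n"
  using trace_mult_add[of H "A - B" B] by simp

lemma pos_def_pos: "pos_def B \<Longrightarrow> s \<noteq> 0 \<Longrightarrow> 0 < s \<bullet> (B *v s)"
  by (simp add: pos_def_def)

text \<open>The update replaces the behaviour of \<open>C\<close> along \<open>t\<close> by that of \<open>G\<close>, and the potential registers just this
  exchange.\<close>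

lemma psi_bfgs:
  assumes C: "pos_def C" and G: "pos_def G" and G0: "pos_def G0" and t: "t \<noteq> 0"
  shows "psi G0 (bfgs C (G *v t) t) = psi G0 C - discrepancy G0 C t + discrepancy G0 G t"
proof -
  note pos = pos_def_pos[OF C t] pos_def_pos[OF G t] pos_def_pos[OF G0 t] pos_def_det[OF C]
  have yt: "(G *v t) \<bullet> t > 0" using pos by (simp add: inner_commute)
  have "trace (matrix_inv G0 ** bfgs C (G *v t) t) = trace (matrix_inv G0 ** C)
     - (C *v t) \<bullet> (matrix_inv G0 *v (C *v t)) / (t \<bullet> (C *v t))
     + (G *v t) \<bullet> (matrix_inv G0 *v (G *v t)) / (t \<bullet> (G *v t))"
    by (simp add: bfgs_def trace_mult_add trace_mult_diff trace_mult_scaleR trace_mult_outer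
        inner_commute[of _ t])
  moreover have "ln (det (bfgs C (G *v t) t)) = ln (det C) + ln (t \<bullet> (G *v t)) - ln (t \<bullet> (C *v t))"
    using pos unfolding det_bfgs[OF C yt] by (simp add: ln_mult ln_div inner_commute[of _ t])
  ultimately show ?thesis using pos unfolding psi_def discrepancy_def by (simp add: ln_div)
qed

lemma trace_matrix_inv:
  fixes G0 :: "real^'n^'n"
  assumes "pos_def G0"
  shows "trace (matrix_inv G0 ** G0) = CARD('n)"
proof -
  have "matrix_inv G0 ** G0 = \<I>"
    by (simp add: matrix_eq matrix_vector_mul_assoc[symmetric]
        matrix_inv_mult_vec[OF pos_def_invertible[OF assms]])
  then show ?thesis by (simp add: trace_I)
qed

lemma inverse_Cauchy_Schwarz:
  assumes G0: "pos_def G0"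
  shows "(s \<bullet> a)\<^sup>2 \<le> (s \<bullet> (G0 *v s)) * (a \<bullet> (matrix_inv G0 *v a))"
proof -
  have "G0 *v (matrix_inv G0 *v a) = a"
    by (rule matrix_inv_mult_vec(1)[OF pos_def_invertible[OF G0]])
  then show ?thesis
    using psd_Cauchy_Schwarz[OF pos_def_imp_psd[OF G0], of s "matrix_inv G0 *v a"]
    by (simp add: inner_commute)
qed

text \<open>The quantitative form of \<open>ln k \<le> k - 1\<close> obtained by applying it to \<open>sqrt k\<close>.\<close>

lemma ln_gap: "(sqrt k - 1)\<^sup>2 \<le> k - 1 - ln k" if "k > 0" for k :: real
proof -
  have "ln k = 2 * ln (sqrt k)" using that by (simp add: ln_sqrt)
  moreover have "ln (sqrt k) \<le> sqrt k - 1" using that ln_le_minus_one[of "sqrt k"] by simp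
  moreover have "(sqrt k)\<^sup>2 = k" using that by simp
  ultimately show ?thesis by (simp add: power2_diff)
qed

text \<open>Both summands of the discrepancy are nonnegative: the first by the Cauchy-Schwarz inequality, the second since
  \<open>ln k \<le> k - 1\<close>.  Here \<open>k\<close> compares \<open>B\<close> with \<open>G0\<close> along \<open>s\<close>, and \<open>A / k\<close> is \<open>1 / cos\<^sup>2 \<theta>\<close>.\<close>

lemma discrepancy_split:
  assumes B: "pos_def B" and G0: "pos_def G0" and s: "s \<noteq> 0"
  obtains k A where "k > 0" "A \<ge> k" "s \<bullet> (B *v s) = k * (s \<bullet> (G0 *v s))"
    "(B *v s) \<bullet> (matrix_inv G0 *v (B *v s)) = A * k * (s \<bullet> (G0 *v s))"
    "discrepancy G0 B s = (A - k) + (k - 1 - ln k)"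
proof -
  define N T where "N = s \<bullet> (G0 *v s)" and "T = s \<bullet> (B *v s)"
  define Z where "Z = (B *v s) \<bullet> (matrix_inv G0 *v (B *v s))"
  have N: "N > 0" and T: "T > 0" using pos_def_pos B G0 s by (auto simp: N_def T_def)
  have "T\<^sup>2 \<le> N * Z"
    unfolding N_def T_def Z_def by (rule inverse_Cauchy_Schwarz[OF G0])
  then have le: "T / N \<le> Z / T" using N T by (simp add: field_simps power2_eq_square)
  show ?thesis
  proof (rule that[of "T / N" "Z / T"])
    show "discrepancy G0 B s = (Z / T - T / N) + (T / N - 1 - ln (T / N))"
      by (simp add: discrepancy_def N_def T_def Z_def)
  qed (use N T le in \<open>simp_all add: N_def[symmetric] T_def[symmetric] Z_def[symmetric]\<close>)
qed

lemma discrepancy_nonneg: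
  assumes "pos_def B" "pos_def G0" "s \<noteq> 0"
  shows "0 \<le> discrepancy G0 B s"
proof -
  obtain k A where "k > 0" "A \<ge> k" "discrepancy G0 B s = (A - k) + (k - 1 - ln k)"
    using discrepancy_split[OF assms] by metis
  then show ?thesis using ln_le_minus_one[of k] by simp
qed

lemma discrepancy_self:
  assumes "pos_def G0" "s \<noteq> 0"
  shows "discrepancy G0 G0 s = 0"
  using pos_def_pos[OF assms]
  by (simp add: discrepancy_def matrix_inv_mult_vec[OF pos_def_invertible[OF assms(1)]] inner_commute)

lemma psi_bfgs_steps:
  assumes st: "bfgs_steps G C n D" and C: "pos_def C" and G: "pos_def G" and G0: "pos_def G0"
    and \<delta>: "0 \<le> \<delta>" "\<And>t. t \<noteq> 0 \<Longrightarrow> discrepancy G0 G t \<le> \<delta>"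
  shows "psi G0 D \<le> psi G0 C + real n * \<delta>"
  using st
proof induction
  case (step n D t)
  have D: "pos_def D" using pos_def_bfgs_steps[OF step.hyps(1) G C] .
  show ?case
    using step.IH discrepancy_nonneg[OF D G0 step.hyps(2)] \<delta>(2)[OF step.hyps(2)]
    unfolding psi_bfgs[OF D G G0 step.hyps(2)] by (simp add: algebra_simps)
qed (use \<delta> in \<open>auto simp: algebra_simps\<close>)

text \<open>Along a chain of BFGS updates from \<open>B\<close> to \<open>G0\<close> that uses \<open>G0\<close> itself, the potential never increases.\<close>

lemma psi_ge:
  fixes B G0 :: "real^'n^'n"
  assumes B: "pos_def B" and G0: "pos_def G0"
  shows "CARD('n) - ln (det G0) \<le> psi G0 B"
proof -
  obtain n where st: "bfgs_steps G0 B n G0" using pos_def_connected[OF B G0] .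
  have "psi G0 G0 \<le> psi G0 B + real n * 0"
    by (rule psi_bfgs_steps[OF st B G0 G0]) (simp_all add: discrepancy_self G0)
  then show ?thesis by (simp add: psi_def trace_matrix_inv[OF G0])
qed

text \<open>Since the order of the columns is irrelevant, the step of interest can be processed first, when the current matrix is
  still \<open>B\<close>; this contributes the discrepancy of \<open>B\<close>.  The remaining columns can only add errors \<open>\<delta>\<close>.\<close>

lemma psi_block_update:
  assumes B: "pos_def B" and G: "pos_def G" and G0: "pos_def G0" and ind: "independent_for G ds"
    and \<delta>: "0 \<le> \<delta>" "\<And>t. t \<noteq> 0 \<Longrightarrow> discrepancy G0 G t \<le> \<delta>"
    and s: "s \<in> set ds" "s \<noteq> 0"
  shows "psi G0 (block_update B G ds) \<le> psi G0 B - discrepancy G0 B s + real (Suc (length ds)) * \<delta>"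
proof -
  let ?C = "bfgs B (G *v s) s"
  have Gs: "s \<bullet> (G *v s) > 0" by (rule pos_def_pos[OF G s(2)])
  have "partial_update B G (span (insert s {0})) ?C"
  proof -
    obtain t where "t - s \<in> {0}" and "deflation B (span (insert s {0})) (0 + (1 / (s \<bullet> (B *v s - 0 *v s))) *\<^sub>R outer (B *v s - 0 *v s) (B *v s - 0 *v s))"
      and "deflation G (span (insert s {0})) (0 + (1 / (s \<bullet> (G *v s - 0 *v s))) *\<^sub>R outer (G *v s - 0 *v s) (G *v s - 0 *v s))"
      and "B - (0 + (1 / (s \<bullet> (B *v s - 0 *v s))) *\<^sub>R outer (B *v s - 0 *v s) (B *v s - 0 *v s))
       + (0 + (1 / (s \<bullet> (G *v s - 0 *v s))) *\<^sub>R outer (G *v s - 0 *v s) (G *v s - 0 *v s)) = bfgs (B - 0 + 0) (G *v t) t"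
      using partial_update_step[OF B pos_def_imp_psd[OF G] subspace_single_0 deflation_zero deflation_zero,
        of "G *v s - 0 *v s" s "B *v s - 0 *v s"] B Gs by auto
    then show ?thesis unfolding partial_update_def by (intro exI conjI) auto
  qed
  moreover have C: "pos_def ?C" by (rule pos_def_bfgs[OF B pos_def_quadratic[OF G s(2)]])
  ultimately obtain D where D: "partial_update B G (span (span (insert s {0}) \<union> set ds)) D"
    and st: "bfgs_steps G ?C (length ds) D"
    using partial_update_chain[OF B G subspace_span] by blast
  have "span (span (insert s {0}) \<union> set ds) = span (set ds)"
  proof
    have "insert s {0} \<subseteq> span (set ds)" using s by (auto intro: span_base span_zero)
    then have "span (insert s {0}) \<subseteq> span (set ds)" by (intro span_minimal subspace_span)
    then show "span (span (insert s {0}) \<union> set ds) \<subseteq> span (set ds)"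
      by (intro span_minimal subspace_span) (auto intro: span_base)
  qed (intro span_mono, blast)
  then have "D = block_update B G ds"
    using D partial_update_unique[OF pos_def_imp_psd[OF B] pos_def_imp_psd[OF G] subspace_span]
      partial_update_block_update[OF B pos_def_imp_psd[OF G] ind] by metis
  then have "psi G0 (block_update B G ds) \<le> psi G0 ?C + real (length ds) * \<delta>"
    using psi_bfgs_steps[OF st C G G0 \<delta>] by simp
  also have "psi G0 ?C \<le> psi G0 B - discrepancy G0 B s + \<delta>"
    unfolding psi_bfgs[OF B G G0 s(2)] using \<delta>(2)[OF s(2)] by simp
  finally show ?thesis by (simp add: algebra_simps)
qed

text \<open>Write \<open>G t = G0 t + e\<close>.  The terms of first order in \<open>e\<close> cancel, which leaves a bound that is quadratic in the
  relative distance \<open>\<eta> / m\<close>.\<close>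

lemma discrepancy_near:
  assumes G: "pos_def G" and G0: "pos_def G0" and m: "0 < m"
    and mG0: "\<And>v. m * (norm v)\<^sup>2 \<le> v \<bullet> (G0 *v v)" and mG: "\<And>v. m * (norm v)\<^sup>2 \<le> v \<bullet> (G *v v)"
    and \<eta>: "\<And>v. norm ((G - G0) *v v) \<le> \<eta> * norm v" and t: "t \<noteq> 0"
  shows "discrepancy G0 G t \<le> (\<eta> / m)\<^sup>2"
proof -
  let ?H = "matrix_inv G0"
  note inv = matrix_inv_mult_vec[OF pos_def_invertible[OF G0]]
  define e where "e = (G - G0) *v t"
  define g N where "g = t \<bullet> (G *v t)" and "N = (norm t)\<^sup>2"
  have N: "N > 0" using t by (simp add: N_def)
  have gN: "m * N \<le> g" using mG by (simp add: g_def N_def)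
  then have g: "g > 0" using m N by (smt (verit) mult_pos_pos)
  have ne: "norm e \<le> \<eta> * norm t" unfolding e_def by (rule \<eta>)
  have eHe: "e \<bullet> (?H *v e) \<le> \<eta>\<^sup>2 * N / m"
  proof -
    define v where "v = ?H *v e"
    have e: "e = G0 *v v" by (simp add: v_def inv)
    have ev: "e \<bullet> v \<le> norm e * norm v" by (rule norm_cauchy_schwarz)
    have "m * (norm v)\<^sup>2 \<le> norm e * norm v" using mG0[of v] ev by (simp add: e inner_commute)
    then have "m * norm v \<le> norm e" by (cases "v = 0") (auto simp: power2_eq_square)
    then have "norm v \<le> norm e / m" using m by (simp add: field_simps)
    then have "norm e * norm v \<le> norm e * (norm e / m)" by (intro mult_left_mono) auto
    then have "e \<bullet> v \<le> (norm e)\<^sup>2 / m" using ev by (simp add: power2_eq_square)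
    also have "\<dots> \<le> (\<eta> * norm t)\<^sup>2 / m" using ne m by (intro divide_right_mono power_mono) auto
    finally show ?thesis by (simp add: v_def N_def power_mult_distrib)
  qed
  have Gt: "G *v t = G0 *v t + e" by (simp add: e_def matrix_vector_mult_diff_rdistrib)
  have "(G0 *v t) \<bullet> (?H *v e) = t \<bullet> e"
    by (metis G0 inv(1) pos_def_def symmetric_dot)
  then have Z: "(G *v t) \<bullet> (?H *v (G *v t)) = g + t \<bullet> e + e \<bullet> (?H *v e)"
    by (simp add: g_def Gt matrix_vector_right_distrib inv inner_add_left inner_add_right inner_commute)
  have "ln ((t \<bullet> (G0 *v t)) / g) \<le> (t \<bullet> (G0 *v t)) / g - 1"
    using pos_def_pos[OF G0 t] g by (intro ln_le_minus_one) simp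
  moreover have "t \<bullet> (G0 *v t) = g - t \<bullet> e" by (simp add: g_def Gt inner_add_right)
  moreover have "- ln (g / (t \<bullet> (G0 *v t))) = ln ((t \<bullet> (G0 *v t)) / g)"
    using pos_def_pos[OF G0 t] g by (simp only: ln_div) auto
  ultimately have "- ln (g / (t \<bullet> (G0 *v t))) \<le> - (t \<bullet> e) / g"
    using g by (simp add: diff_divide_distrib)
  then have "discrepancy G0 G t \<le> (g + t \<bullet> e + e \<bullet> (?H *v e)) / g - 1 - (t \<bullet> e) / g"
    unfolding discrepancy_def Z g_def[symmetric] by simp
  also have "\<dots> = e \<bullet> (?H *v e) / g" using g by (simp add: add_divide_distrib)
  also have "\<dots> \<le> (\<eta>\<^sup>2 * N / m) / g" using eHe g by (intro divide_right_mono) auto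
  also have "\<dots> \<le> (\<eta>\<^sup>2 * N / m) / (m * N)"
    using gN m N g by (intro divide_left_mono) auto
  also have "\<dots> = (\<eta> / m)\<^sup>2" using N by (simp add: power2_eq_square)
  finally show ?thesis .
qed

text \<open>The squared length of \<open>(B - G0) s\<close> in the norm of \<open>G0\<^sup>-\<^sup>1\<close>, relative to \<open>s \<bullet> G0 s\<close>, is
  \<open>k (A - k) + (k - 1)\<^sup>2\<close> in the notation of \<open>discrepancy_split\<close>.  A discrepancy at most 1 forces
  \<open>sqrt k \<le> 2\<close>, hence the factor \<open>13 = 2\<^sup>2 + 3\<^sup>2\<close>.\<close>

lemma discrepancy_controls:
  assumes B: "pos_def B" and G0: "pos_def G0" and s: "s \<noteq> 0" and small: "discrepancy G0 B s \<le> 1"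
  shows "(norm (B *v s - G0 *v s))\<^sup>2 \<le> 13 * discrepancy G0 B s * trace G0 * (s \<bullet> (G0 *v s))"
proof -
  let ?H = "matrix_inv G0" and ?d = "discrepancy G0 B s"
  note inv = matrix_inv_mult_vec[OF pos_def_invertible[OF G0]]
  define N where "N = s \<bullet> (G0 *v s)"
  have N: "N > 0" using pos_def_pos[OF G0 s] by (simp add: N_def)
  obtain k A where k: "k > 0" and A: "A \<ge> k" and sBs: "s \<bullet> (B *v s) = k * N"
    and Z: "(B *v s) \<bullet> (?H *v (B *v s)) = A * k * N"
    and d: "?d = (A - k) + (k - 1 - ln k)"
    using discrepancy_split[OF B G0 s] unfolding N_def by metis
  define r where "r = sqrt k"
  have r: "r > 0" "k = r\<^sup>2" using k by (simp_all add: r_def)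
  have r1: "(r - 1)\<^sup>2 \<le> ?d" and Ak: "A - k \<le> ?d"
    using ln_gap[OF k] ln_le_minus_one[OF k] A d by (simp_all add: r_def)
  have "(r - 1)\<^sup>2 \<le> 1\<^sup>2" using r1 small by simp
  then have r2: "r \<le> 2" using power2_le_imp_le[of "r - 1" 1] by simp
  define a where "a = B *v s - G0 *v s"
  have "a \<bullet> (?H *v a) = A * k * N - 2 * (k * N) + N"
  proof -
    have "(G0 *v s) \<bullet> (?H *v (B *v s)) = s \<bullet> (B *v s)"
      by (metis G0 inv(1) pos_def_def symmetric_dot)
    then show ?thesis using sBs Z
      by (simp add: a_def matrix_vector_mult_diff_distrib inv inner_diff_left inner_diff_right
          inner_commute N_def)
  qed
  also have "\<dots> = (k * (A - k) + (r - 1)\<^sup>2 * (r + 1)\<^sup>2) * N"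
    by (simp add: r power2_eq_square algebra_simps)
  also have "\<dots> \<le> (4 * ?d + ?d * 9) * N"
  proof -
    have "r\<^sup>2 \<le> 2\<^sup>2" using r r2 by (intro power_mono) auto
    then have "k * (A - k) \<le> 4 * ?d" using Ak A r by (intro mult_mono) auto
    moreover have "(r + 1)\<^sup>2 \<le> 3\<^sup>2" using r r2 by (intro power_mono) auto
    then have "(r - 1)\<^sup>2 * (r + 1)\<^sup>2 \<le> ?d * 9"
      using r1 discrepancy_nonneg[OF B G0 s] by (intro mult_mono) auto
    ultimately show ?thesis using N by (intro mult_right_mono) auto
  qed
  finally have aHa: "a \<bullet> (?H *v a) \<le> 13 * ?d * N" by simp
  define v where "v = ?H *v a"
  have av: "a = G0 *v v" by (simp add: v_def inv)
  have "(norm a)\<^sup>2 \<le> trace G0 * (v \<bullet> (G0 *v v))"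
    unfolding av by (rule psd_norm_trace[OF pos_def_imp_psd[OF G0]])
  also have "v \<bullet> (G0 *v v) = a \<bullet> (?H *v a)" by (metis av v_def inner_commute)
  also have "trace G0 * \<dots> \<le> trace G0 * (13 * ?d * N)"
    using aHa psd_trace_nonneg[OF pos_def_imp_psd[OF G0]] by (intro mult_left_mono)
  finally show ?thesis by (simp add: a_def N_def mult_ac)
qed

text \<open>The squared cosine of the angle between \<open>s\<close> and \<open>B s\<close>, that is, between the search direction and the
  direction of steepest descent.\<close>

definition cos2 :: "real^'n^'n \<Rightarrow> real^'n \<Rightarrow> real" where
  "cos2 B s = (s \<bullet> (B *v s))\<^sup>2 / ((norm s)\<^sup>2 * (norm (B *v s))\<^sup>2)"

lemma cos2_bounds:
  assumes B: "pos_def B" and s: "s \<noteq> 0"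
  shows "0 < cos2 B s" "cos2 B s \<le> 1"
proof -
  have sBs: "0 < s \<bullet> (B *v s)" by (rule pos_def_pos[OF B s])
  then have "B *v s \<noteq> 0" by auto
  then show "0 < cos2 B s" using s sBs by (simp add: cos2_def)
  have "(s \<bullet> (B *v s))\<^sup>2 \<le> (norm s)\<^sup>2 * (norm (B *v s))\<^sup>2"
    using Cauchy_Schwarz_ineq[of s "B *v s"] by (simp add: power2_norm_eq_inner)
  moreover have "0 < (norm s)\<^sup>2 * (norm (B *v s))\<^sup>2" using s \<open>B *v s \<noteq> 0\<close> by simp
  ultimately show "cos2 B s \<le> 1" by (simp only: cos2_def divide_le_eq_1_pos)
qed

text \<open>Uniform in \<open>s\<close> for a fixed \<open>B\<close>: the product of the two traces plays the role of the condition number.\<close>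

lemma cos2_lower:
  assumes B: "pos_def B"
  obtains e where "0 < e" "\<And>s. s \<noteq> 0 \<Longrightarrow> e \<le> cos2 B s"
proof -
  let ?H = "matrix_inv B"
  define T where "T = trace B * trace ?H"
  have key: "1 \<le> T * cos2 B s" "0 < T" if s: "s \<noteq> 0" for s
  proof -
    note sBs = pos_def_pos[OF B s]
    then have Bs: "B *v s \<noteq> 0" by auto
    have 1: "(norm (B *v s))\<^sup>2 \<le> trace B * (s \<bullet> (B *v s))"
      by (rule psd_norm_trace[OF pos_def_imp_psd[OF B]])
    have 2: "(norm s)\<^sup>2 \<le> trace ?H * (s \<bullet> (B *v s))"
      using psd_norm_trace[OF pos_def_imp_psd[OF pos_def_matrix_inv[OF B]], of "B *v s"]
      by (simp add: matrix_inv_mult_vec[OF pos_def_invertible[OF B]] inner_commute)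
    have "(norm s)\<^sup>2 * (norm (B *v s))\<^sup>2 \<le> (trace ?H * (s \<bullet> (B *v s))) * (trace B * (s \<bullet> (B *v s)))"
      using 1 2 psd_trace_nonneg[OF pos_def_imp_psd[OF pos_def_matrix_inv[OF B]]] sBs
      by (intro mult_mono) auto
    then have *: "(norm s)\<^sup>2 * (norm (B *v s))\<^sup>2 \<le> T * (s \<bullet> (B *v s))\<^sup>2"
      by (simp add: T_def power2_eq_square mult_ac)
    have p: "0 < (norm s)\<^sup>2 * (norm (B *v s))\<^sup>2" using s Bs by simp
    show "1 \<le> T * cos2 B s" using * p by (simp add: cos2_def le_divide_eq)
    have "0 < T * (s \<bullet> (B *v s))\<^sup>2" using * p by linarith
    then show "0 < T" by (simp add: zero_less_mult_iff)
  qed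
  have T: "0 < T" using key(2)[of "axis (SOME i. True) 1"] by (simp add: axis_eq_0_iff)
  show ?thesis
  proof (rule that[of "1 / T"])
    show "1 / T \<le> cos2 B s" if "s \<noteq> 0" for s
      using key(1)[OF that] T by (simp add: divide_le_eq mult.commute)
  qed (use T in simp)
qed

text \<open>A column \<open>s\<close> multiplies the determinant by the ratio of its residuals with respect to \<open>G\<close> and to \<open>B\<close>.
  The numerator is the filter value, at least \<open>\<tau> \<parallel>s\<parallel>\<^sup>2\<close>; the denominator is at most \<open>s \<bullet> B s\<close>, because a
  projection shortens.\<close>

lemma filtered_block_update:
  assumes B: "pos_def B" and G: "psd G" and \<tau>: "\<tau> > 0" and "filtered \<tau> G ds"
  shows "pos_def (block_update B G ds) \<and>
    ln (det B) + (\<Sum>s\<leftarrow>ds. ln (\<tau> * (norm s)\<^sup>2) - ln (s \<bullet> (B *v s))) \<le> ln (det (block_update B G ds))"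
  using assms(4)
proof (induction ds rule: rev_induct)
  case Nil
  then show ?case using B by (simp add: block_update_def)
next
  case (snoc s ds)
  let ?W = "span (set ds)" and ?D = "block_update B G ds" and ?D' = "block_update B G (ds @ [s])"
  have f: "filtered \<tau> G ds" and s: "s \<noteq> 0" "\<tau> * (norm s)\<^sup>2 \<le> filter_value G ds s"
    using snoc.prems by (auto simp: filtered_snoc)
  have ind: "independent_for G ds" by (rule filtered_independent[OF G \<tau> f])
  have ind': "independent_for G (ds @ [s])" by (rule filtered_independent[OF G \<tau> snoc.prems])
  have D: "pos_def ?D" and IH: "ln (det B) + (\<Sum>s\<leftarrow>ds. ln (\<tau> * (norm s)\<^sup>2) - ln (s \<bullet> (B *v s))) \<le> ln (det ?D)"
    using snoc.IH[OF f] by auto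
  obtain P Q where P: "deflation B ?W P" and Q: "deflation G ?W Q" and DPQ: "?D = B - P + Q"
    using partial_update_block_update[OF B G ind] unfolding partial_update_def by blast
  have "Q = block_term G ds"
    by (rule deflation_unique[OF G subspace_span Q deflation_block_term[OF G ind]])
  then have sy: "\<tau> * (norm s)\<^sup>2 \<le> s \<bullet> (G *v s - Q *v s)" using s by (simp add: filter_value_eq)
  have \<tau>s: "0 < \<tau> * (norm s)\<^sup>2" using \<tau> s by simp
  have pos: "0 < s \<bullet> (G *v s - Q *v s)" using sy \<tau>s by simp
  have DPQ': "pos_def (B - P + Q)" using D DPQ by simp
  obtain t where Gt: "G *v t = G *v s - Q *v s" and Dt: "(B - P + Q) *v t = B *v s - P *v s"
    and tb: "t \<bullet> (B *v s - P *v s) = s \<bullet> (B *v s - P *v s)"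
    and yt: "(G *v s - Q *v s) \<bullet> t = s \<bullet> (G *v s - Q *v s)"
    and sb: "0 < s \<bullet> (B *v s - P *v s)"
    and part: "partial_update B G (span (insert s ?W)) (bfgs ?D (G *v t) t)"
    using partial_update_step[OF B G subspace_span P Q DPQ' HOL.refl HOL.refl pos]
    unfolding partial_update_def DPQ by metis
  have ytp: "(G *v t) \<bullet> t > 0" using Gt yt pos by simp
  have "span (insert s ?W) = span (set (ds @ [s]))"
  proof
    show "span (insert s ?W) \<subseteq> span (set (ds @ [s]))"
      by (rule span_minimal) (auto intro: span_base span_mono[THEN subsetD, rotated])
    show "span (set (ds @ [s])) \<subseteq> span (insert s ?W)"
      by (rule span_mono) (auto intro: span_base)
  qed
  then have D': "?D' = bfgs ?D (G *v t) t"
    using part partial_update_unique[OF pos_def_imp_psd[OF B] G subspace_span]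
      partial_update_block_update[OF B G ind'] by metis
  have pd: "pos_def ?D'" unfolding D' by (rule pos_def_bfgs[OF D ytp])
  have "det ?D' = det ?D * ((s \<bullet> (G *v s - Q *v s)) / (s \<bullet> (B *v s - P *v s)))"
    unfolding D' det_bfgs[OF D ytp] by (simp only: DPQ Dt tb) (simp only: Gt yt)
  then have "ln (det ?D') = ln (det ?D) + ln (s \<bullet> (G *v s - Q *v s)) - ln (s \<bullet> (B *v s - P *v s))"
    using pos sb pos_def_det[OF D] by (simp add: ln_mult ln_div)
  moreover have "ln (\<tau> * (norm s)\<^sup>2) \<le> ln (s \<bullet> (G *v s - Q *v s))" using sy \<tau>s by simp
  moreover have "ln (s \<bullet> (B *v s - P *v s)) \<le> ln (s \<bullet> (B *v s))"
  proof -
    have "0 \<le> s \<bullet> (P *v s)" using psd_deflation(1)[OF pos_def_imp_psd[OF B] P] by (simp add: psd_def)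
    then show ?thesis using sb by (simp add: inner_diff_right)
  qed
  ultimately show ?case using pd IH by simp
qed

lemma sum_list_le_except_one:
  fixes f :: "'a \<Rightarrow> real"
  assumes "x \<in> set xs" "\<And>y. y \<in> set xs \<Longrightarrow> f y \<le> c" "f x \<le> c + e" "e \<le> 0"
  shows "(\<Sum>y\<leftarrow>xs. f y) \<le> real (length xs) * c + e"
  using assms(1,2)
proof (induction xs)
  case (Cons y ys)
  have all: "(\<Sum>y\<leftarrow>ys. f y) \<le> real (length ys) * c"
    using Cons.prems(2) sum_list_mono[of ys f "\<lambda>_. c"] by (simp add: sum_list_triv)
  show ?case
  proof (cases "x = y")
    case True
    then show ?thesis using all assms(3) by (simp add: algebra_simps)
  next
    case False
    then have "(\<Sum>y\<leftarrow>ys. f y) \<le> real (length ys) * c + e" using Cons by auto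
    moreover have "f y \<le> c" using Cons.prems by simp
    ultimately show ?thesis by (simp add: algebra_simps)
  qed
qed simp

lemma matrix_inv_identity: "matrix_inv \<I> = (\<I> :: real^'n^'n)"
  by (simp add: matrix_eq matrix_inv_mult_vec(1)[OF pos_def_invertible[OF pos_def_identity], simplified])

text \<open>Let \<open>T\<close> be the trace of the subtracted block.  It dominates \<open>\<parallel>B z\<parallel>\<^sup>2 / (z \<bullet> B z)\<close> for every column \<open>z\<close>, so
  the determinant terms add at most \<open>ln T + ln (cos\<^sup>2 \<theta>) - ln \<tau>\<close> per column.  As there are at most \<open>q\<close> columns,
  the logarithms of \<open>T\<close> are absorbed by \<open>- T\<close> at the cost of \<open>q ln q\<close>.  Nonpositive angle terms are kept for one chosen column only.  The trace of
  the added block is at most that of \<open>G\<close>.\<close>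

lemma psi_filtered_update:
  fixes B G :: "real^'n^'n" and M :: real
  assumes B: "pos_def B" and G: "psd G" and M: "\<And>v. v \<bullet> (G *v v) \<le> M * (norm v)\<^sup>2"
    and \<tau>: "\<tau> > 0" and f: "filtered \<tau> G ds" and s: "s \<in> set ds"
    and q: "length ds \<le> q"
  shows "psi \<I> (block_update B G ds) \<le>
    psi \<I> B + (CARD('n) * M + q * ln q + q * \<bar>ln \<tau>\<bar>) + ln (cos2 B s)"
proof -
  have psdB: "psd B" by (rule pos_def_imp_psd[OF B])
  have ind: "independent_for G ds" by (rule filtered_independent[OF G \<tau> f])
  obtain P Q where P: "deflation B (span (set ds)) P" and Q: "deflation G (span (set ds)) Q"
    and D: "block_update B G ds = B - P + Q"
    using partial_update_block_update[OF B G ind] unfolding partial_update_def by blast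
  define T where "T = trace P"
  have nz: "z \<noteq> 0" if "z \<in> set ds" for z
    using f that by (auto simp: filtered_def in_set_conv_nth)
  have BsT: "(norm (B *v z))\<^sup>2 \<le> T * (z \<bullet> (B *v z))" if "z \<in> set ds" for z
  proof -
    have "P *v z = B *v z" using P that by (auto simp: deflation_def intro: span_base)
    then show ?thesis using psd_norm_trace[OF psd_deflation(1)[OF psdB P], of z] by (simp add: T_def)
  qed
  have Bz: "B *v z \<noteq> 0" if "z \<in> set ds" for z
    using pos_def_pos[OF B nz[OF that]] by auto
  have T: "T > 0"
  proof -
    have "0 < (norm (B *v s))\<^sup>2" using Bz[OF s] by simp
    then have "0 < T * (s \<bullet> (B *v s))" using BsT[OF s] by linarith
    then show ?thesis using pos_def_pos[OF B nz[OF s]] by (simp add: zero_less_mult_iff)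
  qed
  have elem: "ln (z \<bullet> (B *v z)) - ln (\<tau> * (norm z)\<^sup>2) \<le> ln T - ln \<tau> + ln (cos2 B z)"
    if z: "z \<in> set ds" for z
  proof -
    have p: "0 < z \<bullet> (B *v z)" "0 < (norm z)\<^sup>2" "0 < (norm (B *v z))\<^sup>2"
      using pos_def_pos[OF B nz[OF z]] nz[OF z] Bz[OF z] by auto
    have "ln (cos2 B z) = 2 * ln (z \<bullet> (B *v z)) - ln ((norm z)\<^sup>2) - ln ((norm (B *v z))\<^sup>2)"
      unfolding cos2_def using p by (simp only: ln_div ln_mult mult_pos_pos zero_less_power ln_realpow) (simp)
    moreover have "ln ((norm (B *v z))\<^sup>2) \<le> ln (T * (z \<bullet> (B *v z)))"
      using BsT[OF z] p(3) by (subst ln_le_cancel_iff) linarith+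
    moreover have "ln (T * (z \<bullet> (B *v z))) = ln T + ln (z \<bullet> (B *v z))"
      using T p by (simp add: ln_mult)
    moreover have "ln (\<tau> * (norm z)\<^sup>2) = ln \<tau> + ln ((norm z)\<^sup>2)"
      using \<tau> p by (subst ln_mult) auto
    ultimately show ?thesis by simp
  qed
  have lncos: "ln (cos2 B z) \<le> 0" if "z \<in> set ds" for z
    using cos2_bounds[OF B nz[OF that]] by simp
  have "(\<Sum>z\<leftarrow>ds. ln (z \<bullet> (B *v z)) - ln (\<tau> * (norm z)\<^sup>2))
      \<le> real (length ds) * (ln T - ln \<tau>) + ln (cos2 B s)"
    by (rule sum_list_le_except_one[OF s]) (use elem lncos s in force)+
  moreover have "real (length ds) * (ln T - ln \<tau>) \<le> T + q * ln q + q * \<bar>ln \<tau>\<bar>"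
  proof -
    have "length ds > 0" using s by (cases ds) auto
    then have q0: "real q \<ge> 1" using q by linarith
    \<comment> \<open>the factor \<open>1 / q\<close> is chosen so that the sum over at most \<open>q\<close> columns gives one \<open>T\<close>\<close>
    have "ln (T / q) \<le> T / q - 1" using T q0 by (intro ln_le_minus_one) simp
    then have "ln T \<le> T / q + ln q" using T q0 by (simp add: ln_div)
    then have "ln T - ln \<tau> \<le> T / q + ln q + \<bar>ln \<tau>\<bar>" by linarith
    then have "real (length ds) * (ln T - ln \<tau>) \<le> real (length ds) * (T / q + ln q + \<bar>ln \<tau>\<bar>)"
      by (intro mult_left_mono) auto
    also have "\<dots> \<le> real q * (T / q + ln q + \<bar>ln \<tau>\<bar>)"
      using q q0 T by (intro mult_right_mono) auto
    also have "\<dots> = T + q * ln q + q * \<bar>ln \<tau>\<bar>" using q0 by (simp add: distrib_left)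
    finally show ?thesis .
  qed
  moreover have "trace Q \<le> CARD('n) * M"
  proof -
    have "Q $ i $ i \<le> M" for i
    proof -
      have e: "A $ i $ i = axis i 1 \<bullet> (A *v axis i 1)" for A :: "real^'n^'n"
        by (simp_all add: inner_axis' matrix_vector_mul_component inner_axis)
      have "axis i 1 \<bullet> (Q *v axis i 1) \<le> axis i 1 \<bullet> (G *v axis i 1)"
        using psd_deflation(2)[OF G Q]
        by (simp add: psd_def matrix_vector_mult_diff_rdistrib inner_diff_right)
      also have "\<dots> \<le> M" using M[of "axis i 1"] by simp
      finally show ?thesis by (simp only: e)
    qed
    then show ?thesis using sum_bounded_above[of UNIV "\<lambda>i. Q $ i $ i" M] by (simp add: trace_def)
  qed
  moreover have "ln (det B) - (\<Sum>z\<leftarrow>ds. ln (z \<bullet> (B *v z)) - ln (\<tau> * (norm z)\<^sup>2)) \<le> ln (det (block_update B G ds))"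
  proof -
    have "(\<Sum>z\<leftarrow>ds. ln (\<tau> * (norm z)\<^sup>2) - ln (z \<bullet> (B *v z)))
        = - (\<Sum>z\<leftarrow>ds. ln (z \<bullet> (B *v z)) - ln (\<tau> * (norm z)\<^sup>2))"
      by (induction ds) auto
    then show ?thesis using filtered_block_update[OF B G \<tau> f] by simp
  qed
  moreover have "trace (block_update B G ds) = trace B - T + trace Q"
    by (simp add: D T_def trace_add trace_sub)
  ultimately show ?thesis by (simp add: psi_def matrix_inv_identity)
qed

section \<open>Convexity and the line search\<close>

locale smooth_convex =
  fixes f :: "real^'n \<Rightarrow> real" and g :: "real^'n \<Rightarrow> real^'n" and G :: "real^'n \<Rightarrow> real^'n^'n"
  assumes gradient: "\<And>y. GDERIV f y :> g y"
    and hessian: "\<And>y. (g has_derivative (\<lambda>h. G y *v h)) (at y)"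
    and convex: "convex_on UNIV f"
begin

lemma line_derivative: "((\<lambda>t. f (x + t *\<^sub>R d)) has_real_derivative g (x + t *\<^sub>R d) \<bullet> d) (at t)"
proof -
  have "((\<lambda>t. f (x + t *\<^sub>R d)) has_derivative (\<lambda>h. (h *\<^sub>R d) \<bullet> g (x + t *\<^sub>R d))) (at t)"
    by (rule has_derivative_compose[where f = "\<lambda>t. x + t *\<^sub>R d" and g = f, unfolded o_def])
      (auto intro!: derivative_eq_intros gradient[unfolded gderiv_def])
  then show ?thesis
    by (simp add: has_field_derivative_def mult.commute inner_commute mult_commute_abs)
qed

lemma line_gradient_derivative:
  "((\<lambda>t. g (x + t *\<^sub>R d) \<bullet> e) has_real_derivative e \<bullet> (G (x + t *\<^sub>R d) *v d)) (at t)"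
proof -
  have "((\<lambda>t. g (x + t *\<^sub>R d)) has_derivative (\<lambda>h. G (x + t *\<^sub>R d) *v (h *\<^sub>R d))) (at t)"
    by (rule has_derivative_compose[where f = "\<lambda>t. x + t *\<^sub>R d" and g = g, unfolded o_def])
      (auto intro!: derivative_eq_intros hessian)
  then have "((\<lambda>t. g (x + t *\<^sub>R d) \<bullet> e) has_derivative (\<lambda>h. (G (x + t *\<^sub>R d) *v (h *\<^sub>R d)) \<bullet> e)) (at t)"
    by (rule has_derivative_inner_left)
  then show ?thesis
    by (simp add: has_field_derivative_def matrix_vector_mult_scaleR inner_commute mult_commute_abs)
qed

lemma tangent: "f x + g x \<bullet> (y - x) \<le> f y"
proof -
  define \<phi> where "\<phi> = (\<lambda>t. f (x + t *\<^sub>R (y - x)))"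
  have "convex_on UNIV \<phi>"
  proof (rule convex_onI)
    fix t a b :: real assume t: "0 < t" "t < 1"
    have "x + ((1 - t) * a + t * b) *\<^sub>R (y - x)
        = (1 - t) *\<^sub>R (x + a *\<^sub>R (y - x)) + t *\<^sub>R (x + b *\<^sub>R (y - x))"
      by (simp add: algebra_simps)
    then show "\<phi> ((1 - t) *\<^sub>R a + t *\<^sub>R b) \<le> (1 - t) * \<phi> a + t * \<phi> b"
      using convex_onD[OF convex, of t "x + a *\<^sub>R (y - x)" "x + b *\<^sub>R (y - x)"] t
      by (simp add: \<phi>_def)
  qed simp
  moreover have "(\<phi> has_field_derivative g x \<bullet> (y - x)) (at 0 within UNIV)"
    using line_derivative[of x "y - x" 0] by (simp add: \<phi>_def)
  ultimately have "(g x \<bullet> (y - x)) * (1 - 0) \<le> \<phi> 1 - \<phi> 0"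
    by (intro convex_on_imp_above_tangent[of UNIV]) auto
  then show ?thesis by (simp add: \<phi>_def)
qed

lemma hessian_nonneg: "0 \<le> v \<bullet> (G y *v v)"
proof -
  define \<phi> where "\<phi> = (\<lambda>t. g (y + t *\<^sub>R v) \<bullet> v)"
  have "\<phi> a \<le> \<phi> b" if "a \<le> b" for a b
  proof (cases "a = b")
    case False
    then have ab: "b - a > 0" using that by simp
    let ?x = "y + a *\<^sub>R v" and ?z = "y + b *\<^sub>R v"
    have "?z - ?x = (b - a) *\<^sub>R v" by (simp add: algebra_simps)
    moreover have "?x - ?z = - ((b - a) *\<^sub>R v)" by (simp add: algebra_simps)
    ultimately have "f ?x + (b - a) * (g ?x \<bullet> v) \<le> f ?z" "f ?z - (b - a) * (g ?z \<bullet> v) \<le> f ?x"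
      using tangent[of ?x ?z] tangent[of ?z ?x] by simp_all
    then have "(b - a) * (g ?x \<bullet> v) \<le> (b - a) * (g ?z \<bullet> v)" by linarith
    then show ?thesis using ab by (simp add: \<phi>_def)
  qed simp
  then have mono: "mono_on UNIV \<phi>" by (intro mono_onI) auto
  have "(\<phi> has_real_derivative v \<bullet> (G y *v v)) (at 0)"
    using line_gradient_derivative[of y v v 0] by (simp add: \<phi>_def)
  then show ?thesis by (rule mono_on_imp_deriv_nonneg[OF mono]) simp
qed

lemma level_segment:
  assumes "f a \<le> c" "f b \<le> c" "0 \<le> t" "t \<le> 1"
  shows "f (a + t *\<^sub>R (b - a)) \<le> c"
proof -
  have "f ((1 - t) *\<^sub>R a + t *\<^sub>R b) \<le> (1 - t) * f a + t * f b"
    using convex_onD[OF convex] assms by auto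
  also have "\<dots> \<le> (1 - t) * c + t * c" using assms by (intro add_mono mult_left_mono) auto
  also have "\<dots> = c" by (simp add: algebra_simps)
  finally show ?thesis by (simp add: algebra_simps)
qed

lemma gradient_mean_value:
  obtains z where "0 < z" "z < 1" "(g (x + d) - g x) \<bullet> d = d \<bullet> (G (x + z *\<^sub>R d) *v d)"
proof -
  have "\<exists>z>0. z < 1 \<and> g (x + 1 *\<^sub>R d) \<bullet> d - g (x + 0 *\<^sub>R d) \<bullet> d
      = (1 - 0) * (d \<bullet> (G (x + z *\<^sub>R d) *v d))"
    by (rule MVT2) (simp_all only: zero_less_one line_gradient_derivative)
  then show ?thesis using that by (auto simp: inner_diff_left)
qed

text \<open>The classical Zoutendijk estimate.  The curvature condition and \<open>G \<preceq> M \<I>\<close> bound the step size from below; the bound on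
  \<open>G\<close> is needed only in the level set, which contains the whole segment by convexity.\<close>

lemma line_search_step:
  assumes B: "pos_def B" and gx: "g x \<noteq> 0"
    and d: "d = - (matrix_inv B *v g x)" and t: "t > 0" and aw: "armijo_wolfe f g \<alpha> \<beta> x d t"
    and \<alpha>: "0 < \<alpha>" and \<beta>: "\<beta> < 1" and M: "M > 0"
    and up: "\<And>y v. f y \<le> f x \<Longrightarrow> v \<bullet> (G y *v v) \<le> M * (norm v)\<^sup>2"
    and s: "s = t *\<^sub>R d"
  shows "s \<noteq> 0"
    and "f (x + s) \<le> f x - \<alpha> * (1 - \<beta>) / M * (norm (g x))\<^sup>2 * cos2 B s"
proof -
  have Bd: "B *v d = - g x"
    by (simp add: d linear_neg[OF matrix_vector_mul_linear] matrix_inv_mult_vec(1)[OF pos_def_invertible[OF B]])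
  then have d0: "d \<noteq> 0" using gx by auto
  show "s \<noteq> 0" using d0 t by (simp add: s)
  define p where "p = - (g x \<bullet> d)"
  have p: "d \<bullet> (B *v d) = p" by (simp add: Bd p_def inner_commute)
  then have p0: "p > 0" using pos_def_pos[OF B d0] by simp
  have dec: "f (x + s) \<le> f x - \<alpha> * t * p"
    using aw by (simp add: armijo_wolfe_def s p_def)
  have "0 \<le> \<alpha> * t * p" using \<alpha> t p0 by simp
  then have le: "f (x + s) \<le> f x" using dec by linarith
  have "(g (x + s) - g x) \<bullet> s \<le> M * (norm s)\<^sup>2"
  proof -
    obtain z where z: "0 < z" "z < 1" "(g (x + s) - g x) \<bullet> s = s \<bullet> (G (x + z *\<^sub>R s) *v s)"
      by (rule gradient_mean_value)
    then have "f (x + z *\<^sub>R s) \<le> f x"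
      using level_segment[of x "f x" "x + s" z] le by simp
    then show ?thesis unfolding z(3) by (rule up)
  qed
  then have "t * ((g (x + s) - g x) \<bullet> d) \<le> t * (t * (M * (norm d)\<^sup>2))"
    using t by (simp add: s power_mult_distrib power2_eq_square mult_ac)
  then have "(g (x + s) - g x) \<bullet> d \<le> t * (M * (norm d)\<^sup>2)" using t by simp
  moreover have "\<beta> * (g x \<bullet> d) \<le> g (x + s) \<bullet> d" using aw by (simp add: armijo_wolfe_def s)
  ultimately have "(1 - \<beta>) * p \<le> t * (M * (norm d)\<^sup>2)"
    by (simp add: p_def inner_diff_left algebra_simps)
  then have "(1 - \<beta>) * p / (M * (norm d)\<^sup>2) \<le> t"
    using M d0 by (simp add: divide_le_eq)
  then have "\<alpha> * ((1 - \<beta>) * p / (M * (norm d)\<^sup>2)) * p \<le> \<alpha> * t * p"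
    using \<alpha> p0 by (intro mult_right_mono mult_left_mono) auto
  moreover have "(norm (g x))\<^sup>2 * cos2 B s = p\<^sup>2 / (norm d)\<^sup>2"
  proof -
    have "s \<bullet> (B *v s) = t\<^sup>2 * p"
      by (simp add: s matrix_vector_mult_scaleR p power2_eq_square)
    moreover have "(norm s)\<^sup>2 = t\<^sup>2 * (norm d)\<^sup>2" "(norm (B *v s))\<^sup>2 = t\<^sup>2 * (norm (g x))\<^sup>2"
      by (simp_all add: s matrix_vector_mult_scaleR Bd power_mult_distrib)
    ultimately have "cos2 B s = (t\<^sup>2 * p)\<^sup>2 / (t\<^sup>2 * (norm d)\<^sup>2 * (t\<^sup>2 * (norm (g x))\<^sup>2))"
      by (simp only: cos2_def)
    then show ?thesis using t gx d0 by (simp add: power2_eq_square)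
  qed
  then have "\<alpha> * (1 - \<beta>) / M * ((norm (g x))\<^sup>2 * cos2 B s)
      = \<alpha> * ((1 - \<beta>) * p / (M * (norm d)\<^sup>2)) * p"
    by (simp add: power2_eq_square)
  ultimately show "f (x + s) \<le> f x - \<alpha> * (1 - \<beta>) / M * (norm (g x))\<^sup>2 * cos2 B s"
    using dec by (simp add: mult.assoc)
qed

end

text \<open>Curvature is assumed in a ball around the minimizer only; convexity makes \<open>f\<close> grow at least linearly outside.\<close>

locale strongly_convex_at_minimizer = smooth_convex f g G
  for f :: "real^'n \<Rightarrow> real" and g G +
  fixes xs :: "real^'n" and m r :: real
  assumes minimizer: "\<And>y. f xs \<le> f y"
    and m: "0 < m" and r: "0 < r"
    and lower: "\<And>y v. y \<in> ball xs r \<Longrightarrow> m * (norm v)\<^sup>2 \<le> v \<bullet> (G y *v v)"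
begin

lemma gradient_minimizer: "g xs = 0"
proof -
  have "g xs \<bullet> g xs = 0"
    using line_derivative[of xs "g xs" 0] minimizer
    by (intro DERIV_local_min[of "\<lambda>t. f (xs + t *\<^sub>R g xs)" _ 0 1]) auto
  then show ?thesis by simp
qed

lemma segment_in_ball:
  assumes "xs + d \<in> ball xs r" "0 \<le> t" "t \<le> 1"
  shows "xs + t *\<^sub>R d \<in> ball xs r"
proof -
  have "\<bar>t\<bar> * norm d \<le> 1 * norm d" using assms by (intro mult_right_mono) auto
  then show ?thesis using assms by (simp add: dist_norm)
qed

lemma gradient_strong:
  assumes "y \<in> ball xs r"
  shows "m * (norm (y - xs))\<^sup>2 \<le> g y \<bullet> (y - xs)"
proof -
  obtain z where z: "0 < z" "z < 1"
    "(g (xs + (y - xs)) - g xs) \<bullet> (y - xs) = (y - xs) \<bullet> (G (xs + z *\<^sub>R (y - xs)) *v (y - xs))"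
    by (rule gradient_mean_value)
  have "xs + z *\<^sub>R (y - xs) \<in> ball xs r" using segment_in_ball[of "y - xs" z] assms z by simp
  from lower[OF this, of "y - xs"] show ?thesis using z(3) by (simp add: gradient_minimizer)
qed

lemma gradient_norm_ge:
  assumes "y \<in> ball xs r"
  shows "m * norm (y - xs) \<le> norm (g y)"
proof -
  have "m * (norm (y - xs))\<^sup>2 \<le> norm (g y) * norm (y - xs)"
    using gradient_strong[OF assms] norm_cauchy_schwarz[of "g y" "y - xs"] by linarith
  then show ?thesis by (cases "y = xs") (auto simp: power2_eq_square)
qed

lemma growth_near:
  assumes "y \<in> ball xs r"
  shows "m / 2 * (norm (y - xs))\<^sup>2 \<le> f y - f xs"
proof -
  define d where "d = y - xs"
  define \<phi> where "\<phi> t = f (xs + t *\<^sub>R d) - m / 2 * (norm d)\<^sup>2 * t\<^sup>2" for t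
  have "\<phi> 0 \<le> \<phi> 1"
  proof (rule DERIV_nonneg_imp_nondecreasing[of 0 1 \<phi>])
    fix t :: real assume t: "0 \<le> t" "t \<le> 1"
    have "(\<phi> has_real_derivative g (xs + t *\<^sub>R d) \<bullet> d - m / 2 * (norm d)\<^sup>2 * (2 * t)) (at t)"
      unfolding \<phi>_def by (auto intro!: derivative_eq_intros line_derivative)
    moreover have "0 \<le> g (xs + t *\<^sub>R d) \<bullet> d - m / 2 * (norm d)\<^sup>2 * (2 * t)"
    proof (cases "t = 0")
      case True
      then show ?thesis by (simp add: gradient_minimizer)
    next
      case False
      have "xs + t *\<^sub>R d \<in> ball xs r" using segment_in_ball[of d t] t assms by (simp add: d_def)
      from gradient_strong[OF this] have "t * (m * t * (norm d)\<^sup>2) \<le> t * (g (xs + t *\<^sub>R d) \<bullet> d)"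
        by (simp add: power_mult_distrib power2_eq_square mult_ac)
      then have "m * t * (norm d)\<^sup>2 \<le> g (xs + t *\<^sub>R d) \<bullet> d" using t False by simp
      then show ?thesis by (simp add: mult_ac)
    qed
    ultimately show "\<exists>y. (\<phi> has_real_derivative y) (at t) \<and> 0 \<le> y" by blast
  qed simp
  then show ?thesis by (simp add: \<phi>_def d_def)
qed

text \<open>Convexity along the segment from \<open>xs\<close> to \<open>y\<close> carries the growth at distance \<open>\<rho>\<close> over to all larger
  distances.\<close>

lemma growth_far:
  assumes \<rho>: "0 < \<rho>" "\<rho> < r" and y: "\<rho> \<le> norm (y - xs)"
  shows "m / 2 * \<rho> * norm (y - xs) \<le> f y - f xs"
proof -
  define N where "N = norm (y - xs)"
  have N: "N > 0" using y \<rho> unfolding N_def by linarith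
  define t where "t = \<rho> / N"
  have t: "0 < t" "t \<le> 1" using \<rho> y N by (simp_all add: t_def N_def[symmetric])
  let ?z = "xs + t *\<^sub>R (y - xs)"
  have nz: "norm (?z - xs) = \<rho>" using N \<rho> by (simp add: t_def N_def[symmetric])
  then have "?z \<in> ball xs r" using \<rho> by (simp add: dist_norm norm_minus_commute)
  from growth_near[OF this] have "m / 2 * \<rho>\<^sup>2 \<le> f ?z - f xs" by (simp only: nz)
  moreover have "f ?z \<le> (1 - t) * f xs + t * f y"
    using convex_onD[OF convex, of t xs y] t by (simp add: algebra_simps)
  ultimately have "m / 2 * \<rho>\<^sup>2 \<le> t * (f y - f xs)" by (simp add: algebra_simps)
  then have "m / 2 * \<rho>\<^sup>2 * N \<le> \<rho> * (f y - f xs)" using N by (simp add: t_def field_simps)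
  then have "\<rho> * (m / 2 * \<rho> * N) \<le> \<rho> * (f y - f xs)" by (simp add: power2_eq_square mult_ac)
  then show ?thesis using \<rho> by (simp add: N_def)
qed

lemma level_bounded:
  obtains R where "R > 0" "\<And>y. f y \<le> c \<Longrightarrow> norm (y - xs) \<le> R"
proof -
  have "norm (y - xs) \<le> max r (4 * \<bar>c - f xs\<bar> / (m * r)) + r" if "f y \<le> c" for y
  proof (cases "norm (y - xs) \<le> r / 2")
    case False
    then have "m / 2 * (r / 2) * norm (y - xs) \<le> f y - f xs"
      using r by (intro growth_far) auto
    also have "\<dots> \<le> \<bar>c - f xs\<bar>" using that by linarith
    finally have "norm (y - xs) \<le> 4 * \<bar>c - f xs\<bar> / (m * r)" using m r by (simp add: field_simps)
    then show ?thesis using r by linarith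
  qed (use r in linarith)
  moreover have "0 < max r (4 * \<bar>c - f xs\<bar> / (m * r)) + r" using r by linarith
  ultimately show ?thesis using that by blast
qed

lemma close_if_small_value:
  assumes \<rho>: "0 < \<rho>" "\<rho> < r" and y: "f y - f xs < m / 2 * \<rho>\<^sup>2"
  shows "norm (y - xs) < \<rho>"
proof (rule ccontr)
  assume "\<not> norm (y - xs) < \<rho>"
  then have N: "\<rho> \<le> norm (y - xs)" by simp
  have "m / 2 * \<rho> * \<rho> \<le> m / 2 * \<rho> * norm (y - xs)"
    using N m \<rho> by (intro mult_left_mono) auto
  then show False using growth_far[OF \<rho> N] y by (simp add: power2_eq_square mult.assoc)
qed

lemma value_le: "f y - f xs \<le> norm (g y) * norm (y - xs)"
proof -
  have "f y - f xs \<le> g y \<bullet> (y - xs)"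
    using tangent[of y xs] by (simp add: inner_diff_right)
  also have "\<dots> \<le> norm (g y) * norm (y - xs)" by (rule norm_cauchy_schwarz)
  finally show ?thesis .
qed

end

section \<open>Potential arguments for sequences\<close>

text \<open>The inequality that couples the two estimates: a potential that goes up by \<open>\<Delta>\<close> forces \<open>c\<close> to be at least an affine
  function of \<open>\<Delta>\<close>.  Its sum over the iterations telescopes.\<close>

lemma exp_tangent_bound:
  fixes c K \<Delta> :: real
  assumes "0 < c" and "\<Delta> \<le> K + ln c"
  shows "exp (- K) * (1 + \<Delta>) \<le> c"
proof -
  have "1 + \<Delta> \<le> 1 + (K + ln c)" using assms by simp
  also have "\<dots> \<le> exp (K + ln c)" by (rule exp_ge_add_one_self)
  also have "\<dots> = exp K * c" using assms by (simp add: exp_add)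
  finally show ?thesis by (simp add: exp_minus field_simps)
qed

text \<open>The quantity \<open>1 / h - b \<psi>\<close> never decreases and gains at least \<open>b\<close> at each index in \<open>U\<close>.  If \<open>U\<close> is infinite, this makes
  \<open>1 / h\<close> unbounded; if \<open>U\<close> is finite, the last hypothesis does.\<close>

lemma sublinear_lyapunov:
  fixes h \<psi> c :: "nat \<Rightarrow> real"
  assumes h: "\<And>k. 0 < h k" and dec: "\<And>k. h (Suc k) \<le> h k" and \<psi>: "\<And>k. 0 \<le> \<psi> k" and a: "0 < a"
    and upd: "\<And>k. k \<in> U \<Longrightarrow> 0 < c k \<and> 1 / h k + a * c k \<le> 1 / h (Suc k) \<and> \<psi> (Suc k) \<le> \<psi> k + K + ln (c k)"
    and no: "\<And>k. k \<notin> U \<Longrightarrow> \<psi> (Suc k) = \<psi> k"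
    and const: "\<And>N. (\<And>k. k \<ge> N \<Longrightarrow> k \<notin> U) \<Longrightarrow> \<exists>e>0. \<forall>k\<ge>N. 1 / h k + e \<le> 1 / h (Suc k)"
  shows "h \<longlonglongrightarrow> 0"
proof -
  have unbounded: "\<exists>k. C < 1 / h k" for C
  proof (rule ccontr)
    assume "\<not> (\<exists>k. C < 1 / h k)"
    then have C: "1 / h k \<le> C" for k by (simp add: not_less)
    show False
    proof (cases "finite U")
      case True
      then obtain N where "\<forall>k\<in>U. k < N" using finite_nat_set_iff_bounded by blast
      then have "\<And>k. k \<ge> N \<Longrightarrow> k \<notin> U" by (meson not_less)
      from const[OF this] obtain e where e: "e > 0" "\<And>k. k \<ge> N \<Longrightarrow> 1 / h k + e \<le> 1 / h (Suc k)" by blast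
      have "1 / h N + real j * e \<le> 1 / h (N + j)" for j
      proof (induction j)
        case (Suc j)
        then show ?case using e(2)[of "N + j"] by (simp add: algebra_simps)
      qed simp
      moreover obtain j where "C < real j * e" using reals_Archimedean3[OF e(1)] by blast
      moreover have "0 < 1 / h N" using h by simp
      ultimately show False using C[of "N + j"] by (smt (verit))
    next
      case False
      define b where "b = a * exp (- K)"
      have b: "b > 0" using a by (simp add: b_def)
      define L where "L k = 1 / h k - b * \<psi> k" for k
      have step: "L k + (if k \<in> U then b else 0) \<le> L (Suc k)" for k
      proof (cases "k \<in> U")
        case True
        have "exp (- K) * (1 + (\<psi> (Suc k) - \<psi> k)) \<le> c k"
          using upd[OF True] by (intro exp_tangent_bound) auto
        then have "b * (1 + (\<psi> (Suc k) - \<psi> k)) \<le> a * c k"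
          using a by (simp add: b_def mult.assoc)
        then show ?thesis using upd[OF True] True by (simp add: L_def algebra_simps)
      next
        case False
        have "1 / h k \<le> 1 / h (Suc k)" using h dec by (simp add: frac_le)
        then show ?thesis using False no by (simp add: L_def)
      qed
      have sum: "L 0 + b * real (card (U \<inter> {..<k})) \<le> L k" for k
      proof (induction k)
        case (Suc k)
        have "card (U \<inter> {..<Suc k}) = card (U \<inter> {..<k}) + (if k \<in> U then 1 else 0)"
          by (simp add: lessThan_Suc)
        then show ?case using Suc step[of k] by (auto simp: algebra_simps split: if_splits)
      qed simp
      obtain j where j: "C - L 0 < real j * b" using reals_Archimedean3[OF b] by blast
      obtain T where T: "T \<subseteq> U" "finite T" "card T = j"
        using infinite_arbitrarily_large[OF False] by blast
      obtain k where "T \<subseteq> {..<k}" using T(2) finite_nat_iff_bounded by blast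
      then have "j \<le> card (U \<inter> {..<k})" using T card_mono[of "U \<inter> {..<k}" T] by auto
      then have "real j * b \<le> b * real (card (U \<inter> {..<k}))" using b by simp
      then have "C < L k" using sum[of k] j by linarith
      moreover have "L k \<le> 1 / h k" using b \<psi>[of k] by (simp add: L_def)
      ultimately show False using C[of k] by linarith
    qed
  qed
  have "decseq h" using dec by (intro decseq_SucI)
  show ?thesis
  proof (rule LIMSEQ_I)
    fix e :: real assume e: "e > 0"
    obtain k where "1 / e < 1 / h k" using unbounded by blast
    then have "h k < e" using e h[of k] by (simp add: field_simps)
    then show "\<exists>no. \<forall>n\<ge>no. norm (h n - 0) < e"
      using \<open>decseq h\<close> h by (intro exI[of _ k]) (smt (verit) decseqD real_norm_def)
  qed
qed

text \<open>Here \<open>ln h + b \<psi>\<close> loses at least \<open>b\<close> at every index.\<close>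

lemma linear_lyapunov:
  fixes h \<psi> c :: "nat \<Rightarrow> real"
  assumes h: "\<And>k. 0 < h k" and \<psi>: "\<And>k. 0 \<le> \<psi> k" and a: "0 < a"
    and upd: "\<And>k. 0 < c k \<and> h (Suc k) \<le> h k * (1 - a * c k) \<and> \<psi> (Suc k) \<le> \<psi> k + K + ln (c k)"
  obtains b C where "0 < b" "0 < C" "\<And>k. h k \<le> C * exp (- b) ^ k"
proof -
  define b where "b = a * exp (- K)"
  have b: "b > 0" using a by (simp add: b_def)
  define L where "L k = ln (h k) + b * \<psi> k" for k
  have step: "L (Suc k) \<le> L k - b" for k
  proof -
    have "exp (- K) * (1 + (\<psi> (Suc k) - \<psi> k)) \<le> c k"
      using upd[of k] by (intro exp_tangent_bound) auto
    then have bc: "b * (1 + (\<psi> (Suc k) - \<psi> k)) \<le> a * c k"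
      using a by (simp add: b_def mult.assoc)
    have "0 < h k * (1 - a * c k)" using h[of "Suc k"] upd[of k] by linarith
    then have p: "0 < 1 - a * c k" using h[of k] by (simp add: zero_less_mult_iff)
    have "ln (h (Suc k)) \<le> ln (h k * (1 - a * c k))" using upd[of k] h[of "Suc k"] by simp
    also have "\<dots> = ln (h k) + ln (1 - a * c k)" using h[of k] p by (simp add: ln_mult)
    also have "ln (1 - a * c k) \<le> - (a * c k)" using ln_le_minus_one[OF p] by simp
    finally show ?thesis using bc by (simp add: L_def algebra_simps)
  qed
  have L: "L k \<le> L 0 - b * real k" for k
  proof (induction k)
    case (Suc k)
    then show ?case using step[of k] by (simp add: algebra_simps)
  qed simp
  have "h k \<le> exp (L 0) * exp (- b) ^ k" for k
  proof -
    have "h k = exp (ln (h k))" using h by simp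
    also have "\<dots> \<le> exp (L 0 - b * real k)" using L[of k] b \<psi>[of k] by (simp add: L_def) (smt (verit) mult_nonneg_nonneg)
    also have "\<dots> = exp (L 0) * exp (- b) ^ k"
      by (simp add: exp_diff exp_minus exp_of_nat_mult[symmetric] power_inverse field_simps)
    finally show ?thesis .
  qed
  then show ?thesis using that[OF b, of "exp (L 0)"] by simp
qed

text \<open>After subtraction of the partial sums of \<open>\<delta>\<close>, the sequence \<open>\<psi>\<close> is decreasing and bounded below, so its increments
  tend to 0.\<close>

lemma summable_drift_vanishes:
  fixes \<psi> \<delta> :: "nat \<Rightarrow> real"
  assumes lb: "\<And>k. l \<le> \<psi> k" and step: "\<And>k. \<psi> (Suc k) \<le> \<psi> k + \<delta> k"
    and \<delta>: "summable \<delta>" "\<And>k. 0 \<le> \<delta> k"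
  shows "(\<lambda>k. \<psi> k + \<delta> k - \<psi> (Suc k)) \<longlonglongrightarrow> 0"
proof -
  define z where "z k = \<psi> k - (\<Sum>j<k. \<delta> j)" for k
  have dec: "decseq z" using step by (intro decseq_SucI) (simp add: z_def algebra_simps)
  have "l - suminf \<delta> \<le> z k" for k
    using lb[of k] sum_le_suminf[OF \<delta>(1), of "{..<k}"] \<delta>(2) by (simp add: z_def)
  then obtain Z where "z \<longlonglongrightarrow> Z" using decseq_convergent[OF dec] by metis
  then have "(\<lambda>k. z k - z (Suc k)) \<longlonglongrightarrow> Z - Z" by (intro tendsto_diff LIMSEQ_Suc)
  moreover have "z k - z (Suc k) = \<psi> k + \<delta> k - \<psi> (Suc k)" for k by (simp add: z_def)
  ultimately show ?thesis by simp
qed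

section \<open>The quasi-Newton step near the minimizer\<close>

locale lipschitz_hessian_at_minimizer = strongly_convex_at_minimizer f g G xs m r
  for f :: "real^'n \<Rightarrow> real" and g G xs m r +
  fixes \<mu> :: real
  assumes lip: "\<And>y. y \<in> ball xs r \<Longrightarrow> norm (G y - G xs) \<le> \<mu> * norm (y - xs)"
    and mu: "0 \<le> \<mu>"
    and sym: "transpose (G xs) = G xs"
begin

lemma pos_def_minimizer: "pos_def (G xs)"
  unfolding pos_def_def
proof (intro conjI sym allI impI)
  fix v :: "real^'n" assume "v \<noteq> 0"
  then have "0 < m * (norm v)\<^sup>2" using m by simp
  also have "\<dots> \<le> v \<bullet> (G xs *v v)" using r by (intro lower) simp
  finally show "0 < v \<bullet> (G xs *v v)" .
qed

lemma gradient_linearization: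
  assumes \<rho>: "0 < \<rho>" "\<rho> \<le> r" and a: "a \<in> ball xs \<rho>" and b: "b \<in> ball xs \<rho>"
  shows "norm (g b - g a - G xs *v (b - a)) \<le> norm (b - a) * (\<mu> * \<rho>)"
proof (rule differentiable_bound_linearization[where S = "ball xs \<rho>" and f = g and f' = "\<lambda>z. (*v) (G z)"])
  show "a + t *\<^sub>R (b - a) \<in> ball xs \<rho>" if "t \<in> {0..1}" for t
  proof -
    have "(1 - t) *\<^sub>R a + t *\<^sub>R b \<in> ball xs \<rho>"
      using convex_ball[of xs \<rho>] a b that by (intro convexD) auto
    then show ?thesis by (simp add: algebra_simps)
  qed
  show "(g has_derivative (*v) (G z)) (at z within ball xs \<rho>)" for z
    using hessian by (rule has_derivative_at_withinI)
  show "onorm ((*v) (G z) - (*v) (G xs)) \<le> \<mu> * \<rho>" if z: "z \<in> ball xs \<rho>" for z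
  proof (rule onorm_le)
    fix v :: "real^'n"
    have "norm (G z - G xs) \<le> \<mu> * norm (z - xs)" using z \<rho> by (intro lip) auto
    also have "\<dots> \<le> \<mu> * \<rho>" using z mu by (intro mult_left_mono) (auto simp: dist_norm norm_minus_commute)
    finally have "norm (G z - G xs) * norm v \<le> \<mu> * \<rho> * norm v" by (intro mult_right_mono) auto
    then show "norm (((*v) (G z) - (*v) (G xs)) v) \<le> \<mu> * \<rho> * norm v"
      using norm_matrix_vector_le[of "G z - G xs" v]
      by (simp add: matrix_vector_mult_diff_rdistrib)
  qed
qed (use \<rho> in auto)

lemma quadratic_model:
  assumes \<eta>: "\<And>t. 0 \<le> t \<Longrightarrow> t \<le> 1 \<Longrightarrow> norm (g (y + t *\<^sub>R d) - g y - t *\<^sub>R (A *v d)) \<le> t * norm d * \<eta>"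
  shows "f (y + d) \<le> f y + g y \<bullet> d + (d \<bullet> (A *v d) + \<eta> * (norm d)\<^sup>2) / 2"
proof -
  define \<phi> where "\<phi> t = t * (g y \<bullet> d) + (d \<bullet> (A *v d) + \<eta> * (norm d)\<^sup>2) / 2 * t\<^sup>2 - f (y + t *\<^sub>R d)" for t
  have "\<phi> 0 \<le> \<phi> 1"
  proof (rule DERIV_nonneg_imp_nondecreasing[of 0 1 \<phi>])
    fix t :: real assume t: "0 \<le> t" "t \<le> 1"
    let ?D = "g y \<bullet> d + (d \<bullet> (A *v d) + \<eta> * (norm d)\<^sup>2) / 2 * (2 * t) - g (y + t *\<^sub>R d) \<bullet> d"
    have "(\<phi> has_real_derivative ?D) (at t)"
      unfolding \<phi>_def by (auto intro!: derivative_eq_intros line_derivative)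
    moreover have "0 \<le> ?D"
    proof -
      have "(g (y + t *\<^sub>R d) - g y - t *\<^sub>R (A *v d)) \<bullet> d
          \<le> norm (g (y + t *\<^sub>R d) - g y - t *\<^sub>R (A *v d)) * norm d"
        by (rule norm_cauchy_schwarz)
      also have "\<dots> \<le> (t * norm d * \<eta>) * norm d" using \<eta>[OF t] by (intro mult_right_mono) auto
      finally show ?thesis
        by (simp add: inner_diff_left inner_commute power2_eq_square algebra_simps add_divide_distrib)
    qed
    ultimately show "\<exists>y. (\<phi> has_real_derivative y) (at t) \<and> 0 \<le> y" by blast
  qed simp
  then show ?thesis by (simp add: \<phi>_def)
qed

text \<open>A bound for \<open>\<parallel>d\<parallel> / \<parallel>y - xs\<parallel>\<close> when \<open>d\<close> is the direction at \<open>y\<close> given by a matrix that is close to \<open>G xs\<close> along \<open>d\<close>.\<close>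

definition step_ratio :: real where
  "step_ratio = 2 * (norm (G xs) + \<mu> * r) / m"

lemma step_ratio_nonneg: "0 \<le> step_ratio"
  using mu r m by (simp add: step_ratio_def)

text \<open>One step under the Dennis-More condition with constant \<open>\<omega>\<close>.  On the ball of radius \<open>\<rho>\<close> the gradient is linear with matrix
  \<open>G xs\<close> up to a relative error \<open>\<omega>\<close>.  Hence the unit step reduces \<open>f\<close> by about half of \<open>p = d \<bullet> B d\<close>, which is
  enough as \<open>\<alpha> < 1 / 2\<close>, and leaves a gradient of size at most \<open>2 \<omega> \<parallel>d\<parallel>\<close>, which gives the curvature condition and
  the contraction.\<close>

lemma quasi_newton_step:
  assumes Bd: "B *v d = - g y" and dm: "norm (B *v d - G xs *v d) \<le> \<omega> * norm d"
    and \<omega>: "\<omega> \<le> m / 2" "\<omega> \<le> (1/2 - \<alpha>) * m / 2" "\<omega> \<le> \<beta> * m / 4" "0 \<le> \<omega>"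
    and \<rho>: "0 < \<rho>" "\<rho> \<le> r" "\<mu> * \<rho> \<le> \<omega>" and y: "(1 + step_ratio) * norm (y - xs) < \<rho>"
    and \<alpha>: "\<alpha> < 1/2" and \<beta>: "0 < \<beta>"
  shows "armijo_wolfe f g \<alpha> \<beta> y d 1"
    and "norm (y + d - xs) \<le> 2 * \<omega> * step_ratio / m * norm (y - xs)"
proof -
  let ?A = "G xs"
  define p where "p = d \<bullet> (B *v d)"
  have L0: "0 \<le> step_ratio * norm (y - xs)" using step_ratio_nonneg by simp
  have yb: "y \<in> ball xs \<rho>" using y L0 by (simp add: dist_norm norm_minus_commute algebra_simps)
  have lowA: "m * (norm d)\<^sup>2 \<le> d \<bullet> (?A *v d)" using r by (intro lower) simp
  have Ad: "m * norm d \<le> norm (?A *v d)"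
  proof -
    have "m * (norm d)\<^sup>2 \<le> norm d * norm (?A *v d)"
      using lowA norm_cauchy_schwarz[of d "?A *v d"] by linarith
    then show ?thesis by (cases "d = 0") (auto simp: power2_eq_square)
  qed
  have "norm (?A *v d) \<le> norm (B *v d) + norm (B *v d - ?A *v d)"
    using norm_triangle_ineq4[of "B *v d" "B *v d - ?A *v d"] by simp
  then have "m * norm d \<le> norm (g y) + \<omega> * norm d" using Ad dm Bd by simp
  moreover have "\<omega> * norm d \<le> m / 2 * norm d" using \<omega>(1) by (intro mult_right_mono) auto
  ultimately have gd: "m / 2 * norm d \<le> norm (g y)" by (simp add: algebra_simps)
  have "norm (g y) \<le> (norm ?A + \<mu> * r) * norm (y - xs)"
  proof -
    have "norm (g y - g xs - ?A *v (y - xs)) \<le> norm (y - xs) * (\<mu> * r)"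
      using yb \<rho> r by (intro gradient_linearization) auto
    moreover have "norm (g y) \<le> norm (g y - g xs - ?A *v (y - xs)) + norm (?A *v (y - xs))"
      using norm_triangle_ineq[of "g y - g xs - ?A *v (y - xs)" "?A *v (y - xs)"]
      by (simp add: gradient_minimizer)
    moreover have "norm (?A *v (y - xs)) \<le> norm ?A * norm (y - xs)" by (rule norm_matrix_vector_le)
    ultimately show ?thesis by (simp add: algebra_simps)
  qed
  with gd have "m / 2 * norm d \<le> (norm ?A + \<mu> * r) * norm (y - xs)" by linarith
  then have dL: "norm d \<le> step_ratio * norm (y - xs)"
    using m by (simp add: step_ratio_def field_simps)
  have seg: "y + t *\<^sub>R d \<in> ball xs \<rho>" if "0 \<le> t" "t \<le> 1" for t
  proof -
    have "norm (y + t *\<^sub>R d - xs) \<le> norm (y - xs) + norm (t *\<^sub>R d)"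
      using norm_triangle_ineq[of "y - xs" "t *\<^sub>R d"] by (simp add: algebra_simps)
    also have "norm (t *\<^sub>R d) \<le> 1 * norm d" using that by (simp add: mult_left_le_one_le)
    also have "norm (y - xs) + 1 * norm d \<le> (1 + step_ratio) * norm (y - xs)"
      using dL by (simp add: algebra_simps)
    finally show ?thesis using y by (simp add: dist_norm norm_minus_commute)
  qed
  have lin: "norm (g (y + t *\<^sub>R d) - g y - t *\<^sub>R (?A *v d)) \<le> t * norm d * \<omega>" if t: "0 \<le> t" "t \<le> 1" for t
  proof -
    have "norm (g (y + t *\<^sub>R d) - g y - ?A *v ((y + t *\<^sub>R d) - y)) \<le> norm ((y + t *\<^sub>R d) - y) * (\<mu> * \<rho>)"
      using yb seg[OF t] \<rho> by (intro gradient_linearization) auto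
    also have "\<dots> \<le> norm ((y + t *\<^sub>R d) - y) * \<omega>" using \<rho>(3) by (intro mult_left_mono) auto
    finally show ?thesis using t by (simp add: matrix_vector_mult_scaleR)
  qed
  have gyd: "g y \<bullet> d = - p" using Bd by (simp add: p_def inner_commute)
  have dAp: "\<bar>d \<bullet> (?A *v d) - p\<bar> \<le> \<omega> * (norm d)\<^sup>2"
  proof -
    have "\<bar>d \<bullet> (B *v d - ?A *v d)\<bar> \<le> norm d * norm (B *v d - ?A *v d)" by (rule Cauchy_Schwarz_ineq2)
    also have "\<dots> \<le> norm d * (\<omega> * norm d)" using dm by (intro mult_left_mono) auto
    finally show ?thesis by (simp add: p_def inner_diff_right power2_eq_square mult_ac abs_minus_commute)
  qed
  have "\<omega> * (norm d)\<^sup>2 \<le> m / 2 * (norm d)\<^sup>2" using \<omega>(1) by (intro mult_right_mono) auto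
  then have pm: "m / 2 * (norm d)\<^sup>2 \<le> p" using dAp lowA by (simp add: abs_le_iff algebra_simps)
  show "armijo_wolfe f g \<alpha> \<beta> y d 1"
    unfolding armijo_wolfe_def
  proof (intro conjI)
    have "f (y + d) \<le> f y - p + (d \<bullet> (?A *v d) + \<omega> * (norm d)\<^sup>2) / 2"
      using quadratic_model[OF lin] gyd by simp
    also have "\<dots> \<le> f y - p / 2 + \<omega> * (norm d)\<^sup>2" using abs_le_D1[OF dAp] by (simp add: field_simps)
    also have "\<omega> * (norm d)\<^sup>2 \<le> (1/2 - \<alpha>) * p"
    proof -
      have "\<omega> * (norm d)\<^sup>2 \<le> (1/2 - \<alpha>) * m / 2 * (norm d)\<^sup>2" using \<omega>(2) by (intro mult_right_mono) auto
      also have "\<dots> = (1/2 - \<alpha>) * (m / 2 * (norm d)\<^sup>2)" by simp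
      also have "\<dots> \<le> (1/2 - \<alpha>) * p" using pm \<alpha> by (intro mult_left_mono) auto
      finally show ?thesis .
    qed
    finally show "f (y + 1 *\<^sub>R d) \<le> f y + \<alpha> * 1 * (g y \<bullet> d)" by (simp add: gyd algebra_simps)
    have "\<bar>(g (y + 1 *\<^sub>R d) - g y - 1 *\<^sub>R (?A *v d)) \<bullet> d\<bar> \<le> norm d * \<omega> * norm d"
      using Cauchy_Schwarz_ineq2[of "g (y + 1 *\<^sub>R d) - g y - 1 *\<^sub>R (?A *v d)" d] lin[of 1]
      by (smt (verit) mult_1 mult_right_mono norm_ge_zero)
    moreover have "(g (y + 1 *\<^sub>R d) - g y - 1 *\<^sub>R (?A *v d)) \<bullet> d = g (y + d) \<bullet> d + p - d \<bullet> (?A *v d)"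
      using gyd by (simp add: inner_diff_left inner_commute[of "?A *v d" d])
    moreover have "norm d * \<omega> * norm d = \<omega> * (norm d)\<^sup>2" by (simp add: power2_eq_square)
    ultimately have "- 2 * (\<omega> * (norm d)\<^sup>2) \<le> g (y + d) \<bullet> d"
      using dAp by linarith
    moreover have "2 * (\<omega> * (norm d)\<^sup>2) \<le> \<beta> * p"
    proof -
      have "2 * (\<omega> * (norm d)\<^sup>2) \<le> 2 * (\<beta> * m / 4 * (norm d)\<^sup>2)"
        using \<omega>(3) by (intro mult_left_mono mult_right_mono) auto
      also have "\<dots> = \<beta> * (m / 2 * (norm d)\<^sup>2)" by simp
      also have "\<dots> \<le> \<beta> * p" using pm \<beta> by (intro mult_left_mono) auto
      finally show ?thesis .
    qed
    ultimately show "\<beta> * (g y \<bullet> d) \<le> g (y + 1 *\<^sub>R d) \<bullet> d" by (simp add: gyd)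
  qed
  have "norm (g (y + d)) \<le> 2 * \<omega> * norm d"
  proof -
    have "g (y + d) = (g (y + d) - g y - ?A *v d) - (B *v d - ?A *v d)" by (simp add: Bd)
    then have "norm (g (y + d)) \<le> norm (g (y + d) - g y - ?A *v d) + norm (B *v d - ?A *v d)"
      by (metis norm_triangle_ineq4)
    then show ?thesis using lin[of 1] dm by (simp add: algebra_simps)
  qed
  also have "\<dots> \<le> 2 * \<omega> * (step_ratio * norm (y - xs))" using dL \<omega>(4) by (intro mult_left_mono) auto
  finally have "norm (g (y + d)) \<le> 2 * \<omega> * (step_ratio * norm (y - xs))" .
  moreover have "m * norm (y + d - xs) \<le> norm (g (y + d))"
    using seg[of 1] \<rho> by (intro gradient_norm_ge) auto
  ultimately show "norm (y + d - xs) \<le> 2 * \<omega> * step_ratio / m * norm (y - xs)"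
    using m by (simp add: field_simps)
qed

end

section \<open>Runs of the algorithm\<close>

lemma set_retained: "set (retained \<tau> A s p) \<subseteq> {1..p}"
  by (induction p) (auto simp: Let_def)

lemma length_retained: "length (retained \<tau> A s p) \<le> p"
  by (induction p) (auto simp: Let_def)

lemma retained_mono: "p \<le> p' \<Longrightarrow> set (retained \<tau> A s p) \<subseteq> set (retained \<tau> A s p')"
  by (induction p' rule: dec_induct) (auto simp: Let_def)

lemma filter_value_Nil: "filter_value A [] s = s \<bullet> (A *v s)"
proof -
  have "block_term A [] = 0"
    by (simp add: block_term_def Let_def Finite_Cartesian_Product.vec_eq_iff)
  then show ?thesis by (simp add: filter_value_def)
qed

lemma loewner_le_upper: "A \<preceq> M *\<^sub>R \<I> \<Longrightarrow> v \<bullet> (A *v v) \<le> M * (norm v)\<^sup>2"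
  unfolding loewner_le_def psd_def
  by (simp add: matrix_vector_mult_diff_rdistrib scaleR_mult_vec inner_diff_right power2_norm_eq_inner)

lemma loewner_le_lower: "M *\<^sub>R \<I> \<preceq> A \<Longrightarrow> M * (norm v)\<^sup>2 \<le> v \<bullet> (A *v v)"
  unfolding loewner_le_def psd_def
  by (simp add: matrix_vector_mult_diff_rdistrib scaleR_mult_vec inner_diff_right power2_norm_eq_inner)

lemma loewner_le_symmetric:
  assumes "A \<preceq> M *\<^sub>R \<I>"
  shows "transpose A = (A :: real^'n^'n)"
proof (rule symmetricI)
  fix x y :: "real^'n"
  have "transpose (M *\<^sub>R \<I> - A) = M *\<^sub>R \<I> - A" using assms by (simp add: loewner_le_def psd_def)
  from symmetric_dot[OF this, of x y] show "(A *v x) \<bullet> y = x \<bullet> (A *v y)"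
    by (simp add: matrix_vector_mult_diff_rdistrib scaleR_mult_vec inner_diff_right inner_diff_left)
qed

locale block_bfgs_run = lipschitz_hessian_at_minimizer f g G xs m r \<mu>
  for f :: "real^'n \<Rightarrow> real" and g G xs m r \<mu> +
  fixes x1 :: "real^'n" and B1 :: "real^'n^'n" and q :: nat and \<tau> \<alpha> \<beta> M :: real
    and x s :: "nat \<Rightarrow> nat \<Rightarrow> real^'n" and lam :: "nat \<Rightarrow> nat \<Rightarrow> real" and B :: "nat \<Rightarrow> real^'n^'n"
  assumes B1: "pos_def B1" and q: "q \<ge> 1" and tau: "\<tau> > 0" and tau_le: "\<tau> \<le> m"
    and alpha: "0 < \<alpha>" "\<alpha> < 1/2" and beta: "\<alpha> < \<beta>" "\<beta> < 1"
    and run: "block_BFGS f g G x1 B1 q \<tau> \<alpha> \<beta> x s lam B"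
    and nonzero_gradient: "\<And>k i. k \<ge> 1 \<Longrightarrow> i \<in> {1..q + 1} \<Longrightarrow> g (x k i) \<noteq> 0"
    and M: "M > 0" "\<And>y. f y \<le> f x1 \<Longrightarrow> G y \<preceq> M *\<^sub>R \<I>"
begin

abbreviation ret :: "nat \<Rightarrow> nat list" where
  "ret k \<equiv> retained \<tau> (G (x k (q + 1))) (s k) q"

abbreviation steps :: "nat \<Rightarrow> (real^'n) list" where
  "steps k \<equiv> filter_steps \<tau> (G (x k (q + 1))) (s k) q"

abbreviation dir :: "nat \<Rightarrow> nat \<Rightarrow> real^'n" where
  "dir k i \<equiv> - (matrix_inv (B k) *v g (x k i))"

lemma run_start: "x 1 1 = x1" "B 1 = B1"
  using run by (simp_all add: block_BFGS_def)

lemma run_inner: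
  assumes "k \<ge> 1" "i \<in> {1..q}"
  shows "lam k i > 0" "armijo_wolfe f g \<alpha> \<beta> (x k i) (dir k i) (lam k i)"
    "armijo_wolfe f g \<alpha> \<beta> (x k i) (dir k i) 1 \<Longrightarrow> lam k i = 1"
    "s k i = lam k i *\<^sub>R dir k i" "x k (Suc i) = x k i + s k i"
  using run assms unfolding block_BFGS_def Let_def by auto

lemma run_outer:
  assumes "k \<ge> 1"
  shows "B (Suc k) = block_update (B k) (G (x k (q + 1))) (steps k)" "x (Suc k) 1 = x k (q + 1)"
  using run assms unfolding block_BFGS_def Let_def by auto

lemma hessian_level:
  assumes "f y \<le> f x1"
  shows "v \<bullet> (G y *v v) \<le> M * (norm v)\<^sup>2" "psd (G y)"
  using loewner_le_upper[OF M(2)[OF assms]] loewner_le_symmetric[OF M(2)[OF assms]] hessian_nonneg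
  by (auto simp: psd_def)

definition descent_const :: real where "descent_const = \<alpha> * (1 - \<beta>) / M"

lemma descent_const: "descent_const > 0"
  using alpha beta M by (simp add: descent_const_def)

lemma inner_step:
  assumes k: "k \<ge> 1" and i: "i \<in> {1..q}" and B: "pos_def (B k)" and lev: "f (x k i) \<le> f x1"
  shows "s k i \<noteq> 0"
    "f (x k (Suc i)) \<le> f (x k i) - descent_const * (norm (g (x k i)))\<^sup>2 * cos2 (B k) (s k i)"
proof -
  have gx: "g (x k i) \<noteq> 0" using nonzero_gradient[OF k] i by auto
  have up: "v \<bullet> (G y *v v) \<le> M * (norm v)\<^sup>2" if "f y \<le> f (x k i)" for y v
    using hessian_level(1) that lev by auto
  note step = line_search_step[OF B gx HOL.refl run_inner(1,2)[OF k i] alpha(1) beta(2) M(1) up run_inner(4)[OF k i]]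
  show "s k i \<noteq> 0" by (rule step(1))
  show "f (x k (Suc i)) \<le> f (x k i) - descent_const * (norm (g (x k i)))\<^sup>2 * cos2 (B k) (s k i)"
    unfolding descent_const_def run_inner(5)[OF k i] by (rule step(2))
qed

lemma level_inner:
  assumes k: "k \<ge> 1" and B: "pos_def (B k)" and lev: "f (x k 1) \<le> f x1"
    and i: "1 \<le> i" "i \<le> j" "j \<le> q + 1"
  shows "f (x k j) \<le> f (x k i) \<and> f (x k j) \<le> f x1"
proof -
  have *: "f (x k (Suc i)) \<le> f (x k i)" if i: "i \<in> {1..q}" and l: "f (x k i) \<le> f x1" for i
  proof -
    have "0 \<le> descent_const * (norm (g (x k i)))\<^sup>2 * cos2 (B k) (s k i)"
      using descent_const cos2_bounds[OF B inner_step(1)[OF k i B l]] by simp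
    then show ?thesis using inner_step(2)[OF k i B l] by linarith
  qed
  have l: "i \<le> q + 1 \<Longrightarrow> f (x k i) \<le> f x1" if "1 \<le> i" for i
    using that
  proof (induction i rule: dec_induct)
    case (step n)
    then show ?case using *[of n] by auto
  qed (use lev in simp)
  have "j \<le> q + 1 \<Longrightarrow> f (x k j) \<le> f (x k i)"
    using i(2)
  proof (induction j rule: dec_induct)
    case (step n)
    then have "f (x k (Suc n)) \<le> f (x k n)" using i(1) l by (intro *) auto
    then show ?case using step by auto
  qed simp
  then show ?thesis using l i by auto
qed

lemma invariant:
  assumes "k \<ge> 1"
  shows "pos_def (B k) \<and> f (x k 1) \<le> f x1"
  using assms
proof (induction k rule: dec_induct)
  case base
  then show ?case by (simp add: run_start[unfolded One_nat_def] B1)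
next
  case (step k)
  then have k: "k \<ge> 1" and B: "pos_def (B k)" and l: "f (x k 1) \<le> f x1" by auto
  have l1: "f (x k (q + 1)) \<le> f x1" using level_inner[OF k B l, of 1 "q + 1"] by simp
  have "filtered \<tau> (G (x k (q + 1))) (steps k)"
    using level_inner[OF k B l] by (intro filtered_filter_steps inner_step[OF k _ B]) auto
  then have "pos_def (B (Suc k))"
    unfolding run_outer(1)[OF k] using filtered_block_update[OF B hessian_level(2)[OF l1] tau] by blast
  then show ?case using l1 by (simp add: run_outer(2)[OF k, unfolded One_nat_def])
qed

lemmas pos_def_B = invariant[THEN conjunct1]

lemma level:
  assumes "k \<ge> 1" "i \<in> {1..q + 1}"
  shows "f (x k i) \<le> f x1"
  using level_inner[OF assms(1), of 1 i] invariant[OF assms(1)] assms(2) by auto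

lemma descent:
  assumes "k \<ge> 1" "1 \<le> i" "i \<le> j" "j \<le> q + 1"
  shows "f (x k j) \<le> f (x k i)"
  using level_inner[OF assms(1) _ _ assms(2-)] invariant[OF assms(1)] by auto

lemma step_facts:
  assumes k: "k \<ge> 1" and i: "i \<in> {1..q}"
  shows "s k i \<noteq> 0"
    "f (x k (Suc i)) \<le> f (x k i) - descent_const * (norm (g (x k i)))\<^sup>2 * cos2 (B k) (s k i)"
    "0 < cos2 (B k) (s k i)"
proof -
  have l: "f (x k i) \<le> f x1" using level[OF k] i by auto
  show "s k i \<noteq> 0"
    "f (x k (Suc i)) \<le> f (x k i) - descent_const * (norm (g (x k i)))\<^sup>2 * cos2 (B k) (s k i)"
    using inner_step[OF k i pos_def_B[OF k] l] by auto
  then show "0 < cos2 (B k) (s k i)" using cos2_bounds[OF pos_def_B[OF k]] by blast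
qed

lemma filtered_steps: "k \<ge> 1 \<Longrightarrow> filtered \<tau> (G (x k (q + 1))) (steps k)"
  by (intro filtered_filter_steps step_facts)

lemma psd_outer: "k \<ge> 1 \<Longrightarrow> psd (G (x k (q + 1)))"
  by (intro hessian_level level) auto

lemma retained_in_steps: "i \<in> set (ret k) \<Longrightarrow> s k i \<in> set (steps k)"
  by (simp add: filter_steps_def)

lemma retained_index: "i \<in> set (ret k) \<Longrightarrow> i \<in> {1..q}"
  using set_retained by blast

lemma length_steps: "length (steps k) \<le> q"
  using length_retained by (simp add: filter_steps_def)

definition drift_const :: real where
  "drift_const = CARD('n) * M + q * ln q + q * \<bar>ln \<tau>\<bar>"

lemma psi_outer:
  assumes k: "k \<ge> 1" and i: "i \<in> set (ret k)"
  shows "psi \<I> (B (Suc k)) \<le> psi \<I> (B k) + drift_const + ln (cos2 (B k) (s k i))"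
proof -
  have "v \<bullet> (G (x k (q + 1)) *v v) \<le> M * (norm v)\<^sup>2" for v
    using level[OF k] by (intro hessian_level) auto
  from psi_filtered_update[OF pos_def_B[OF k] psd_outer[OF k] this tau filtered_steps[OF k]
      retained_in_steps[OF i] length_steps]
  show ?thesis unfolding run_outer(1)[OF k] drift_const_def .
qed

lemma psi_nonneg: "k \<ge> 1 \<Longrightarrow> 0 \<le> psi \<I> (B k)"
  using psi_ge[OF pos_def_B pos_def_identity, of k] by simp

section \<open>Convergence of the function values\<close>

definition gap :: "nat \<Rightarrow> nat \<Rightarrow> real" where
  "gap k i = f (x k i) - f xs"

text \<open>A nonzero gradient gives strict descent, so an inner iterate has a larger value than its successor; the last iterate
  of a block is the first of the next one.\<close>

lemma gap_pos:
  assumes "k \<ge> 1" "i \<in> {1..q + 1}"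
  shows "0 < gap k i"
proof -
  have *: "0 < gap k i" if k: "k \<ge> 1" and i: "i \<in> {1..q}" for k i
  proof -
    have "g (x k i) \<noteq> 0" using nonzero_gradient[OF k] i by auto
    then have "0 < descent_const * (norm (g (x k i)))\<^sup>2 * cos2 (B k) (s k i)"
      using descent_const step_facts(3)[OF k i] by simp
    then show ?thesis
      using step_facts(2)[OF k i] minimizer[of "x k (Suc i)"] unfolding gap_def by linarith
  qed
  show ?thesis
  proof (cases "i = q + 1")
    case True
    then have "gap k i = gap (Suc k) 1" using run_outer(2)[OF assms(1)] by (simp add: gap_def)
    then show ?thesis using *[of "Suc k" 1] q by simp
  next
    case False
    then show ?thesis using * assms by auto
  qed
qed

lemma gap_descent:
  assumes "k \<ge> 1" "1 \<le> i" "i \<le> j" "j \<le> q + 1"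
  shows "gap k j \<le> gap k i"
  using descent[OF assms] by (simp add: gap_def)

lemma gap_Suc: "k \<ge> 1 \<Longrightarrow> gap (Suc k) 1 = gap k (q + 1)"
  using run_outer(2) by (simp add: gap_def)

lemma gap_outer:
  assumes k: "k \<ge> 1"
  shows "gap (Suc k) 1 \<le> gap k 1"
  using gap_descent[OF k, of 1 "q + 1"] gap_Suc[OF k] by simp

text \<open>By convexity \<open>h \<le> \<parallel>g\<parallel> R\<close>, so a descent of the order \<open>\<parallel>g\<parallel>\<^sup>2\<close> is one of the order \<open>h\<^sup>2\<close>, which is additive
  for \<open>1 / h\<close>.  The other steps of the block do no harm since \<open>f\<close> decreases along them too.\<close>

lemma reciprocal_gap:
  assumes R: "R > 0" "\<And>y. f y \<le> f x1 \<Longrightarrow> norm (y - xs) \<le> R" and k: "k \<ge> 1" and i: "i \<in> {1..q}"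
  shows "1 / gap k 1 + descent_const / R\<^sup>2 * cos2 (B k) (s k i) \<le> 1 / gap (Suc k) 1"
proof -
  define h h' c where "h = gap k i" and "h' = gap k (Suc i)" and "c = descent_const / R\<^sup>2 * cos2 (B k) (s k i)"
  have pos: "0 < h" "0 < h'" using gap_pos[OF k] i by (auto simp: h_def h'_def)
  have c: "0 < c" using descent_const R step_facts(3)[OF k i] by (simp add: c_def)
  have "h \<le> norm (g (x k i)) * norm (x k i - xs)" unfolding h_def gap_def by (rule value_le)
  also have "\<dots> \<le> norm (g (x k i)) * R" using R(2) level[OF k] i by (intro mult_left_mono) auto
  finally have "h / R \<le> norm (g (x k i))" using R by (simp add: divide_le_eq)
  then have "(h / R)\<^sup>2 \<le> (norm (g (x k i)))\<^sup>2" using pos R by (intro power_mono) auto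
  then have "descent_const * (h / R)\<^sup>2 * cos2 (B k) (s k i) \<le> descent_const * (norm (g (x k i)))\<^sup>2 * cos2 (B k) (s k i)"
    using descent_const step_facts(3)[OF k i] by (intro mult_right_mono mult_left_mono) auto
  then have "h' \<le> h - c * h\<^sup>2"
    using step_facts(2)[OF k i] by (simp add: h_def h'_def gap_def c_def power_divide mult_ac)
  then have "h' + c * h * h' \<le> h"
  proof -
    assume le: "h' \<le> h - c * h\<^sup>2"
    have "0 \<le> c * h\<^sup>2" using c by simp
    then have "h' \<le> h" using le by linarith
    then have "c * h * h' \<le> c * h * h" using c pos by (intro mult_left_mono) auto
    then show ?thesis using le by (simp add: power2_eq_square mult.assoc)
  qed
  then have "1 / h + c \<le> 1 / h'" using pos by (simp add: field_simps)
  moreover have "1 / gap k 1 \<le> 1 / h"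
    using gap_descent[OF k, of 1 i] i pos unfolding h_def by (intro frac_le) auto
  moreover have "1 / h' \<le> 1 / gap (Suc k) 1"
    using gap_descent[OF k, of "Suc i" "q + 1"] gap_Suc[OF k] gap_pos[of "Suc k" 1] i
    unfolding h'_def by (intro frac_le) auto
  ultimately show ?thesis unfolding c_def by linarith
qed

text \<open>Far from \<open>xs\<close> the filter may discard all columns.  If that happens from some iteration on, \<open>B\<close> stays fixed and
  the angles are bounded; otherwise the potential controls the angles at the iterations with a retained column.\<close>

lemma gap_tendsto_0: "(\<lambda>k. gap (Suc k) 1) \<longlonglongrightarrow> 0"
proof -
  obtain R where R: "R > 0" "\<And>y. f y \<le> f x1 \<Longrightarrow> norm (y - xs) \<le> R" using level_bounded by blast
  define i where "i k = hd (ret (Suc k))" for k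
  have i: "i k \<in> set (ret (Suc k))" if "ret (Suc k) \<noteq> []" for k using that by (simp add: i_def)
  have same: "B (Suc (Suc k)) = B (Suc k)" if "ret (Suc k) = []" for k
    using that run_outer(1)[of "Suc k"] by (simp add: filter_steps_def block_update_def)
  show ?thesis
  proof (rule sublinear_lyapunov[where \<psi> = "\<lambda>k. psi \<I> (B (Suc k))" and U = "{k. ret (Suc k) \<noteq> []}"
        and a = "descent_const / R\<^sup>2" and c = "\<lambda>k. cos2 (B (Suc k)) (s (Suc k) (i k))" and K = drift_const])
    show "0 < descent_const / R\<^sup>2" using descent_const R by simp
    fix k :: nat
    show "0 < gap (Suc k) 1" by (rule gap_pos) auto
    show "gap (Suc (Suc k)) 1 \<le> gap (Suc k) 1" by (rule gap_outer) auto
    show "0 \<le> psi \<I> (B (Suc k))" by (rule psi_nonneg) auto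
    show "psi \<I> (B (Suc (Suc k))) = psi \<I> (B (Suc k))" if "k \<notin> {k. ret (Suc k) \<noteq> []}"
      using same that by simp
    assume "k \<in> {k. ret (Suc k) \<noteq> []}"
    then have ik: "i k \<in> set (ret (Suc k))" using i by simp
    show "0 < cos2 (B (Suc k)) (s (Suc k) (i k)) \<and>
      1 / gap (Suc k) 1 + descent_const / R\<^sup>2 * cos2 (B (Suc k)) (s (Suc k) (i k)) \<le> 1 / gap (Suc (Suc k)) 1 \<and>
      psi \<I> (B (Suc (Suc k))) \<le> psi \<I> (B (Suc k)) + drift_const + ln (cos2 (B (Suc k)) (s (Suc k) (i k)))"
      using retained_index[OF ik] by (intro conjI step_facts reciprocal_gap R psi_outer ik) auto
  next
    fix N assume none: "\<And>k. N \<le> k \<Longrightarrow> k \<notin> {k. ret (Suc k) \<noteq> []}"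
    have B: "B (Suc k) = B (Suc N)" if "N \<le> k" for k
      using that
    proof (induction k rule: dec_induct)
      case (step n)
      then show ?case using none[of n] same[of n] by simp
    qed simp
    obtain e where e: "0 < e" "\<And>s. s \<noteq> 0 \<Longrightarrow> e \<le> cos2 (B (Suc N)) s"
      using cos2_lower[OF pos_def_B[of "Suc N"]] by auto
    have "1 / gap (Suc k) 1 + descent_const / R\<^sup>2 * e \<le> 1 / gap (Suc (Suc k)) 1" if "N \<le> k" for k
    proof -
      have "descent_const / R\<^sup>2 * e \<le> descent_const / R\<^sup>2 * cos2 (B (Suc k)) (s (Suc k) 1)"
        using e(2)[of "s (Suc k) 1"] step_facts(1)[of "Suc k" 1] q descent_const B[OF that] by (intro mult_left_mono) auto
      then show ?thesis using reciprocal_gap[OF R, of "Suc k" 1] q by auto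
    qed
    then show "\<exists>e>0. \<forall>k\<ge>N. 1 / gap (Suc k) 1 + e \<le> 1 / gap (Suc (Suc k)) 1"
      using e descent_const R by (intro exI[of _ "descent_const / R\<^sup>2 * e"]) auto
  qed
qed

lemma eventually_near:
  assumes \<rho>: "0 < \<rho>"
  obtains N where "N \<ge> 1" "\<And>k i. k \<ge> N \<Longrightarrow> i \<in> {1..q + 1} \<Longrightarrow> norm (x k i - xs) < \<rho>"
proof -
  \<comment> \<open>\<open>r / 2\<close> keeps the radius strictly below \<open>r\<close>, as \<open>growth_far\<close> requires\<close>
  define \<rho>' where "\<rho>' = min \<rho> (r / 2)"
  have \<rho>': "0 < \<rho>'" "\<rho>' < r" "\<rho>' \<le> \<rho>" using \<rho> r by (auto simp: \<rho>'_def)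
  then have "0 < m / 2 * \<rho>'\<^sup>2" using m by simp
  then obtain N where N: "\<And>k. k \<ge> N \<Longrightarrow> norm (gap (Suc k) 1 - 0) < m / 2 * \<rho>'\<^sup>2"
    using LIMSEQ_D[OF gap_tendsto_0] by blast
  show ?thesis
  proof (rule that[of "Suc N"])
    fix k i assume k: "Suc N \<le> k" and i: "i \<in> {1..q + 1}"
    then have k1: "k \<ge> 1" by simp
    have "gap k 1 < m / 2 * \<rho>'\<^sup>2" 
    proof -
      have "N \<le> k - 1" "Suc (k - 1) = k" using k by auto
      then have "\<bar>gap k 1\<bar> < m / 2 * \<rho>'\<^sup>2" using N[of "k - 1"] by (simp only: real_norm_def diff_zero)
      then show ?thesis by (simp only: abs_less_iff)
    qed
    moreover have "gap k i \<le> gap k 1" using gap_descent[OF k1, of 1 i] i by simp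
    ultimately have "norm (x k i - xs) < \<rho>'"
      using \<rho>' by (intro close_if_small_value) (auto simp: gap_def)
    then show "norm (x k i - xs) < \<rho>" using \<rho>' by simp
  qed simp
qed

text \<open>The first column meets an empty list, so its filter value is \<open>s \<bullet> G s\<close>.\<close>

lemma first_retained:
  assumes "k \<ge> 1" and near: "norm (x k (q + 1) - xs) < r"
  shows "1 \<in> set (ret k)"
proof -
  have "\<tau> * (norm (s k 1))\<^sup>2 \<le> m * (norm (s k 1))\<^sup>2" using tau_le by (intro mult_right_mono) auto
  also have "\<dots> \<le> s k 1 \<bullet> (G (x k (q + 1)) *v s k 1)"
    using near by (intro lower) (simp add: dist_norm norm_minus_commute)
  finally have "1 \<in> set (retained \<tau> (G (x k (q + 1))) (s k) 1)"
    by (simp add: filter_value_Nil)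
  then show ?thesis using retained_mono q by blast
qed

text \<open>Near \<open>xs\<close> every iteration retains its first step, and \<open>h \<le> \<parallel>g\<parallel>\<^sup>2 / m\<close> turns the descent into a contraction.\<close>

lemma summable_distance: "summable (\<lambda>k. norm (x (Suc k) 1 - xs))"
proof -
  obtain N where N: "N \<ge> 1" "\<And>k i. k \<ge> N \<Longrightarrow> i \<in> {1..q + 1} \<Longrightarrow> norm (x k i - xs) < r"
    using eventually_near[OF r] by blast
  have k1: "k + N \<ge> 1" for k using N by simp
  have nb: "x (k + N) i \<in> ball xs r" if "i \<in> {1..q + 1}" for k i
    using N(2)[of "k + N" i] that by (simp add: dist_norm norm_minus_commute)
  have one: "1 \<in> {1..q}" "1 \<in> {1..q + 1}" using q by auto
  obtain b C where b: "0 < b" and C: "0 < C" and hC: "\<And>k. gap (k + N) 1 \<le> C * exp (- b) ^ k"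
  proof (rule linear_lyapunov[where h = "\<lambda>k. gap (k + N) 1" and \<psi> = "\<lambda>k. psi \<I> (B (k + N))"
        and a = "descent_const * m" and c = "\<lambda>k. cos2 (B (k + N)) (s (k + N) 1)" and K = drift_const])
    show "0 < descent_const * m" using descent_const m by simp
    fix k :: nat
    let ?k = "k + N" and ?g = "norm (g (x (k + N) 1))" and ?c = "cos2 (B (k + N)) (s (k + N) 1)"
    show h: "0 < gap ?k 1" by (rule gap_pos[OF k1 one(2)])
    show "0 \<le> psi \<I> (B ?k)" by (rule psi_nonneg[OF k1])
    have c: "0 < ?c" by (rule step_facts(3)[OF k1 one(1)])
    have "1 \<in> set (ret ?k)" using N(2)[of ?k "q + 1"] by (intro first_retained k1) auto
    then have "psi \<I> (B (Suc ?k)) \<le> psi \<I> (B ?k) + drift_const + ln ?c" by (rule psi_outer[OF k1])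
    moreover have "gap (Suc ?k) 1 \<le> gap ?k 1 * (1 - descent_const * m * ?c)"
    proof -
      have "m * gap ?k 1 \<le> m * (?g * norm (x ?k 1 - xs))"
        using m unfolding gap_def by (intro mult_left_mono value_le) auto
      also have "\<dots> = ?g * (m * norm (x ?k 1 - xs))" by simp
      also have "\<dots> \<le> ?g * ?g" by (intro mult_left_mono gradient_norm_ge nb one) auto
      finally have "descent_const * (m * gap ?k 1) * ?c \<le> descent_const * ?g\<^sup>2 * ?c"
        using descent_const c by (intro mult_right_mono mult_left_mono) (auto simp: power2_eq_square)
      then have "gap ?k 2 \<le> gap ?k 1 * (1 - descent_const * m * ?c)"
        using step_facts(2)[OF k1 one(1), of k] by (simp add: gap_def algebra_simps numeral_2_eq_2)
      moreover have "gap (Suc ?k) 1 \<le> gap ?k 2"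
        using gap_descent[OF k1, of 2 "q + 1" k] gap_Suc[OF k1, of k] q by simp
      ultimately show ?thesis by linarith
    qed
    ultimately show "0 < ?c \<and> gap (Suc k + N) 1 \<le> gap ?k 1 * (1 - descent_const * m * ?c)
      \<and> psi \<I> (B (Suc k + N)) \<le> psi \<I> (B ?k) + drift_const + ln ?c" using c by simp
  qed blast
  \<comment> \<open>the function values decay like \<open>exp (- b)\<close>, the distances like its square root\<close>
  define \<rho> where "\<rho> = exp (- b / 2)"
  have \<rho>: "0 < \<rho>" "\<rho> < 1" "\<rho>\<^sup>2 = exp (- b)"
    using b by (auto simp: \<rho>_def power2_eq_square exp_add[symmetric])
  have bound: "norm (x (k + N) 1 - xs) \<le> sqrt (2 * C / m) * \<rho> ^ k" for k
  proof (rule power2_le_imp_le)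
    have "m / 2 * (norm (x (k + N) 1 - xs))\<^sup>2 \<le> gap (k + N) 1"
      unfolding gap_def by (rule growth_near[OF nb[OF one(2)]])
    also have "\<dots> \<le> C * (\<rho>\<^sup>2) ^ k" using hC[of k] by (simp add: \<rho>)
    finally have "(norm (x (k + N) 1 - xs))\<^sup>2 \<le> 2 * C / m * (\<rho>\<^sup>2) ^ k" using m by (simp add: field_simps)
    also have "\<dots> = (sqrt (2 * C / m) * \<rho> ^ k)\<^sup>2"
      using C m by (simp add: power_mult_distrib power_mult[symmetric] mult.commute)
    finally show "(norm (x (k + N) 1 - xs))\<^sup>2 \<le> (sqrt (2 * C / m) * \<rho> ^ k)\<^sup>2" .
    show "0 \<le> sqrt (2 * C / m) * \<rho> ^ k" using \<rho> C m by simp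
  qed
  have "summable (\<lambda>k. sqrt (2 * C / m) * \<rho> ^ k)"
    using \<rho> by (intro summable_mult summable_geometric) simp
  then have "summable (\<lambda>k. norm (x (k + N) 1 - xs))"
    by (rule summable_comparison_test[rotated]) (use bound in auto)
  then show ?thesis
    using summable_iff_shift[of "\<lambda>k. norm (x k 1 - xs)"] summable_Suc_iff[of "\<lambda>k. norm (x k 1 - xs)"] by blast
qed

section \<open>Superlinear convergence\<close>

lemma hessian_ball:
  assumes "y \<in> ball xs r" "f y \<le> f x1"
  shows "pos_def (G y)"
  unfolding pos_def_def
proof (intro conjI allI impI)
  show "transpose (G y) = G y" using hessian_level(2)[OF assms(2)] by (simp add: psd_def)
  fix v :: "real^'n" assume "v \<noteq> 0"
  then have "0 < m * (norm v)\<^sup>2" using m by simp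
  also have "\<dots> \<le> v \<bullet> (G y *v v)" by (rule lower[OF assms(1)])
  finally show "0 < v \<bullet> (G y *v v)" .
qed

text \<open>The Hessians used in the updates differ from \<open>G xs\<close> by at most \<open>\<mu>\<close> times the distances that have just been shown to be
  summable.  The factor \<open>q + 1\<close> in the error accounts for the retained columns, one of which is counted twice because it is processed first.\<close>

lemma discrepancy_vanishes:
  obtains N a where "N \<ge> 1" "a \<longlonglongrightarrow> 0"
    "\<And>k i. k \<ge> N \<Longrightarrow> i \<in> set (ret k) \<Longrightarrow> discrepancy (G xs) (B k) (s k i) \<le> a k"
proof -
  let ?A = "G xs"
  obtain N where N: "N \<ge> 1" "\<And>k i. k \<ge> N \<Longrightarrow> i \<in> {1..q + 1} \<Longrightarrow> norm (x k i - xs) < r"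
    using eventually_near[OF r] by blast
  define e where "e k = norm (x (Suc k) 1 - xs)" for k
  \<comment> \<open>the error \<open>(\<mu> e / m)\<^sup>2\<close> is made linear in \<open>e\<close> by \<open>e \<le> r\<close>, since it is the sum of the \<open>e k\<close> that is known to be finite\<close>
  define lip_const where "lip_const = (\<mu> / m) * (\<mu> / m * r)"
  have lip_const: "0 \<le> lip_const" using mu m r by (simp add: lip_const_def)
  define \<delta> where "\<delta> k = real (Suc q) * (lip_const * e k)" for k
  define a where "a k = psi ?A (B k) + \<delta> k - psi ?A (B (Suc k))" for k
  have main: "discrepancy ?A (B k) (s k i) \<le> a k" if k: "k \<ge> N" and i: "i \<in> set (ret k)" for k i
  proof -
    have k1: "k \<ge> 1" using k N by simp
    let ?y = "x k (q + 1)"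
    have ey: "e k = norm (?y - xs)" using run_outer(2)[OF k1] by (simp add: e_def)
    have yr: "norm (?y - xs) < r" using N(2)[OF k, of "q + 1"] by simp
    then have yb: "?y \<in> ball xs r" by (simp add: dist_norm norm_minus_commute)
    have Gy: "pos_def (G ?y)" using level[OF k1, of "q + 1"] by (intro hessian_ball yb) auto
    have d: "discrepancy ?A (G ?y) t \<le> lip_const * e k" if t: "t \<noteq> 0" for t
    proof -
      define \<eta> where "\<eta> = \<mu> * e k"
      have \<eta>: "0 \<le> \<eta>" using mu by (simp add: \<eta>_def e_def)
      have "norm ((G ?y - ?A) *v v) \<le> \<eta> * norm v" for v
      proof -
        have "norm ((G ?y - ?A) *v v) \<le> norm (G ?y - ?A) * norm v" by (rule norm_matrix_vector_le)
        also have "\<dots> \<le> \<eta> * norm v" using lip[OF yb] ey by (intro mult_right_mono) (auto simp: \<eta>_def)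
        finally show ?thesis .
      qed
      then have "discrepancy ?A (G ?y) t \<le> (\<eta> / m)\<^sup>2"
        using r by (intro discrepancy_near Gy pos_def_minimizer m lower[OF yb] lower t) auto
      also have "\<dots> \<le> (\<eta> / m) * (\<mu> / m * r)"
      proof -
        have "\<mu> * e k \<le> \<mu> * r" using yr ey mu by (intro mult_left_mono) auto
        then have "\<eta> / m \<le> \<mu> / m * r" using m by (simp add: \<eta>_def divide_right_mono)
        then show ?thesis unfolding power2_eq_square using \<eta> m by (intro mult_left_mono) auto
      qed
      finally show ?thesis by (simp add: \<eta>_def lip_const_def algebra_simps)
    qed
    have e0: "0 \<le> lip_const * e k" using lip_const by (simp add: e_def)
    have "psi ?A (B (Suc k)) \<le> psi ?A (B k) - discrepancy ?A (B k) (s k i) + real (Suc (length (steps k))) * (lip_const * e k)"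
      unfolding run_outer(1)[OF k1]
      by (rule psi_block_update[OF pos_def_B[OF k1] Gy pos_def_minimizer
            filtered_independent[OF psd_outer[OF k1] tau filtered_steps[OF k1]] e0 d retained_in_steps[OF i]])
        (use step_facts(1)[OF k1] retained_index[OF i] in auto)
    also have "real (Suc (length (steps k))) * (lip_const * e k) \<le> \<delta> k"
      unfolding \<delta>_def using length_steps[of k] e0 by (intro mult_right_mono) auto
    finally show ?thesis by (simp add: a_def)
  qed
  have "e = (\<lambda>k. norm (x (Suc k) 1 - xs))" by (rule ext) (simp only: e_def)
  then have "summable e" using summable_distance by (simp only:)
  then have "summable \<delta>" unfolding \<delta>_def by (intro summable_mult)
  then have sN: "summable (\<lambda>k. \<delta> (k + N))" by (simp add: summable_iff_shift)
  have "(\<lambda>k. psi ?A (B (k + N)) + \<delta> (k + N) - psi ?A (B (Suc k + N))) \<longlonglongrightarrow> 0"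
  proof (rule summable_drift_vanishes[OF _ _ sN])
    fix k :: nat
    have k1: "k + N \<ge> 1" using N by simp
    show "CARD('n) - ln (det ?A) \<le> psi ?A (B (k + N))"
      by (rule psi_ge[OF pos_def_B[OF k1] pos_def_minimizer])
    show "0 \<le> \<delta> (k + N)" using lip_const by (simp add: \<delta>_def e_def)
    have 1: "1 \<in> set (ret (k + N))" using N(2)[of "k + N" "q + 1"] by (intro first_retained k1) auto
    have "0 \<le> discrepancy ?A (B (k + N)) (s (k + N) 1)"
      using step_facts(1)[OF k1, of 1] q by (intro discrepancy_nonneg pos_def_B[OF k1] pos_def_minimizer) auto
    then show "psi ?A (B (Suc k + N)) \<le> psi ?A (B (k + N)) + \<delta> (k + N)"
      using main[OF _ 1] by (simp add: a_def)
  qed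
  then have "(\<lambda>k. a (k + N)) \<longlonglongrightarrow> 0" by (simp add: a_def)
  then have "a \<longlonglongrightarrow> 0" by (simp add: LIMSEQ_offset)
  with N(1) main show ?thesis using that by blast
qed

text \<open>The classical characterisation of superlinear convergence, here for each retained step of a block and the one
  matrix \<open>B k\<close> that the whole block shares.\<close>

lemma dennis_more:
  assumes \<omega>: "0 < \<omega>"
  obtains N where "N \<ge> 1" "\<And>k i. k \<ge> N \<Longrightarrow> i \<in> set (ret k) \<Longrightarrow>
    norm (B k *v s k i - G xs *v s k i) \<le> \<omega> * norm (s k i)"
proof -
  obtain N a where N: "N \<ge> 1" and a: "a \<longlonglongrightarrow> 0"
    and da: "\<And>k i. k \<ge> N \<Longrightarrow> i \<in> set (ret k) \<Longrightarrow> discrepancy (G xs) (B k) (s k i) \<le> a k"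
    using discrepancy_vanishes by blast
  \<comment> \<open>the constant of \<open>discrepancy_controls\<close>, increased by 1 to make it positive\<close>
  define T where "T = 13 * trace (G xs) * M + 1"
  have tr: "0 \<le> trace (G xs)" by (rule psd_trace_nonneg[OF pos_def_imp_psd[OF pos_def_minimizer]])
  then have T: "T > 0" using M(1) by (simp add: T_def add_nonneg_pos)
  have "0 < min 1 (\<omega>\<^sup>2 / T)" using \<omega> T by simp
  then obtain N' where N': "\<And>k. k \<ge> N' \<Longrightarrow> norm (a k - 0) < min 1 (\<omega>\<^sup>2 / T)"
    using LIMSEQ_D[OF a] by blast
  show ?thesis
  proof (rule that[of "max N N'"])
    fix k i assume k: "max N N' \<le> k" and i: "i \<in> set (ret k)"
    have k1: "k \<ge> 1" using k N by simp
    let ?d = "discrepancy (G xs) (B k) (s k i)" and ?s = "s k i"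
    have s0: "?s \<noteq> 0" using step_facts(1)[OF k1] retained_index[OF i] by blast
    have d: "?d \<le> 1" "?d \<le> \<omega>\<^sup>2 / T" using da[OF _ i] N'[of k] k by auto
    have d0: "0 \<le> ?d" by (rule discrepancy_nonneg[OF pos_def_B[OF k1] pos_def_minimizer s0])
    have "(norm (B k *v ?s - G xs *v ?s))\<^sup>2 \<le> 13 * ?d * trace (G xs) * (?s \<bullet> (G xs *v ?s))"
      by (rule discrepancy_controls[OF pos_def_B[OF k1] pos_def_minimizer s0 d(1)])
    also have "\<dots> \<le> 13 * ?d * trace (G xs) * (M * (norm ?s)\<^sup>2)"
      using d0 tr minimizer by (intro mult_left_mono hessian_level) auto
    also have "\<dots> = ?d * (13 * trace (G xs) * M) * (norm ?s)\<^sup>2" by simp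
    also have "\<dots> \<le> (\<omega>\<^sup>2 / T) * T * (norm ?s)\<^sup>2"
      using d d0 T tr M(1) by (intro mult_right_mono mult_mono) (auto simp: T_def)
    also have "\<dots> = (\<omega> * norm ?s)\<^sup>2" using T by (simp add: power_mult_distrib)
    finally show "norm (B k *v ?s - G xs *v ?s) \<le> \<omega> * norm ?s"
      by (rule power2_le_imp_le) (use \<omega> in simp)
  qed (use N in simp)
qed

lemma superlinear:
  assumes \<epsilon>: "\<epsilon> > 0"
  shows "\<exists>K. \<forall>k\<ge>K. k \<ge> 1 \<longrightarrow> (\<forall>i\<in>{1..q}. i \<in> set (ret k) \<longrightarrow>
    norm (x k (i + 1) - xs) / norm (x k i - xs) < \<epsilon>)"
proof -
  let ?L = "step_ratio"
  have L: "0 \<le> ?L" by (rule step_ratio_nonneg)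
  \<comment> \<open>the first three bounds are those of \<open>quasi_newton_step\<close>, the last makes the contraction factor at most \<open>\<epsilon> / 2\<close>\<close>
  define \<omega> where "\<omega> = min (min (m / 2) ((1/2 - \<alpha>) * m / 2)) (min (\<beta> * m / 4) (\<epsilon> * m / (4 * (?L + 1))))"
  have pos: "0 < m / 2" "0 < (1/2 - \<alpha>) * m / 2" "0 < \<beta> * m / 4" "0 < \<epsilon> * m / (4 * (?L + 1))"
    using m alpha beta \<epsilon> L by (auto intro!: divide_pos_pos mult_pos_pos)
  have \<omega>: "0 < \<omega>" "\<omega> \<le> m / 2" "\<omega> \<le> (1/2 - \<alpha>) * m / 2" "\<omega> \<le> \<beta> * m / 4" "\<omega> \<le> \<epsilon> * m / (4 * (?L + 1))"
    unfolding \<omega>_def using pos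
    by - (simp only: min_less_iff_conj,
      (meson min.cobounded1 min.cobounded2 order_trans)+)
  define \<rho> where "\<rho> = min r (\<omega> / (\<mu> + 1))"
  have \<rho>: "0 < \<rho>" "\<rho> \<le> r" using r \<omega>(1) mu by (auto simp: \<rho>_def)
  have "\<rho> \<le> \<omega> / (\<mu> + 1)" by (simp add: \<rho>_def)
  then have "(\<mu> + 1) * \<rho> \<le> \<omega>" using mu by (simp add: pos_le_divide_eq mult.commute)
  then have \<mu>\<rho>: "\<mu> * \<rho> \<le> \<omega>" using \<rho> by (simp add: algebra_simps)
  have "0 < \<rho> / (1 + ?L)" using \<rho> L by simp
  then obtain N1 where N1: "N1 \<ge> 1" "\<And>k i. k \<ge> N1 \<Longrightarrow> i \<in> {1..q + 1} \<Longrightarrow> norm (x k i - xs) < \<rho> / (1 + ?L)"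
    using eventually_near[of "\<rho> / (1 + ?L)"] by blast
  obtain N2 where N2: "N2 \<ge> 1" "\<And>k i. k \<ge> N2 \<Longrightarrow> i \<in> set (ret k) \<Longrightarrow>
    norm (B k *v s k i - G xs *v s k i) \<le> \<omega> * norm (s k i)"
    using dennis_more[OF \<omega>(1)] by blast
  have "norm (x k (i + 1) - xs) / norm (x k i - xs) < \<epsilon>"
    if k: "k \<ge> max N1 N2" and i: "i \<in> {1..q}" "i \<in> set (ret k)" for k i
  proof -
    have k1: "k \<ge> 1" using k N1 by simp
    let ?d = "dir k i" and ?y = "x k i"
    have sd: "s k i = lam k i *\<^sub>R ?d" and lam: "lam k i > 0" using run_inner[OF k1 i(1)] by auto
    have Bd: "B k *v ?d = - g ?y"
      by (simp add: linear_neg[OF matrix_vector_mul_linear]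
          matrix_inv_mult_vec(1)[OF pos_def_invertible[OF pos_def_B[OF k1]]])
    have "norm (B k *v s k i - G xs *v s k i) \<le> \<omega> * norm (s k i)" using N2(2) k i by simp
    then have "lam k i * norm (B k *v ?d - G xs *v ?d) \<le> lam k i * (\<omega> * norm ?d)"
      unfolding sd matrix_vector_mult_scaleR using lam
      by (simp only: scaleR_diff_right[symmetric] norm_scaleR) (simp add: mult_ac)
    then have dm: "norm (B k *v ?d - G xs *v ?d) \<le> \<omega> * norm ?d" using lam by simp
    have "norm (?y - xs) < \<rho> / (1 + ?L)" using N1(2)[of k i] k i by simp
    then have y: "(1 + ?L) * norm (?y - xs) < \<rho>" using L by (simp add: field_simps)
    note step = quasi_newton_step[OF Bd dm \<omega>(2-4) less_imp_le[OF \<omega>(1)] \<rho> \<mu>\<rho> y alpha(2) less_trans[OF alpha(1) beta(1)]]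
    have "lam k i = 1" using run_inner(3)[OF k1 i(1)] step(1) by blast
    then have nx: "x k (i + 1) = ?y + ?d" using run_inner(5)[OF k1 i(1)] sd by simp
    have yn: "norm (?y - xs) > 0"
      using nonzero_gradient[OF k1, of i] i(1) gradient_minimizer by auto
    have "norm (x k (i + 1) - xs) \<le> 2 * \<omega> * ?L / m * norm (?y - xs)" unfolding nx by (rule step(2))
    then have "norm (x k (i + 1) - xs) / norm (?y - xs) \<le> 2 * \<omega> * ?L / m"
      using yn by (simp add: divide_le_eq)
    also have "\<dots> \<le> 2 * (\<epsilon> * m / (4 * (?L + 1))) * ?L / m"
      using \<omega>(5) L m by (intro divide_right_mono mult_right_mono mult_left_mono) auto
    also have "\<dots> = \<epsilon> / 2 * (?L / (?L + 1))" using m L by (simp add: divide_simps)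
    also have "\<dots> \<le> \<epsilon> / 2 * 1" using L \<epsilon> by (intro mult_left_mono) auto
    also have "\<dots> < \<epsilon>" using \<epsilon> by simp
    finally show ?thesis .
  qed
  then show ?thesis by (intro exI[of _ "max N1 N2"]) auto
qed

end

theorem theorem5p1:
  fixes f :: "real^'n \<Rightarrow> real"
    and g :: "real^'n \<Rightarrow> real^'n"
    and G :: "real^'n \<Rightarrow> real^'n^'n"
    and x1 xs :: "real^'n"
    and B1 :: "real^'n^'n"
    and q :: nat
    and \<tau> \<alpha> \<beta> M m \<mu> :: real
    and S U :: "(real^'n) set"
    and x s :: "nat \<Rightarrow> nat \<Rightarrow> real^'n"
    and lam :: "nat \<Rightarrow> nat \<Rightarrow> real"
    and B :: "nat \<Rightarrow> real^'n^'n"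
  assumes gradient: "\<And>y. GDERIV f y :> g y"
    and hessian: "\<And>y. (g has_derivative (\<lambda>h. G y *v h)) (at y)"
    and B1: "pos_def B1"
    and q: "q \<ge> 1"
    and tau: "\<tau> > 0"
    and alpha: "0 < \<alpha>" "\<alpha> < 1/2"
    and beta: "\<alpha> < \<beta>" "\<beta> < 1"
    and run: "block_BFGS f g G x1 B1 q \<tau> \<alpha> \<beta> x s lam B"
    and nonzero_gradient: "\<And>k i. k \<ge> 1 \<Longrightarrow> i \<in> {1..q + 1} \<Longrightarrow> g (x k i) \<noteq> 0"
    and convex: "convex_on UNIV f"
    and M: "M > 0" "\<And>y. f y \<le> f x1 \<Longrightarrow> G y \<preceq> M *\<^sub>R \<I>"
    and minimizer: "\<And>y. f xs \<le> f y" "invertible (G xs)"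
    and lipschitz: "xs \<in> interior U" "\<mu>-lipschitz_on U G"
    and S: "xs \<in> interior S" "0 < m" "m \<le> M"
      "\<And>y. y \<in> S \<Longrightarrow> m *\<^sub>R \<I> \<preceq> G y \<and> G y \<preceq> M *\<^sub>R \<I>"
    and tau_le: "\<tau> \<le> m"
  shows "\<forall>\<epsilon>>0. \<exists>K. \<forall>k\<ge>K. k \<ge> 1 \<longrightarrow>
           (\<forall>i\<in>{1..q}. i \<in> set (retained \<tau> (G (x k (q + 1))) (s k) q) \<longrightarrow>
              norm (x k (i + 1) - xs) / norm (x k i - xs) < \<epsilon>)"
proof -
  have "xs \<in> interior (S \<inter> U)" using S(1) lipschitz(1) by simp
  then obtain r where r: "r > 0" "ball xs r \<subseteq> S \<inter> U"
    using mem_interior by blast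
  have xsSU: "xs \<in> S" "xs \<in> U" using r by auto
  interpret block_bfgs_run f g G xs m r \<mu> x1 B1 q \<tau> \<alpha> \<beta> M x s lam B
  proof
    show "m * (norm v)\<^sup>2 \<le> v \<bullet> (G y *v v)" if "y \<in> ball xs r" for y v
      using S(4)[of y] r that by (intro loewner_le_lower) auto
    show "norm (G y - G xs) \<le> \<mu> * norm (y - xs)" if "y \<in> ball xs r" for y
      using lipschitz_onD[OF lipschitz(2), of y xs] r xsSU that by (auto simp: dist_norm)
    show "0 \<le> \<mu>" using lipschitz(2) by (rule lipschitz_on_nonneg)
    show "transpose (G xs) = G xs" using S(4)[OF xsSU(1)] loewner_le_symmetric by blast
  qed (use assms r in auto)
  show ?thesis using superlinear by blast
qed

end
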